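(* Suppose the model $(\xi,\vec h)$ is non-degenerate and $\vec x\in(0,1]^{\mathscr S}\cup\{\vec0\}$ is solvable with $\langle\vec\lambda,\vec x\rangle=q_1$. (a) If $\vec h\ne\vec0$, then $\vec x\in(0,1]^{\mathscr S}$ and $q_1>0$. There is a unique $\vec v\in\mathbb R_{\ge0}^{\mathscr S}$ satisfying $M^*_{\mathrm{sym}}(\vec x)\vec v=\vec0$ and $\langle\vec\lambda,\vec v\rangle=1$. There is a unique tree-descending trajectory with endpoint $\vec x$, which is obtained by solving the tree-descending ODE forward in time from $\Phi(q_1)=\vec x$, $\Phi'(q_1)=\vec v$ until reaching $\|\Phi(q_2)\|_\infty=1$. (b) If $\vec h=\vec0$, then $\vec x=\vec0$ and $q_1=0$. For any $\vec v\in\mathbb R_{\ge0}^{\mathscr S}$ satisfying $\langle\vec\lambda,\vec v\rangle=1$, there is a unique tree-descending trajectory with $\Phi(0)=\vec0$ and $\Phi'(0)=\vec v$, which is obtained by solving the tree-descending ODE forward in time from these conditions until reaching $\|\Phi(q_2)\|_\infty=1$.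
   Context: Let $r\ge1$, $\mathscr S=\{1,\dots,r\}$, $\vec\lambda\in\mathbb R_{>0}^{\mathscr S}$ with $\sum_s\lambda_s=1$, $\vec h\in\mathbb R_{\ge0}^{\mathscr S}$. For each $k\ge2$ let $\Gamma^{(k)}=(\gamma_{s_1,\dots,s_k})\in(\mathbb R_{\ge0}^{\mathscr S})^{\otimes k}$ be a symmetric tensor, with $\sum_{k\ge2}2^k\|\Gamma^{(k)}\|_\infty<\infty$. Define $\xi(\vec x)=\sum_{k\ge2}\sum_{s_1,\dots,s_k}\gamma_{s_1,\dots,s_k}^2(\lambda_{s_1}x_{s_1})\cdots(\lambda_{s_k}x_{s_k})$ and $\xi^s(\vec x)=\lambda_s^{-1}\partial_{x_s}\xi(\vec x)$. The model is non-degenerate if all entries of $\Gamma^{(2)},\Gamma^{(3)}$ are strictly positive. For $\vec x\in(0,1]^{\mathscr S}$ let $$M^*_{\mathrm{sym}}(\vec x)=\mathrm{diag}\Big(\Big(\tfrac{\partial_{x_s}\xi(\vec x)+\lambda_sh_s^2}{x_s}\Big)_{s}\Big)-\big(\partial_{x_s}\partial_{x_{s'}}\xi(\vec x)\big)_{s,s'}.$$ A point $\vec x\in(0,1]^{\mathscr S}$ is solvable if $M^*_{\mathrm{sym}}(\vec x)$ is positive semidefinite and singular. By convention $\vec0$ is solvable exactly when $\vec h=\vec0$. For $0\le q_1\le q_2\le1$, $\mathbb I(q_1,q_2)$ is the set of increasing (i.e. nondecreasing), continuously differentiable functions $[q_1,q_2]\to[0,1]$, and $\mathrm{Adm}(q_1,q_2)$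 is the set of $\Phi=(\Phi_s)_s\in\mathbb I(q_1,q_2)^{\mathscr S}$ with $\langle\vec\lambda,\Phi(q)\rangle=q$ for all $q$. Tree-descending trajectory: for solvable $\vec x$ with $\langle\vec\lambda,\vec x\rangle=q_1$, a tree-descending trajectory with endpoint $\vec x$ is a pair $(p,\Phi)\in\mathbb I(q_1,q_2)\times\mathrm{Adm}(q_1,q_2)$ (for some $q_2\in[q_1,1]$) with $p\equiv1$, $\Phi(q_1)=\vec x$, $M^*_{\mathrm{sym}}(\vec x)\Phi'(q_1)=\vec0$ (a condition imposed only when $\vec x\neq\vec0$), $\|\Phi(q_2)\|_\infty=1$, and satisfying the tree-descending ODE $$\frac1{\Phi_s'(q)}\frac{d}{dq}\sqrt{\frac{\Phi_s'(q)}{(\xi^s\circ\Phi)'(q)}}=\frac1{\Phi_{s'}'(q)}\frac{d}{dq}\sqrt{\frac{\Phi_{s'}'(q)}{(\xi^{s'}\circ\Phi)'(q)}}\qquad\forall s,s'\in\mathscr S,\ q\in[q_1,q_2].$$ (It is implicit that $\Phi$ is regular enough for this to make sense. Where some $\Phi'_s(q)$ vanish, the ODE is read in the equivalent division-free form: there is a number $\Psi(q)$, independent of $s$, with $\Phi_s''(\xi^s\circ\Phi)'-\Phi_s'(\xi^s\circ\Phi)''=2\Psi\,\big(\Phi_s'(\xi^s\circ\Phi)'\big)^{3/2}$ for all $s$.) Together with $\langle\vec\lambda,\Phi''\rangle=0$ (the second derivative of admissibility), this is a second-order ODE for $\Phi$, which is what "solving the ODE forward in time" refers to. *)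

theory Defs
  imports "HOL-Analysis.Analysis" "HOL-Library.Multiset"
begin

text \<open>
  The species set is the finite type \<open>'s\<close>. The tensors \<open>\<Gamma>\<^sup>(\<^sup>k\<^sup>)\<close>, \<open>k \<ge> 2\<close>, are given by one function
  \<open>\<gamma> :: 's list \<Rightarrow> real\<close>: the entry with indices \<open>s\<^sub>1, \<dots>, s\<^sub>k\<close> is \<open>\<gamma> [s\<^sub>1, \<dots>, s\<^sub>k]\<close>.
  Values on lists of length 0 and 1 are never used.
\<close>

definition symmetric_tensors :: "('s::finite list \<Rightarrow> real) \<Rightarrow> bool" where
  "symmetric_tensors \<gamma> \<longleftrightarrow>
     (\<forall>ss ts. 2 \<le> length ss \<and> mset ss = mset ts \<longrightarrow> \<gamma> ss = \<gamma> ts)"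

definition tensor_infnorm :: "('s::finite list \<Rightarrow> real) \<Rightarrow> nat \<Rightarrow> real" where
  "tensor_infnorm \<gamma> k = Max ((\<lambda>ss. \<bar>\<gamma> ss\<bar>) ` {ss. length ss = k})"

definition nondegenerate :: "('s::finite list \<Rightarrow> real) \<Rightarrow> bool" where
  "nondegenerate \<gamma> \<longleftrightarrow> (\<forall>ss. length ss = 2 \<or> length ss = 3 \<longrightarrow> 0 < \<gamma> ss)"

definition xi :: "real^'s \<Rightarrow> ('s::finite list \<Rightarrow> real) \<Rightarrow> real^'s \<Rightarrow> real" where
  "xi lam \<gamma> x =
     (\<Sum>k. \<Sum>ss | length ss = k + 2. (\<gamma> ss)\<^sup>2 * prod_list (map (\<lambda>s. lam $ s * x $ s) ss))"

definition partial :: "'s \<Rightarrow> (real^'s::finite \<Rightarrow> real) \<Rightarrow> real^'s \<Rightarrow> real" where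
  "partial s f x = deriv (\<lambda>t. f (x + t *\<^sub>R axis s 1)) 0"

definition xi_species :: "real^'s \<Rightarrow> ('s::finite list \<Rightarrow> real) \<Rightarrow> 's \<Rightarrow> real^'s \<Rightarrow> real" where
  "xi_species lam \<gamma> s x = partial s (xi lam \<gamma>) x / lam $ s"

definition M_sym ::
    "real^'s \<Rightarrow> ('s::finite list \<Rightarrow> real) \<Rightarrow> real^'s \<Rightarrow> real^'s \<Rightarrow> real^'s^'s" where
  "M_sym lam \<gamma> h x =
     (\<chi> s s'. (if s = s' then (partial s (xi lam \<gamma>) x + lam $ s * (h $ s)\<^sup>2) / x $ s else 0)
               - partial s (partial s' (xi lam \<gamma>)) x)"

definition unit_cube :: "(real^'s::finite) set" where
  "unit_cube = {x. \<forall>s. 0 < x $ s \<and> x $ s \<le> 1}"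

definition pos_semidef :: "real^'s^'s::finite \<Rightarrow> bool" where
  "pos_semidef A \<longleftrightarrow> transpose A = A \<and> (\<forall>v. 0 \<le> v \<bullet> (A *v v))"

definition solvable ::
    "real^'s \<Rightarrow> ('s::finite list \<Rightarrow> real) \<Rightarrow> real^'s \<Rightarrow> real^'s \<Rightarrow> bool" where
  "solvable lam \<gamma> h x \<longleftrightarrow>
     (x = 0 \<and> h = 0) \<or>
     (x \<in> unit_cube \<and> pos_semidef (M_sym lam \<gamma> h x) \<and> \<not> invertible (M_sym lam \<gamma> h x))"

text \<open>
  Derivatives on \<open>[a, b]\<close> are one-sided at the end points. For \<open>a = b\<close> every value is a derivative,
  so on a one-point interval conditions on derivatives are void. This is relevant only for a
  trajectory that starts at a point with \<open>\<parallel>x\<parallel>\<^sub>\<infinity> = 1\<close> and hence consists of that point alone.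
\<close>

definition deriv_on ::
    "real \<Rightarrow> real \<Rightarrow> (real \<Rightarrow> 'a::real_normed_vector) \<Rightarrow> (real \<Rightarrow> 'a) \<Rightarrow> bool" where
  "deriv_on a b f f' \<longleftrightarrow>
     (\<forall>q\<in>{a..b}. (f has_vector_derivative f' q) (at q within {a..b}))"

text \<open>Functions on \<open>[a, b]\<close> are extensional, so that equality is equality on \<open>[a, b]\<close>.\<close>

definition increasing_C1 :: "real \<Rightarrow> real \<Rightarrow> (real \<Rightarrow> real) set" where
  "increasing_C1 a b =
     {f \<in> {a..b} \<rightarrow>\<^sub>E {0..1}. mono_on {a..b} f \<and>
        (\<exists>f'. deriv_on a b f f' \<and> continuous_on {a..b} f')}"

definition Adm :: "real^'s \<Rightarrow> real \<Rightarrow> real \<Rightarrow> (real \<Rightarrow> real^'s::finite) set" where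
  "Adm lam a b =
     {\<Phi>. (\<forall>s. (\<lambda>q. \<Phi> q $ s) \<in> increasing_C1 a b) \<and> (\<forall>q\<in>{a..b}. lam \<bullet> \<Phi> q = q)}"

text \<open>
  \<open>\<Phi>1\<close>, \<open>\<Phi>2\<close> are the first two derivatives of \<open>\<Phi>\<close>, and \<open>G1\<close>, \<open>G2\<close> those of
  \<open>(\<xi>\<^sup>s \<circ> \<Phi>)\<^sub>s\<close>. At times where some component of \<open>\<Phi>1\<close> vanishes the equation
  is taken in the division-free form, with common value \<open>\<Psi>\<close>; both forms
  agree when all components are positive.
\<close>

definition tree_descending_ode ::
    "real^'s \<Rightarrow> ('s::finite list \<Rightarrow> real) \<Rightarrow> real \<Rightarrow> real \<Rightarrow>
     (real \<Rightarrow> real^'s) \<Rightarrow> (real \<Rightarrow> real^'s) \<Rightarrow> (real \<Rightarrow> real^'s) \<Rightarrow> bool" where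
  "tree_descending_ode lam \<gamma> a b \<Phi> \<Phi>1 \<Phi>2 \<longleftrightarrow>
     deriv_on a b \<Phi> \<Phi>1 \<and> deriv_on a b \<Phi>1 \<Phi>2 \<and>
     (\<exists>G1 G2. deriv_on a b (\<lambda>q. \<chi> s. xi_species lam \<gamma> s (\<Phi> q)) G1 \<and> deriv_on a b G1 G2 \<and>
       (\<forall>q\<in>{a..b}.
          if \<forall>s. \<Phi>1 q $ s \<noteq> 0
          then \<exists>R. ((\<lambda>u. \<chi> s. sqrt (\<Phi>1 u $ s / G1 u $ s)) has_vector_derivative R)
                     (at q within {a..b}) \<and>
                   (\<forall>s s'. 1 / \<Phi>1 q $ s * R $ s = 1 / \<Phi>1 q $ s' * R $ s')
          else \<exists>\<Psi>. \<forall>s. \<Phi>2 q $ s * G1 q $ s - \<Phi>1 q $ s * G2 q $ s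
                     = 2 * \<Psi> * (\<Phi>1 q $ s * G1 q $ s) powr (3 / 2)))"

definition tree_descending_trajectory ::
    "real^'s \<Rightarrow> ('s::finite list \<Rightarrow> real) \<Rightarrow> real^'s \<Rightarrow> real^'s \<Rightarrow>
     real \<Rightarrow> (real \<Rightarrow> real) \<Rightarrow> (real \<Rightarrow> real^'s) \<Rightarrow> bool" where
  "tree_descending_trajectory lam \<gamma> h x q2 p \<Phi> \<longleftrightarrow>
     (let q1 = lam \<bullet> x in
        solvable lam \<gamma> h x \<and> q2 \<in> {q1..1} \<and>
        p \<in> increasing_C1 q1 q2 \<and> \<Phi> \<in> Adm lam q1 q2 \<and>
        (\<forall>q\<in>{q1..q2}. p q = 1) \<and>
        \<Phi> q1 = x \<and> infnorm (\<Phi> q2) = 1 \<and>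
        (\<exists>\<Phi>1 \<Phi>2. tree_descending_ode lam \<gamma> q1 q2 \<Phi> \<Phi>1 \<Phi>2 \<and>
           (x \<noteq> 0 \<longrightarrow> M_sym lam \<gamma> h x *v \<Phi>1 q1 = 0)))"

text \<open>
  Solutions on \<open>[a, b]\<close> of the initial value problem for the second-order system consisting of the
  tree-descending ODE and \<open>\<langle>\<lambda>, \<Phi>''\<rangle> = 0\<close>. Components are required to be increasing because the square
  roots and powers in the ODE are meaningful only for \<open>\<Phi>' \<ge> 0\<close>; the bound \<open>\<Phi> \<le> 1\<close> is not imposed.
\<close>

definition ivp_solution ::
    "real^'s \<Rightarrow> ('s::finite list \<Rightarrow> real) \<Rightarrow> real^'s \<Rightarrow> real^'s \<Rightarrow> real \<Rightarrow> real \<Rightarrow>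
     (real \<Rightarrow> real^'s) \<Rightarrow> bool" where
  "ivp_solution lam \<gamma> x v a b \<Phi> \<longleftrightarrow>
     (\<forall>s. mono_on {a..b} (\<lambda>q. \<Phi> q $ s)) \<and>
     (\<exists>\<Phi>1 \<Phi>2. tree_descending_ode lam \<gamma> a b \<Phi> \<Phi>1 \<Phi>2 \<and> (\<forall>q\<in>{a..b}. lam \<bullet> \<Phi>2 q = 0) \<and>
        \<Phi> a = x \<and> \<Phi>1 a = v)"

text \<open>
  \<open>\<Phi>\<close> on \<open>[q\<^sub>1, q\<^sub>2]\<close> is the outcome of solving forward from \<open>\<Phi>(q\<^sub>1) = x\<close>, \<open>\<Phi>'(q\<^sub>1) = v\<close> until
  \<open>\<parallel>\<Phi>\<parallel>\<^sub>\<infinity> = 1\<close>: it solves the initial value problem, every solution on a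
  shorter interval is a restriction of it, and \<open>q\<^sub>2\<close> is the first time the norm reaches 1.
\<close>

definition solved_forward_until_boundary ::
    "real^'s \<Rightarrow> ('s::finite list \<Rightarrow> real) \<Rightarrow> real^'s \<Rightarrow> real^'s \<Rightarrow> real \<Rightarrow> real \<Rightarrow>
     (real \<Rightarrow> real^'s) \<Rightarrow> bool" where
  "solved_forward_until_boundary lam \<gamma> x v q1 q2 \<Phi> \<longleftrightarrow>
     ivp_solution lam \<gamma> x v q1 q2 \<Phi> \<and>
     (\<forall>b\<in>{q1..q2}. \<forall>\<Theta>. ivp_solution lam \<gamma> x v q1 b \<Theta> \<longrightarrow> (\<forall>q\<in>{q1..b}. \<Theta> q = \<Phi> q)) \<and>
     (\<forall>q\<in>{q1..<q2}. infnorm (\<Phi> q) < 1) \<and> infnorm (\<Phi> q2) = 1"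

end

theory Submission
  imports Defs
begin

text \<open>
  Let \<open>A = \<Phi>'\<close>, and let \<open>B\<^sub>s = (\<xi>\<^sup>s \<circ> \<Phi>)' = \<Sum>\<^sub>t H\<^sub>s\<^sub>t(\<Phi>) A\<^sub>t\<close> with \<open>H\<^sub>s\<^sub>t = \<partial>\<^sub>t \<xi>\<^sup>s\<close>. After expanding
  \<open>(\<xi>\<^sup>s \<circ> \<Phi>)''\<close>, the division-free ODE reads
  \<open>\<Phi>''\<^sub>s B\<^sub>s - A\<^sub>s (H \<Phi>'')\<^sub>s - 2 \<Psi> (A\<^sub>s B\<^sub>s)\<^bsup>3/2\<^esup> = A\<^sub>s \<nabla>\<^sup>2\<xi>\<^sup>s(A, A)\<close>.
  Together with \<open>\<langle>\<lambda>, \<Phi>''\<rangle> = 0\<close> this is, for given position and velocity, a square linear system for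
  \<open>(\<Phi>'', \<Psi>)\<close>. Since \<open>H\<close> is positive and \<open>\<lambda>\<^sub>s H\<^sub>s\<^sub>t\<close> is symmetric, the system is nonsingular for every
  velocity \<open>A \<ge> 0\<close> with \<open>\<langle>\<lambda>, A\<rangle> = 1\<close>, including velocities with vanishing components
  (\<open>acc_homogeneous_zero\<close>). Hence the ODE is equivalent to \<open>\<Phi>'' = F(\<Phi>, \<Phi>')\<close> (\<open>ode_imp_field\<close>, \<open>field_imp_ode\<close>) with a
  field \<open>F\<close> that is Lipschitz by compactness (\<open>Lipschitz_on_field\<close>), tangent to the simplex of velocities, and
  satisfies \<open>\<bar>F\<^sub>s\<bar> \<le> M A\<^sub>s\<close> (\<open>field_bound\<close>).

  Existence follows from Picard iteration for \<open>F\<close> composed with retractions of positions and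
  velocities; the bound \<open>\<bar>F\<^sub>s\<bar> \<le> M A\<^sub>s\<close> keeps the velocity in the simplex (\<open>flow_exists\<close>). As \<open>\<langle>\<lambda>, \<Phi> q\<rangle> = q\<close>, the
  norm reaches 1 no later than at time 1 (\<open>flow_until_boundary_exists\<close>). Uniqueness is Gronwall's lemma,
  localised near the given solution because competing solutions may leave the domain in which \<open>\<xi>\<close>
  is controlled (\<open>flow_unique\<close>). The end time is unique since a species that sits at 1 during a time interval
  has velocity 0 there and therefore never moved (\<open>boundary_not_before_end\<close>), whereas a species that
  starts at 1 has positive velocity.

  The initial velocity for \<open>h \<noteq> 0\<close> is the Perron-Frobenius vector of \<open>M_sym\<close>, whose off-diagonal
  entries are negative (\<open>ex1_normalized_kernel_vector\<close>). For \<open>h = 0\<close>, Euler's identity and the positivity of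
  \<open>\<Gamma>\<^sup>(\<^sup>3\<^sup>)\<close> give \<open>\<langle>x, M_sym x\<rangle> < 0\<close> at every \<open>x\<close> with components in \<open>(0, 1]\<close>, so only \<open>x = 0\<close> is solvable.
\<close>

section \<open>Ordinary differential equations with a Lipschitz right-hand side\<close>

lemma picard_lindelof_global:
  fixes F :: "'a::banach \<Rightarrow> 'a"
  assumes lip: "L-lipschitz_on UNIV F" and "a \<le> b"
  obtains y where "y a = y0"
    and "\<And>t. t \<in> {a..b} \<Longrightarrow> (y has_vector_derivative F (y t)) (at t within {a..b})"
proof -
  define M where "M = L + 1"
  have L0: "0 \<le> L" using lip lipschitz_on_nonneg by blast
  then have M: "0 < M" "L \<le> M" by (auto simp: M_def)
  have F_lip: "norm (F u - F v) \<le> M * norm (u - v)" for u v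
  proof -
    have "norm (F u - F v) \<le> L * norm (u - v)"
      using lipschitz_on_normD[OF lip] by auto
    also have "\<dots> \<le> M * norm (u - v)" using M by (intro mult_right_mono) auto
    finally show ?thesis .
  qed
  have F_cont: "continuous_on S (\<lambda>t. F (g t))" if "continuous_on S g" for S and g :: "real \<Rightarrow> 'a"
    using continuous_on_compose2[OF lipschitz_on_continuous_on[OF lip] that] by auto
  define Y where "Y = rec_nat (\<lambda>_. y0) (\<lambda>_ f t. y0 + integral {a..t} (\<lambda>s. F (f s)))"
  have Y0: "Y 0 t = y0" and YS: "Y (Suc n) t = y0 + integral {a..t} (\<lambda>s. F (Y n s))" for n t
    by (simp_all add: Y_def)
  have int_der: "((\<lambda>u. integral {a..u} (\<lambda>s. F (g s))) has_vector_derivative F (g t)) (at t within {a..b})"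
    if "continuous_on {a..b} g" "t \<in> {a..b}" for g t
    using integral_has_vector_derivative[OF F_cont[OF that(1)] that(2)] .
  have Y_cont: "continuous_on {a..b} (Y n)" for n
  proof (induction n)
    case 0
    have "Y 0 = (\<lambda>_. y0)" by (simp add: Y_def)
    then show ?case by (simp add: continuous_on_const)
  next
    case (Suc n)
    have "continuous_on {a..b} (\<lambda>t. integral {a..t} (\<lambda>s. F (Y n s)))"
      using int_der[OF Suc] has_vector_derivative_continuous continuous_on_eq_continuous_within by blast
    moreover have "Y (Suc n) = (\<lambda>t. y0 + integral {a..t} (\<lambda>s. F (Y n s)))" using YS by auto
    ultimately show ?case by (auto intro!: continuous_intros)
  qed
  define C where "C = norm (F y0) * (b - a)"
  have C0: "0 \<le> C" using \<open>a \<le> b\<close> by (simp add: C_def)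
  \<comment> \<open>The weight \<open>exp (2 * M * (t - a))\<close> makes one Picard step a contraction by \<open>1/2\<close>
  on the whole interval, whatever its length.\<close>
  have step: "norm (Y (Suc n) t - Y n t) \<le> C * (1/2)^n * exp (2 * M * (t - a))" if "t \<in> {a..b}" for n t
    using that
  proof (induction n arbitrary: t)
    case 0
    have "norm (Y (Suc 0) t - Y 0 t) = (t - a) * norm (F y0)"
      using 0 by (simp add: YS Y0)
    also have "\<dots> \<le> (b - a) * norm (F y0)" using 0 by (intro mult_right_mono) auto
    also have "\<dots> \<le> C * exp (2 * M * (t - a))"
      using C0 M 0 mult_left_mono[of 1 "exp (2 * M * (t - a))" C] by (simp add: C_def mult.commute)
    finally show ?case by simp
  next
    case (Suc n)
    have sub: "{a..t} \<subseteq> {a..b}" using Suc.prems by auto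
    have ci: "(\<lambda>s. F (Y m s)) integrable_on {a..t}" for m
      by (intro integrable_continuous_real F_cont continuous_on_subset[OF Y_cont sub])
    define e where "e = C * (1/2)^n"
    have e0: "0 \<le> e" using C0 by (simp add: e_def)
    have hi: "((\<lambda>s. M * e * exp (2 * M * (s - a))) has_integral
        (e / 2 * exp (2 * M * (t - a)) - e / 2 * exp (2 * M * (a - a)))) {a..t}"
    proof (rule fundamental_theorem_of_calculus)
      show "a \<le> t" using Suc.prems by auto
      show "((\<lambda>s. e / 2 * exp (2 * M * (s - a))) has_vector_derivative M * e * exp (2 * M * (s - a)))
          (at s within {a..t})" for s
        unfolding has_real_derivative_iff_has_vector_derivative[symmetric]
        by (auto intro!: derivative_eq_intros)
    qed
    have "norm (Y (Suc (Suc n)) t - Y (Suc n) t)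
        = norm (integral {a..t} (\<lambda>s. F (Y (Suc n) s) - F (Y n s)))"
      by (simp only: YS[of "Suc n" t] YS[of n t] integral_diff[OF ci ci]) simp
    also have "\<dots> \<le> integral {a..t} (\<lambda>s. M * e * exp (2 * M * (s - a)))"
    proof (rule integral_norm_bound_integral)
      show "(\<lambda>s. F (Y (Suc n) s) - F (Y n s)) integrable_on {a..t}" using ci integrable_diff by blast
      show "(\<lambda>s. M * e * exp (2 * M * (s - a))) integrable_on {a..t}" using hi by blast
      fix s assume s: "s \<in> {a..t}"
      have "norm (F (Y (Suc n) s) - F (Y n s)) \<le> M * norm (Y (Suc n) s - Y n s)" by (rule F_lip)
      also have "\<dots> \<le> M * (C * (1/2)^n * exp (2 * M * (s - a)))"
        using s sub M by (intro mult_left_mono Suc.IH) auto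
      finally show "norm (F (Y (Suc n) s) - F (Y n s)) \<le> M * e * exp (2 * M * (s - a))"
        by (simp add: e_def mult.assoc)
    qed
    also have "\<dots> = e / 2 * exp (2 * M * (t - a)) - e / 2"
      using integral_unique[OF hi] by simp
    also have "\<dots> \<le> e / 2 * exp (2 * M * (t - a))" using e0 by simp
    finally show ?case by (simp add: e_def)
  qed
  have "uniform_limit {a..b} (\<lambda>n t. \<Sum>i<n. Y (Suc i) t - Y i t)
      (\<lambda>t. \<Sum>i. Y (Suc i) t - Y i t) sequentially"
  proof (rule Weierstrass_m_test)
    show "norm (Y (Suc n) t - Y n t) \<le> C * exp (2 * M * (b - a)) * (1/2)^n" if "t \<in> {a..b}" for n t
    proof -
      have "norm (Y (Suc n) t - Y n t) \<le> C * (1/2)^n * exp (2 * M * (t - a))" using step that by blast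
      also have "\<dots> \<le> C * (1/2)^n * exp (2 * M * (b - a))"
        using that M C0 by (intro mult_left_mono) auto
      finally show ?thesis by (simp add: mult_ac)
    qed
    show "summable (\<lambda>n. C * exp (2 * M * (b - a)) * (1/2)^n)"
      by (intro summable_mult summable_geometric) auto
  qed
  then have "uniform_limit {a..b} (\<lambda>n t. y0 + (\<Sum>i<n. Y (Suc i) t - Y i t))
      (\<lambda>t. y0 + (\<Sum>i. Y (Suc i) t - Y i t)) sequentially"
    by (intro uniform_limit_intros)
  moreover have "y0 + (\<Sum>i<n. Y (Suc i) t - Y i t) = Y n t" for n t
    by (simp add: sum_lessThan_telescope[of "\<lambda>i. Y i t"] Y0)
  ultimately obtain y where y: "uniform_limit {a..b} Y y sequentially" by auto
  have y_cont: "continuous_on {a..b} y"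
    by (rule uniform_limit_theorem[OF _ y]) (auto simp: Y_cont)
  have fix_eq: "y t = y0 + integral {a..t} (\<lambda>s. F (y s))" if t: "t \<in> {a..b}" for t
  proof -
    have sub: "{a..t} \<subseteq> {a..b}" using t by auto
    have "uniform_limit {a..t} (\<lambda>n s. F (Y n s)) (\<lambda>s. F (y s)) sequentially"
      by (rule uniform_limit_compose_uniformly_continuous_on[OF uniform_limit_on_subset[OF y sub]
            lipschitz_on_uniformly_continuous[OF lip]]) auto
    from uniform_limit_integral[OF this F_cont[OF continuous_on_subset[OF Y_cont sub]]]
    obtain I J where IJ: "\<And>n. ((\<lambda>s. F (Y n s)) has_integral I n) {a..t}"
      "((\<lambda>s. F (y s)) has_integral J) {a..t}" "I \<longlonglongrightarrow> J"
      by auto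
    have "Y (Suc n) t = y0 + I n" for n using IJ(1)[of n] by (simp add: YS integral_unique)
    then have "(\<lambda>n. Y (Suc n) t) \<longlonglongrightarrow> y0 + J" using IJ(3) by (auto intro!: tendsto_intros)
    moreover have "(\<lambda>n. Y (Suc n) t) \<longlonglongrightarrow> y t"
      using LIMSEQ_Suc[OF tendsto_uniform_limitI[OF y t]] .
    ultimately show ?thesis using LIMSEQ_unique IJ(2) by (metis integral_unique)
  qed
  show thesis
  proof (rule that[of y])
    show "y a = y0" using fix_eq[of a] \<open>a \<le> b\<close> by simp
    fix t assume t: "t \<in> {a..b}"
    have "((\<lambda>u. y0 + integral {a..u} (\<lambda>s. F (y s))) has_vector_derivative F (y t)) (at t within {a..b})"
      using has_vector_derivative_add[OF has_vector_derivative_const int_der[OF y_cont t]] by simp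
    then show "(y has_vector_derivative F (y t)) (at t within {a..b})"
      by (rule has_vector_derivative_transform_within[of _ _ _ _ 1]) (use t fix_eq in auto)
  qed
qed

lemma last_zero:
  fixes f :: "real \<Rightarrow> real"
  assumes cont: "continuous_on {a..t} f" and "a \<le> t" and a: "0 \<le> f a" and t: "f t < 0"
  obtains s where "a \<le> s" "s < t" "f s = 0" "\<And>q. s < q \<Longrightarrow> q \<le> t \<Longrightarrow> f q < 0"
proof -
  define S where "S = {q \<in> {a..t}. f q \<in> {0..}}"
  have "closed S"
    using continuous_closed_preimage[OF cont, of "{0..}"] by (simp add: S_def vimage_def Int_def)
  moreover have "bounded S" by (rule bounded_subset[of "{a..t}"]) (auto simp: S_def)
  ultimately have "compact S" by (simp add: compact_eq_bounded_closed)
  moreover have "a \<in> S" using a \<open>a \<le> t\<close> by (simp add: S_def)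
  ultimately obtain s where s: "s \<in> S" "\<And>q. q \<in> S \<Longrightarrow> q \<le> s" using compact_attains_sup[of S] by blast
  have s': "a \<le> s" "s < t" "0 \<le> f s" using s(1) t by (auto simp: S_def less_le)
  have neg: "f q < 0" if "s < q" "q \<le> t" for q
    using s(2)[of q] that s'(1) by (force simp: S_def)
  have "f s = 0"
  proof -
    have "continuous_on {s..t} f" by (rule continuous_on_subset[OF cont]) (use s' in auto)
    then obtain c where "s \<le> c" "c \<le> t" "f c = 0" using IVT2'[of f t 0 s] s' t by auto
    then show ?thesis using neg[of c] by (cases "c = s") auto
  qed
  then show thesis using that s' neg by blast
qed

text \<open>
  A local form of Gronwall's lemma: the differential inequality is needed only where \<open>D\<close> is
  below some threshold, since \<open>D\<close> would have to leave 0 through small values.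
\<close>

lemma gronwall_zero:
  fixes D :: "real \<Rightarrow> real"
  assumes cont: "continuous_on {a..b} D" and "D a = 0" and nonneg: "\<And>q. q \<in> {a..b} \<Longrightarrow> 0 \<le> D q"
    and "0 < e"
    and der: "\<And>q. q \<in> {a<..<b} \<Longrightarrow> D q < e \<Longrightarrow> \<exists>D'. (D has_real_derivative D') (at q) \<and> D' \<le> L * D q"
    and t: "t \<in> {a..b}"
  shows "D t = 0"
proof (rule ccontr)
  assume "D t \<noteq> 0"
  then have Dt: "- D t < 0" using nonneg[OF t] by simp
  have "continuous_on {a..t} (\<lambda>q. - D q)"
    by (intro continuous_intros continuous_on_subset[OF cont]) (use t in auto)
  then obtain s where s: "a \<le> s" "s < t" "- D s = 0" and neg: "\<And>q. s < q \<Longrightarrow> q \<le> t \<Longrightarrow> - D q < 0"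
    by (rule last_zero[of a t "\<lambda>q. - D q"]) (use Dt t \<open>D a = 0\<close> in auto)
  have sab: "s \<in> {a..b}" using s t by auto
  obtain d where d: "d > 0" "\<And>q. q \<in> {a..b} \<Longrightarrow> dist q s < d \<Longrightarrow> dist (D q) (D s) < e"
    using cont[unfolded continuous_on_iff, rule_format, OF sab \<open>0 < e\<close>] by blast
  define t' where "t' = min t (s + d / 2)"
  have t': "s < t'" "t' \<le> t" "t' \<le> s + d/2" using s d(1) by (auto simp: t'_def)
  have "D t' * exp (- L * t') \<le> D s * exp (- L * s)"
  proof (rule DERIV_nonpos_imp_decreasing_open[where f = "\<lambda>q. D q * exp (- L * q)"])
    show "s \<le> t'" using t' by simp
    show "continuous_on {s..t'} (\<lambda>q. D q * exp (- L * q))"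
      by (intro continuous_intros continuous_on_subset[OF cont]) (use s t' t in auto)
    fix q assume q: "s < q" "q < t'"
    have qab: "q \<in> {a<..<b}" using q s t' t by auto
    have "D q < e" using d(2)[of q] q qab t' s by (auto simp: dist_real_def)
    then obtain D' where D': "(D has_real_derivative D') (at q)" "D' \<le> L * D q" using der qab by blast
    have "((\<lambda>q. D q * exp (- L * q)) has_real_derivative (D' - L * D q) * exp (- L * q)) (at q)"
      using D'(1) by (auto intro!: derivative_eq_intros simp: algebra_simps)
    moreover have "(D' - L * D q) * exp (- L * q) \<le> 0" using D'(2) by (intro mult_nonpos_nonneg) auto
    ultimately show "\<exists>y. ((\<lambda>q. D q * exp (- L * q)) has_real_derivative y) (at q) \<and> y \<le> 0" by blast
  qed
  then have "D t' \<le> 0" using s(3) by (simp add: mult_le_0_iff)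
  then show False using neg[of t'] t' by simp
qed

section \<open>Lipschitz dependence of solutions of linear systems\<close>

lemma lipschitz_on_mult_compact:
  fixes f g :: "'a::metric_space \<Rightarrow> real"
  assumes K: "compact K" and f: "L-lipschitz_on K f" and g: "M-lipschitz_on K g"
  shows "\<exists>N. N-lipschitz_on K (\<lambda>z. f z * g z)"
proof -
  have bd: "\<exists>C\<ge>0. \<forall>z\<in>K. \<bar>h z\<bar> \<le> C" if "N-lipschitz_on K h" for h :: "'a \<Rightarrow> real" and N
  proof -
    have "bounded (h ` K)"
      by (intro compact_imp_bounded compact_continuous_image lipschitz_on_continuous_on[OF that] K)
    then obtain C where "C > 0" "\<forall>z\<in>h ` K. norm z \<le> C" unfolding bounded_pos by blast
    then show ?thesis by (intro exI[of _ C]) auto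
  qed
  obtain C where C: "C \<ge> 0" "\<And>z. z \<in> K \<Longrightarrow> \<bar>f z\<bar> \<le> C" using bd[OF f] by blast
  obtain D where D: "D \<ge> 0" "\<And>z. z \<in> K \<Longrightarrow> \<bar>g z\<bar> \<le> D" using bd[OF g] by blast
  have L: "0 \<le> L" and M: "0 \<le> M" using f g lipschitz_on_nonneg by blast+
  have "(C * M + D * L)-lipschitz_on K (\<lambda>z. f z * g z)"
  proof (rule lipschitz_onI)
    fix y z assume yz: "y \<in> K" "z \<in> K"
    have "dist (f y * g y) (f z * g z) = \<bar>f y * (g y - g z) + g z * (f y - f z)\<bar>"
      by (simp add: dist_real_def algebra_simps)
    also have "\<dots> \<le> \<bar>f y\<bar> * \<bar>g y - g z\<bar> + \<bar>g z\<bar> * \<bar>f y - f z\<bar>"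
      by (metis abs_mult abs_triangle_ineq)
    also have "\<dots> \<le> C * (M * dist y z) + D * (L * dist y z)"
      using lipschitz_onD[OF f yz] lipschitz_onD[OF g yz] C D yz L M
      by (intro add_mono mult_mono) (auto simp: dist_real_def)
    finally show "dist (f y * g y) (f z * g z) \<le> (C * M + D * L) * dist y z"
      by (simp add: algebra_simps)
  qed (use C D L M in auto)
  then show ?thesis by blast
qed

lemma lipschitz_on_sum:
  fixes f :: "'i \<Rightarrow> 'a::metric_space \<Rightarrow> 'b::real_normed_vector"
  assumes "finite I" "\<And>i. i \<in> I \<Longrightarrow> \<exists>L. L-lipschitz_on K (f i)"
  shows "\<exists>L. L-lipschitz_on K (\<lambda>z. \<Sum>i\<in>I. f i z)"
  using assms
proof (induction I rule: finite_induct)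
  case empty
  then show ?case using lipschitz_on_constant by fastforce
next
  case (insert i I)
  obtain L where L: "L-lipschitz_on K (f i)" using insert.prems by blast
  obtain M where M: "M-lipschitz_on K (\<lambda>z. \<Sum>i\<in>I. f i z)" using insert.IH insert.prems by blast
  from lipschitz_on_add[OF L M] show ?case using insert.hyps by auto
qed

lemma lipschitz_on_vec:
  fixes f :: "'a::metric_space \<Rightarrow> real^'n"
  assumes "\<And>i. \<exists>L. L-lipschitz_on K (\<lambda>z. f z $ i)"
  shows "\<exists>L. L-lipschitz_on K f"
proof -
  have "\<exists>L. L-lipschitz_on K (\<lambda>z. f z $ i *\<^sub>R axis i (1::real))" for i
  proof -
    obtain L where L: "L-lipschitz_on K (\<lambda>z. f z $ i)" using assms by blast
    have "L-lipschitz_on K (\<lambda>z. f z $ i *\<^sub>R axis i (1::real))"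
      using lipschitz_onD[OF L] lipschitz_on_nonneg[OF L]
      by (intro lipschitz_onI) (simp_all add: dist_norm scaleR_diff_left[symmetric])
    then show ?thesis by blast
  qed
  then have "\<exists>L. L-lipschitz_on K (\<lambda>z. \<Sum>i\<in>UNIV. f z $ i *\<^sub>R axis i (1::real))"
    by (intro lipschitz_on_sum) auto
  moreover have "(\<Sum>i\<in>UNIV. x $ i *\<^sub>R axis i (1::real)) = x" for x :: "real^'n"
    using basis_expansion[of x] by (simp add: scalar_mult_eq_scaleR)
  ultimately show ?thesis by simp
qed

lemma lipschitz_on_powr_three_halves:
  fixes f :: "'a::metric_space \<Rightarrow> real"
  assumes K: "compact K" and f: "L-lipschitz_on K f" and nonneg: "\<And>z. z \<in> K \<Longrightarrow> 0 \<le> f z"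
  shows "\<exists>N. N-lipschitz_on K (\<lambda>z. f z powr (3/2))"
proof -
  have "bounded (f ` K)"
    by (intro compact_imp_bounded compact_continuous_image lipschitz_on_continuous_on[OF f] K)
  then obtain C where C: "C > 0" "\<And>z. z \<in> K \<Longrightarrow> f z \<le> C" unfolding bounded_pos by fastforce
  have eq: "t powr (3/2) = t * sqrt t" if "0 \<le> t" for t :: real
    using powr_add[of t 1 "1/2"] that powr_half_sqrt[OF that] by (cases "t = 0") auto
  have L: "0 \<le> L" using f lipschitz_on_nonneg by blast
  have key: "\<bar>t * sqrt t - u * sqrt u\<bar> \<le> 2 * sqrt C * \<bar>t - u\<bar>"
    if "0 \<le> u" "u \<le> t" "t \<le> C" for t u
  proof -
    have 1: "u * sqrt u \<le> t * sqrt t" using that by (intro mult_mono) auto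
    have "u * sqrt t \<le> t * sqrt u"
    proof -
      have "u * sqrt t = (sqrt u * sqrt t) * sqrt u" using that by simp
      also have "\<dots> \<le> (sqrt t * sqrt t) * sqrt u" using that by (intro mult_right_mono) auto
      finally show ?thesis using that by simp
    qed
    then have "t * sqrt t - u * sqrt u \<le> (t - u) * (sqrt t + sqrt u)"
      using 1 by (simp add: algebra_simps)
    also have "\<dots> \<le> (t - u) * (sqrt C + sqrt C)"
      using that by (intro mult_left_mono add_mono real_sqrt_le_mono) auto
    finally show ?thesis using 1 that by (simp add: mult_ac)
  qed
  have "(2 * sqrt C * L)-lipschitz_on K (\<lambda>z. f z powr (3/2))"
  proof (rule lipschitz_onI)
    fix y z assume yz: "y \<in> K" "z \<in> K"
    have "\<bar>f y * sqrt (f y) - f z * sqrt (f z)\<bar> \<le> 2 * sqrt C * \<bar>f y - f z\<bar>"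
      using key[of "f y" "f z"] key[of "f z" "f y"] nonneg[OF yz(1)] nonneg[OF yz(2)] C(2)[OF yz(1)] C(2)[OF yz(2)]
      by (metis abs_minus_commute linear)
    also have "\<dots> \<le> 2 * sqrt C * (L * dist y z)"
      using lipschitz_onD[OF f yz] C(1) by (intro mult_left_mono) (auto simp: dist_real_def)
    finally show "dist (f y powr (3/2)) (f z powr (3/2)) \<le> 2 * sqrt C * L * dist y z"
      using nonneg yz by (simp add: eq dist_real_def mult.assoc)
  qed (use C L in auto)
  then show ?thesis by blast
qed

text \<open>
  Being Lipschitz on \<open>K\<close> for an unspecified constant. On compact \<open>K\<close> this is closed under products,
  which is what makes it convenient for expressions built from many factors.
\<close>

definition Lipschitz_on :: "'a::metric_space set \<Rightarrow> ('a \<Rightarrow> 'b::metric_space) \<Rightarrow> bool" where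
  "Lipschitz_on K f \<longleftrightarrow> (\<exists>L. L-lipschitz_on K f)"

lemma Lipschitz_on_const: "Lipschitz_on K (\<lambda>z. c)"
  unfolding Lipschitz_on_def by (rule exI, rule lipschitz_on_constant)

lemma Lipschitz_on_add:
  fixes f g :: "'a::metric_space \<Rightarrow> 'b::real_normed_vector"
  shows "Lipschitz_on K f \<Longrightarrow> Lipschitz_on K g \<Longrightarrow> Lipschitz_on K (\<lambda>z. f z + g z)"
  unfolding Lipschitz_on_def by (elim exE) (rule exI, rule lipschitz_on_add)

lemma Lipschitz_on_diff:
  fixes f g :: "'a::metric_space \<Rightarrow> 'b::real_normed_vector"
  shows "Lipschitz_on K f \<Longrightarrow> Lipschitz_on K g \<Longrightarrow> Lipschitz_on K (\<lambda>z. f z - g z)"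
  unfolding Lipschitz_on_def by (elim exE) (rule exI, rule lipschitz_on_diff)

lemma Lipschitz_on_mult:
  fixes f g :: "'a::metric_space \<Rightarrow> real"
  shows "compact K \<Longrightarrow> Lipschitz_on K f \<Longrightarrow> Lipschitz_on K g \<Longrightarrow> Lipschitz_on K (\<lambda>z. f z * g z)"
  unfolding Lipschitz_on_def by (elim exE) (rule lipschitz_on_mult_compact)

lemma Lipschitz_on_sum:
  fixes f :: "'i \<Rightarrow> 'a::metric_space \<Rightarrow> 'b::real_normed_vector"
  shows "finite I \<Longrightarrow> (\<And>i. i \<in> I \<Longrightarrow> Lipschitz_on K (f i)) \<Longrightarrow> Lipschitz_on K (\<lambda>z. \<Sum>i\<in>I. f i z)"
  unfolding Lipschitz_on_def by (rule lipschitz_on_sum)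

lemma Lipschitz_on_vec:
  fixes f :: "'a::metric_space \<Rightarrow> real^'n"
  shows "(\<And>i. Lipschitz_on K (\<lambda>z. f z $ i)) \<Longrightarrow> Lipschitz_on K f"
  unfolding Lipschitz_on_def by (rule lipschitz_on_vec)

lemma Lipschitz_on_Pair: "Lipschitz_on K f \<Longrightarrow> Lipschitz_on K g \<Longrightarrow> Lipschitz_on K (\<lambda>z. (f z, g z))"
  unfolding Lipschitz_on_def by (elim exE) (rule exI, rule lipschitz_on_Pair)

lemma Lipschitz_on_powr_three_halves:
  fixes f :: "'a::metric_space \<Rightarrow> real"
  shows "compact K \<Longrightarrow> Lipschitz_on K f \<Longrightarrow> (\<And>z. z \<in> K \<Longrightarrow> 0 \<le> f z) \<Longrightarrow> Lipschitz_on K (\<lambda>z. f z powr (3/2))"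
  unfolding Lipschitz_on_def by (elim exE) (rule lipschitz_on_powr_three_halves)

lemma Lipschitz_on_compose: "Lipschitz_on X f \<Longrightarrow> Lipschitz_on Y g \<Longrightarrow> f ` X \<subseteq> Y \<Longrightarrow> Lipschitz_on X (\<lambda>z. g (f z))"
  unfolding Lipschitz_on_def by (elim exE) (rule exI, rule lipschitz_on_compose2, assumption, erule lipschitz_on_subset)

lemma Lipschitz_on_continuous_on: "Lipschitz_on K f \<Longrightarrow> continuous_on K f"
  unfolding Lipschitz_on_def by (elim exE) (rule lipschitz_on_continuous_on)

lemma Lipschitz_on_nonexpansive: "(\<And>y z. dist (f y) (f z) \<le> dist y z) \<Longrightarrow> Lipschitz_on K f"
  unfolding Lipschitz_on_def by (intro exI[of _ 1] lipschitz_onI) auto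

lemma Lipschitz_on_cmult:
  fixes f :: "'a::metric_space \<Rightarrow> real"
  shows "Lipschitz_on K f \<Longrightarrow> Lipschitz_on K (\<lambda>z. c * f z)"
  unfolding Lipschitz_on_def by (elim exE) (rule exI, rule lipschitz_on_cmult_real)

lemma Lipschitz_on_quotient:
  fixes f N :: "'a::metric_space \<Rightarrow> real"
  assumes f: "Lipschitz_on K f" and N: "Lipschitz_on K N"
    and N1: "\<And>z. z \<in> K \<Longrightarrow> 1 \<le> N z" and fN: "\<And>z. z \<in> K \<Longrightarrow> \<bar>f z\<bar> \<le> C * N z"
  shows "Lipschitz_on K (\<lambda>z. f z / N z)"
proof (cases "K = {}")
  case True
  then show ?thesis by (auto simp: Lipschitz_on_def intro!: exI[of _ 0])
next
  case False
  then obtain z where z: "z \<in> K" by blast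
  have "0 \<le> C * N z" using fN[OF z] abs_ge_zero order_trans by blast
  then have C: "0 \<le> C" using N1[OF z] by (simp add: zero_le_mult_iff)
  obtain L where L: "L-lipschitz_on K f" using f by (auto simp: Lipschitz_on_def)
  obtain M where M: "M-lipschitz_on K N" using N by (auto simp: Lipschitz_on_def)
  have "(L + C * M)-lipschitz_on K (\<lambda>z. f z / N z)"
  proof (rule lipschitz_onI)
    fix y z assume yz: "y \<in> K" "z \<in> K"
    have Np: "1 \<le> N y" "1 \<le> N z" using N1 yz by auto
    have "f y / N y - f z / N z = ((f y - f z) + f z / N z * (N z - N y)) / N y"
      using Np by (simp add: field_simps)
    also have "\<bar>\<dots>\<bar> \<le> \<bar>(f y - f z) + f z / N z * (N z - N y)\<bar> / 1"
      using Np by (simp add: abs_divide) (intro divide_left_mono[of 1 "N y", simplified]; simp)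
    also have "\<dots> \<le> \<bar>f y - f z\<bar> + \<bar>f z / N z\<bar> * \<bar>N z - N y\<bar>"
      using abs_triangle_ineq[of "f y - f z" "f z / N z * (N z - N y)"] by (simp add: abs_mult)
    also have "\<dots> \<le> L * dist y z + C * (M * dist y z)"
    proof (rule add_mono)
      show "\<bar>f y - f z\<bar> \<le> L * dist y z" using lipschitz_onD[OF L yz] by (simp add: dist_real_def)
      have "\<bar>f z / N z\<bar> \<le> C" using fN[OF yz(2)] Np by (simp add: divide_le_eq)
      then show "\<bar>f z / N z\<bar> * \<bar>N z - N y\<bar> \<le> C * (M * dist y z)"
        using lipschitz_onD[OF M yz] C by (intro mult_mono) (auto simp: dist_real_def abs_minus_commute)
    qed
    finally show "dist (f y / N y) (f z / N z) \<le> (L + C * M) * dist y z"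
      by (simp add: dist_real_def algebra_simps)
  qed (use C L M lipschitz_on_nonneg in \<open>auto intro!: add_nonneg_nonneg mult_nonneg_nonneg\<close>)
  then show ?thesis unfolding Lipschitz_on_def by blast
qed

lemma linear_eq_sum_Basis:
  fixes P :: "'y::euclidean_space \<Rightarrow> 'x::real_vector"
  assumes "linear P"
  shows "P y = (\<Sum>b\<in>Basis. (y \<bullet> b) *\<^sub>R P b)"
  using linear_sum[OF assms, of "\<lambda>b. (y \<bullet> b) *\<^sub>R b" Basis]
  by (simp add: euclidean_representation linear_scale[OF assms])

text \<open>
  The solution of a linear system whose matrix and right-hand side are Lipschitz in a parameter
  ranging over a compact set, and whose matrix is always injective, is Lipschitz in the parameter:
  by compactness the inverses are uniformly bounded.
\<close>

lemma Lipschitz_on_linear_system_solution: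
  fixes P :: "'z::metric_space \<Rightarrow> 'y::euclidean_space \<Rightarrow> 'y" and g Y :: "'z \<Rightarrow> 'y"
  assumes K: "compact K"
    and lin: "\<And>z. z \<in> K \<Longrightarrow> linear (P z)"
    and P_lip: "\<And>y. Lipschitz_on K (\<lambda>z. P z y)"
    and inj: "\<And>z y. z \<in> K \<Longrightarrow> P z y = 0 \<Longrightarrow> y = 0"
    and g_lip: "Lipschitz_on K g"
    and sol: "\<And>z. z \<in> K \<Longrightarrow> P z (Y z) = g z"
  shows "Lipschitz_on K Y"
proof (cases "K = {}")
  case True
  then show ?thesis by (auto simp: Lipschitz_on_def intro!: exI[of _ 0])
next
  case False
  have P_sum: "P z y = (\<Sum>b\<in>Basis. (y \<bullet> b) *\<^sub>R P z b)" if "z \<in> K" for z y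
    by (rule linear_eq_sum_Basis[OF lin[OF that]])
  \<comment> \<open>\<open>c\<close> is a lower bound of \<open>P z\<close> on unit vectors that does not depend on \<open>z\<close>.\<close>
  define S where "S = K \<times> sphere (0::'y) 1"
  have "compact S" using K by (auto simp: S_def intro!: compact_Times)
  moreover have "S \<noteq> {}" using False by (simp add: S_def)
  moreover have "continuous_on S (\<lambda>p. norm (P (fst p) (snd p)))"
  proof -
    have "continuous_on S (\<lambda>p. P (fst p) b)" for b
      by (rule continuous_on_compose2[OF Lipschitz_on_continuous_on[OF P_lip]])
        (auto simp: S_def intro!: continuous_intros)
    then have "continuous_on S (\<lambda>p. norm (\<Sum>b\<in>Basis. (snd p \<bullet> b) *\<^sub>R P (fst p) b))"
      by (intro continuous_intros)
    then show ?thesis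
      by (rule continuous_on_eq) (auto simp: S_def P_sum[symmetric])
  qed
  ultimately obtain p where p: "p \<in> S" "\<And>q. q \<in> S \<Longrightarrow>
      norm (P (fst p) (snd p)) \<le> norm (P (fst q) (snd q))"
    using continuous_attains_inf[of S "\<lambda>p. norm (P (fst p) (snd p))"] by blast
  define c where "c = norm (P (fst p) (snd p))"
  have c: "0 < c"
    using p(1) inj[of "fst p" "snd p"] by (auto simp: c_def S_def)
  have low: "c * norm y \<le> norm (P z y)" if z: "z \<in> K" for z y
  proof (cases "y = 0")
    case False
    have "(z, (1 / norm y) *\<^sub>R y) \<in> S" using z False by (simp add: S_def)
    from p(2)[OF this] have "c \<le> norm (P z ((1 / norm y) *\<^sub>R y))" by (simp add: c_def)
    also have "\<dots> = norm (P z y) / norm y" by (simp add: linear_scale[OF lin[OF z]])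
    finally show ?thesis using False by (simp add: field_simps)
  qed simp
  obtain L where L: "\<And>b. (L b)-lipschitz_on K (\<lambda>z. P z b)" using P_lip unfolding Lipschitz_on_def by metis
  have L0: "0 \<le> L b" for b using L lipschitz_on_nonneg by blast
  define L' where "L' = (\<Sum>b\<in>Basis. L b)"
  have L'0: "0 \<le> L'" by (simp add: L'_def sum_nonneg L0)
  have P_diff: "norm (P z y - P z' y) \<le> L' * dist z z' * norm y" if zz: "z \<in> K" "z' \<in> K" for y z z'
  proof -
    have "P z y - P z' y = (\<Sum>b\<in>Basis. (y \<bullet> b) *\<^sub>R (P z b - P z' b))"
      using zz by (simp add: P_sum[of z y] P_sum[of z' y] sum_subtractf scaleR_diff_right)
    also have "norm \<dots> \<le> (\<Sum>b\<in>Basis. norm y * (L b * dist z z'))"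
    proof (rule sum_norm_le)
      fix b :: 'y assume b: "b \<in> Basis"
      show "norm ((y \<bullet> b) *\<^sub>R (P z b - P z' b)) \<le> norm y * (L b * dist z z')"
        unfolding norm_scaleR
        using lipschitz_onD[OF L zz, of b] Basis_le_norm[OF b, of y]
        by (intro mult_mono) (auto simp: dist_norm)
    qed
    also have "\<dots> = L' * dist z z' * norm y"
      by (simp add: L'_def sum_distrib_left sum_distrib_right mult_ac)
    finally show ?thesis .
  qed
  obtain M where g_lip: "M-lipschitz_on K g" using g_lip unfolding Lipschitz_on_def by blast
  have "bounded (g ` K)"
    by (intro compact_imp_bounded compact_continuous_image lipschitz_on_continuous_on[OF g_lip] K)
  then obtain C where C: "C > 0" "\<And>z. z \<in> K \<Longrightarrow> norm (g z) \<le> C" unfolding bounded_pos by fastforce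
  have Y_bd: "norm (Y z) \<le> C / c" if z: "z \<in> K" for z
    using low[OF z, of "Y z"] sol[OF z] C(2)[OF z] c by (simp add: field_simps)
  have M: "0 \<le> M" using g_lip lipschitz_on_nonneg by blast
  have "((M + L' * (C / c)) / c)-lipschitz_on K Y"
  proof (rule lipschitz_onI)
    fix z z' assume zz: "z \<in> K" "z' \<in> K"
    have "P z (Y z - Y z') = (g z - g z') - (P z (Y z') - P z' (Y z'))"
      using zz by (simp add: linear_diff[OF lin[OF zz(1)]] sol)
    then have "c * norm (Y z - Y z') \<le> norm ((g z - g z') - (P z (Y z') - P z' (Y z')))"
      using low[OF zz(1)] by metis
    also have "\<dots> \<le> norm (g z - g z') + norm (P z (Y z') - P z' (Y z'))"
      by (rule norm_triangle_ineq4)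
    also have "\<dots> \<le> M * dist z z' + L' * dist z z' * (C / c)"
    proof (rule add_mono)
      show "norm (g z - g z') \<le> M * dist z z'" using lipschitz_onD[OF g_lip zz] by (simp add: dist_norm)
      have "norm (P z (Y z') - P z' (Y z')) \<le> L' * dist z z' * norm (Y z')" by (rule P_diff[OF zz])
      also have "\<dots> \<le> L' * dist z z' * (C / c)"
        using Y_bd[OF zz(2)] L'0 by (intro mult_left_mono) auto
      finally show "norm (P z (Y z') - P z' (Y z')) \<le> L' * dist z z' * (C / c)" .
    qed
    finally show "dist (Y z) (Y z') \<le> (M + L' * (C / c)) / c * dist z z'"
      using c by (simp add: dist_norm field_simps)
  qed (use c C M L'0 in auto)
  then show ?thesis unfolding Lipschitz_on_def by blast
qed

section \<open>Symmetric power series in several variables\<close>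

text \<open>
  The homogeneous polynomial of degree \<open>k\<close> and the power series in several variables whose
  coefficients are indexed by words: the word \<open>[s\<^sub>1, \<dots>, s\<^sub>k]\<close> stands for \<open>x\<^bsub>s\<^sub>1\<^esub> \<cdots> x\<^bsub>s\<^sub>k\<^esub>\<close>.
\<close>

definition hom_poly :: "('s::finite list \<Rightarrow> real) \<Rightarrow> nat \<Rightarrow> real^'s \<Rightarrow> real" where
  "hom_poly c k x = (\<Sum>ss | length ss = k. c ss * prod_list (map (\<lambda>s. x $ s) ss))"

definition list_series :: "('s::finite list \<Rightarrow> real) \<Rightarrow> real^'s \<Rightarrow> real" where
  "list_series c x = (\<Sum>k. hom_poly c k x)"

text \<open>
  Coefficients of the partial derivative in direction \<open>s\<close>. This formula is correct for coefficients
  that are invariant under permutations of the word, where the \<open>k + 1\<close> letters of a word of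
  length \<open>k + 1\<close> contribute equally.
\<close>

definition dcoef :: "'s \<Rightarrow> ('s list \<Rightarrow> real) \<Rightarrow> 's list \<Rightarrow> real" where
  "dcoef s c ss = real (Suc (length ss)) * c (s # ss)"

definition sym_coef :: "('s list \<Rightarrow> real) \<Rightarrow> bool" where
  "sym_coef c \<longleftrightarrow> (\<forall>ss ts. mset ss = mset ts \<longrightarrow> c ss = c ts)"

text \<open>
  Absolute convergence on the polydisc of radius 2, which contains a neighbourhood of the unit cube.
\<close>

definition conv_coef :: "('s::finite list \<Rightarrow> real) \<Rightarrow> bool" where
  "conv_coef c \<longleftrightarrow> (\<forall>R. \<bar>R\<bar> < 2 \<longrightarrow> summable (\<lambda>k. (\<Sum>ss | length ss = k. \<bar>c ss\<bar>) * R ^ k))"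

lemma finite_lists_length [simp]: "finite {ss :: 's::finite list. length ss = k}"
  using finite_lists_length_eq[of "UNIV :: 's set" k] by simp

lemma sum_lists_Suc:
  "(\<Sum>ss :: 's::finite list | length ss = Suc k. f ss) = (\<Sum>s\<in>UNIV. \<Sum>ss | length ss = k. f (s # ss))"
proof -
  have "(\<Sum>ss :: 's list | length ss = Suc k. f ss)
      = (\<Sum>(s, ss)\<in>UNIV \<times> {ss. length ss = k}. f (s # ss))"
    by (rule sum.reindex_bij_witness[of _ "\<lambda>(s, ss). s # ss" "\<lambda>ss. (hd ss, tl ss)"])
      (auto simp: length_Suc_conv)
  then show ?thesis by (simp add: sum.cartesian_product)
qed

lemma hom_poly_0 [simp]: "hom_poly c 0 x = c []"
proof -
  have "{ss :: 'a list. length ss = 0} = {[]}" by auto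
  then show ?thesis by (simp add: hom_poly_def)
qed

lemma hom_poly_Suc: "hom_poly c (Suc k) x = (\<Sum>s\<in>UNIV. x $ s * hom_poly (\<lambda>ss. c (s # ss)) k x)"
  unfolding hom_poly_def sum_lists_Suc by (simp add: sum_distrib_left mult_ac)

lemma hom_poly_dcoef: "hom_poly (dcoef s c) k x = real (Suc k) * hom_poly (\<lambda>ss. c (s # ss)) k x"
  unfolding hom_poly_def sum_distrib_left by (intro sum.cong) (auto simp: dcoef_def)

text \<open>
  Euler's identity for homogeneous polynomials.
\<close>

lemma hom_poly_euler: "(\<Sum>s\<in>UNIV. x $ s * hom_poly (dcoef s c) k x) = real (Suc k) * hom_poly c (Suc k) x"
  by (simp only: hom_poly_Suc hom_poly_dcoef sum_distrib_left) (simp add: mult_ac)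

lemma hom_poly_nonneg:
  assumes "\<And>s. 0 \<le> x $ s" "\<And>ss. length ss = k \<Longrightarrow> 0 \<le> c ss"
  shows "0 \<le> hom_poly c k x"
  unfolding hom_poly_def using assms by (intro sum_nonneg mult_nonneg_nonneg prod_list_nonneg) auto

lemma hom_poly_pos:
  assumes "\<And>s. 0 < x $ s" "\<And>ss. length ss = k \<Longrightarrow> 0 < c ss"
  shows "0 < hom_poly c k x"
proof -
  have "0 < prod_list (map (($) x) ss)" for ss using assms(1) by (induction ss) auto
  moreover have "replicate k (undefined :: 'a) \<in> {ss. length ss = k}" by simp
  then have "{ss :: 'a list. length ss = k} \<noteq> {}" by blast
  ultimately show ?thesis
    unfolding hom_poly_def using assms(2) by (intro sum_pos) auto
qed

lemma hom_poly_bound: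
  assumes "\<And>s. \<bar>x $ s\<bar> \<le> R"
  shows "\<bar>hom_poly c k x\<bar> \<le> (\<Sum>ss | length ss = k. \<bar>c ss\<bar>) * R ^ k"
proof -
  have "\<bar>prod_list (map (($) x) ss)\<bar> \<le> R ^ length ss" for ss
  proof (induction ss)
    case (Cons s ss)
    then show ?case using assms[of s] by (auto simp: abs_mult intro!: mult_mono)
  qed simp
  then have "\<bar>c ss * prod_list (map (($) x) ss)\<bar> \<le> \<bar>c ss\<bar> * R ^ length ss" for ss
    by (simp add: abs_mult mult_left_mono)
  then show ?thesis
    unfolding hom_poly_def sum_distrib_right
    by (intro order_trans[OF sum_abs] sum_mono) (metis mem_Collect_eq)
qed

lemma sym_coef_dcoef: "sym_coef c \<Longrightarrow> sym_coef (dcoef s c)"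
  unfolding sym_coef_def dcoef_def by (metis mset.simps(2) size_mset)

lemma dcoef_commute: "sym_coef c \<Longrightarrow> dcoef s (dcoef t c) = dcoef t (dcoef s c)"
  unfolding dcoef_def sym_coef_def by (auto simp: fun_eq_iff)

lemma dcoef_nonneg: "(\<And>ss. 0 \<le> c ss) \<Longrightarrow> 0 \<le> dcoef s c ss"
  by (simp add: dcoef_def)

lemma conv_coef_dcoef:
  fixes c :: "'s::finite list \<Rightarrow> real"
  assumes "conv_coef c"
  shows "conv_coef (dcoef s c)"
  unfolding conv_coef_def
proof (intro allI impI)
  fix R :: real assume R: "\<bar>R\<bar> < 2"
  define a where "a k = (\<Sum>ss :: 's list | length ss = k. \<bar>c ss\<bar>)" for k
  have "summable (\<lambda>k. diffs a k * \<bar>R\<bar> ^ k)"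
    by (rule termdiff_converges[of _ 2]) (use R assms in \<open>auto simp: conv_coef_def a_def\<close>)
  then show "summable (\<lambda>k. (\<Sum>ss | length ss = k. \<bar>dcoef s c ss\<bar>) * R ^ k)"
  proof (rule summable_comparison_test')
    fix k :: nat
    have "(\<Sum>ss | length ss = k. \<bar>dcoef s c ss\<bar>) = real (Suc k) * (\<Sum>ss | length ss = k. \<bar>c (s # ss)\<bar>)"
      unfolding sum_distrib_left by (intro sum.cong) (auto simp: dcoef_def abs_mult)
    also have "\<dots> \<le> real (Suc k) * (\<Sum>t\<in>UNIV. \<Sum>ss | length ss = k. \<bar>c (t # ss)\<bar>)"
      using member_le_sum[of s UNIV "\<lambda>t. \<Sum>ss | length ss = k. \<bar>c (t # ss)\<bar>"]
      by (intro mult_left_mono) (auto simp: sum_nonneg)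
    also have "\<dots> = diffs a k" by (simp add: diffs_def a_def sum_lists_Suc)
    finally have "(\<Sum>ss | length ss = k. \<bar>dcoef s c ss\<bar>) \<le> diffs a k" .
    then show "norm ((\<Sum>ss | length ss = k. \<bar>dcoef s c ss\<bar>) * R ^ k) \<le> diffs a k * \<bar>R\<bar> ^ k"
      by (simp add: abs_mult power_abs mult_right_mono sum_nonneg)
  qed
qed

lemma list_series_summable:
  assumes "conv_coef c" "\<And>s. \<bar>x $ s\<bar> < 2"
  shows "summable (\<lambda>k. hom_poly c k x)"
proof -
  define R where "R = Max (range (\<lambda>s. \<bar>x $ s\<bar>))"
  have R: "\<bar>x $ s\<bar> \<le> R" for s by (simp add: R_def)
  have "R \<in> range (\<lambda>s. \<bar>x $ s\<bar>)" unfolding R_def by (rule Max_in) auto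
  then have "\<bar>R\<bar> < 2" using assms(2) by auto
  then have "summable (\<lambda>k. (\<Sum>ss | length ss = k. \<bar>c ss\<bar>) * R ^ k)" using assms(1) by (simp add: conv_coef_def)
  then show ?thesis
    by (rule summable_comparison_test') (use hom_poly_bound[of x R c] R in auto)
qed

lemma list_series_pos:
  assumes "conv_coef c" "\<And>s. 0 \<le> x $ s" "\<And>s. x $ s < 2" "\<And>ss. 0 \<le> c ss" "0 < c []"
  shows "0 < list_series c x"
proof -
  have "summable (\<lambda>k. hom_poly c k x)" using assms by (intro list_series_summable) (simp_all add: abs_of_nonneg)
  then show ?thesis
    unfolding list_series_def
    by (rule suminf_pos2[of _ 0]) (use assms in \<open>auto intro: hom_poly_nonneg\<close>)
qed

lemma hom_poly_has_derivative:
  assumes "sym_coef c"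
  shows "(hom_poly c (Suc k) has_derivative (\<lambda>v. \<Sum>s\<in>UNIV. v $ s * hom_poly (dcoef s c) k x)) (at x)"
  using assms
proof (induction k arbitrary: c)
  case 0
  have "hom_poly c (Suc 0) = (\<lambda>y. \<Sum>s\<in>UNIV. y $ s * c [s])" by (auto simp: hom_poly_Suc)
  then show ?case
    by (auto simp: dcoef_def intro!: bounded_linear_imp_has_derivative bounded_linear_sum
        bounded_linear_mult_const bounded_linear_vec_nth)
next
  case (Suc k)
  define c' where "c' s = (\<lambda>ss. c (s # ss))" for s
  have sym': "sym_coef (c' s)" for s using Suc.prems by (auto simp: sym_coef_def c'_def)
  have eq: "hom_poly c (Suc (Suc k)) = (\<lambda>y. \<Sum>s\<in>UNIV. y $ s * hom_poly (c' s) (Suc k) y)"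
    by (auto simp: hom_poly_Suc[of c] c'_def)
  have "((\<lambda>y. \<Sum>s\<in>UNIV. y $ s * hom_poly (c' s) (Suc k) y) has_derivative
      (\<lambda>v. \<Sum>s\<in>UNIV. x $ s * (\<Sum>t\<in>UNIV. v $ t * hom_poly (dcoef t (c' s)) k x) + v $ s * hom_poly (c' s) (Suc k) x)) (at x)"
    by (intro has_derivative_sum has_derivative_mult Suc.IH sym'
        bounded_linear_imp_has_derivative bounded_linear_vec_nth)
  moreover have "(\<Sum>s\<in>UNIV. x $ s * (\<Sum>t\<in>UNIV. v $ t * hom_poly (dcoef t (c' s)) k x) + v $ s * hom_poly (c' s) (Suc k) x)
      = (\<Sum>s\<in>UNIV. v $ s * hom_poly (dcoef s c) (Suc k) x)" for v
  proof -
    have sw: "c (s # t # ss) = c (t # s # ss)" for s t ss using Suc.prems by (simp add: sym_coef_def)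
    have h: "hom_poly (dcoef t (c' s)) k x = hom_poly (dcoef s (c' t)) k x" for s t
      by (simp add: hom_poly_dcoef c'_def sw)
    have "(\<Sum>s\<in>UNIV. x $ s * (\<Sum>t\<in>UNIV. v $ t * hom_poly (dcoef t (c' s)) k x))
        = (\<Sum>t\<in>UNIV. v $ t * (\<Sum>s\<in>UNIV. x $ s * hom_poly (dcoef s (c' t)) k x))"
      unfolding sum_distrib_left by (subst sum.swap) (simp add: h mult_ac)
    also have "\<dots> = (\<Sum>t\<in>UNIV. v $ t * (real (Suc k) * hom_poly (c' t) (Suc k) x))"
      by (simp only: hom_poly_euler)
    finally show ?thesis
      by (simp only: sum.distrib) (simp only: sum.distrib[symmetric] hom_poly_dcoef[of _ c] c'_def[symmetric], simp add: algebra_simps)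
  qed
  ultimately show ?case unfolding eq by simp
qed

lemma list_series_has_derivative:
  fixes c :: "'s::finite list \<Rightarrow> real" and x :: "real^'s"
  assumes sym: "sym_coef c" and conv: "conv_coef c" and x: "\<And>s. \<bar>x $ s\<bar> < 2"
  shows "(list_series c has_derivative (\<lambda>v. \<Sum>s\<in>UNIV. v $ s * list_series (dcoef s c) x)) (at x)"
proof -
  define m where "m = Max (range (\<lambda>s. \<bar>x $ s\<bar>))"
  have xm: "\<bar>x $ s\<bar> \<le> m" for s by (simp add: m_def)
  have "m \<in> range (\<lambda>s. \<bar>x $ s\<bar>)" unfolding m_def by (rule Max_in) auto
  then obtain s0 where "m = \<bar>x $ s0\<bar>" by blast
  then have m: "0 \<le> m" "m < 2" using x by simp_all
  define R where "R = (m + 2) / 2"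
  have R: "0 < R" "R < 2" using m by (auto simp: R_def)
  have xR: "\<bar>x $ s\<bar> < R" for s unfolding R_def using xm[of s] m by simp
  define S where "S = {y :: real^'s. \<forall>s. \<bar>y $ s\<bar> < R}"
  have S_eq: "S = (\<Inter>s. {y. \<bar>y $ s\<bar> < R})" by (auto simp: S_def)
  have "open S" unfolding S_eq
    by (intro open_INT) (auto intro!: open_Collect_less continuous_intros)
  have "convex S"
  proof -
    have "convex {y :: real^'s. \<bar>y $ s\<bar> < R}" for s
      using convex_linear_vimage[of "\<lambda>y :: real^'s. y $ s" "{-R<..<R}"]
      by (auto simp: vimage_def abs_less_iff bounded_linear.linear[OF bounded_linear_vec_nth] conj_commute minus_less_iff)
    then show ?thesis unfolding S_eq by (intro convex_INT) auto
  qed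
  have xS: "x \<in> S" using xR by (simp add: S_def)
  have ul: "uniform_limit S (\<lambda>n y. \<Sum>i<n. hom_poly (dcoef s c) i y) (list_series (dcoef s c)) sequentially" for s
    unfolding list_series_def[abs_def]
  proof (rule Weierstrass_m_test)
    show "norm (hom_poly (dcoef s c) n y) \<le> (\<Sum>ss | length ss = n. \<bar>dcoef s c ss\<bar>) * R ^ n" if "y \<in> S" for n y
      unfolding real_norm_def by (rule hom_poly_bound) (use that in \<open>auto simp: S_def intro: less_imp_le\<close>)
    show "summable (\<lambda>n. (\<Sum>ss | length ss = n. \<bar>dcoef s c ss\<bar>) * R ^ n)"
      using conv_coef_dcoef[OF conv, of s] R by (auto simp: conv_coef_def)
  qed
  have "\<exists>g. \<forall>y\<in>S. (\<lambda>n. hom_poly c (Suc n) y) sums (g y) \<and>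
      (g has_derivative (\<lambda>v. \<Sum>s\<in>UNIV. v $ s * list_series (dcoef s c) y)) (at y within S)"
  proof (rule has_derivative_series[OF \<open>convex S\<close> _ _ xS])
    show "(hom_poly c (Suc n) has_derivative (\<lambda>v. \<Sum>s\<in>UNIV. v $ s * hom_poly (dcoef s c) n y)) (at y within S)"
      for n y using hom_poly_has_derivative[OF sym] has_derivative_at_withinI by blast
    show "(\<lambda>n. hom_poly c (Suc n) x) sums (\<Sum>n. hom_poly c (Suc n) x)"
      using list_series_summable[OF conv x] by (intro summable_sums) (subst summable_Suc_iff)
    fix e :: real assume "0 < e"
    define e' where "e' = e / real CARD('s)"
    have e': "0 < e'" using \<open>0 < e\<close> by (simp add: e'_def)
    have "\<forall>\<^sub>F n in sequentially. \<forall>s. \<forall>y\<in>S. dist (\<Sum>i<n. hom_poly (dcoef s c) i y) (list_series (dcoef s c) y) < e'"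
      using uniform_limitD[OF ul e'] by (simp add: eventually_all_finite)
    then show "\<forall>\<^sub>F n in sequentially. \<forall>y\<in>S. \<forall>v. norm ((\<Sum>i<n. \<Sum>s\<in>UNIV. v $ s * hom_poly (dcoef s c) i y)
        - (\<Sum>s\<in>UNIV. v $ s * list_series (dcoef s c) y)) \<le> e * norm v"
    proof (rule eventually_mono, intro ballI allI)
      fix n y and v :: "real^'s"
      assume *: "\<forall>s. \<forall>y\<in>S. dist (\<Sum>i<n. hom_poly (dcoef s c) i y) (list_series (dcoef s c) y) < e'" and y: "y \<in> S"
      have "(\<Sum>i<n. \<Sum>s\<in>UNIV. v $ s * hom_poly (dcoef s c) i y) - (\<Sum>s\<in>UNIV. v $ s * list_series (dcoef s c) y)
          = (\<Sum>s\<in>UNIV. v $ s * ((\<Sum>i<n. hom_poly (dcoef s c) i y) - list_series (dcoef s c) y))"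
        by (subst sum.swap) (simp add: sum_subtractf right_diff_distrib sum_distrib_left)
      also have "norm \<dots> \<le> (\<Sum>s\<in>(UNIV :: 's set). norm v * e')"
      proof (rule sum_norm_le)
        fix s :: 's
        show "norm (v $ s * ((\<Sum>i<n. hom_poly (dcoef s c) i y) - list_series (dcoef s c) y)) \<le> norm v * e'"
          unfolding norm_mult using *[rule_format, OF y, of s] component_le_norm_cart[of v s]
          by (intro mult_mono) (auto simp: dist_real_def)
      qed
      also have "\<dots> = e * norm v" by (simp add: e'_def)
      finally show "norm ((\<Sum>i<n. \<Sum>s\<in>UNIV. v $ s * hom_poly (dcoef s c) i y)
        - (\<Sum>s\<in>UNIV. v $ s * list_series (dcoef s c) y)) \<le> e * norm v" .
    qed
  qed
  then obtain g where g: "\<And>y. y \<in> S \<Longrightarrow> (\<lambda>n. hom_poly c (Suc n) y) sums (g y)"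
    "(g has_derivative (\<lambda>v. \<Sum>s\<in>UNIV. v $ s * list_series (dcoef s c) x)) (at x within S)"
    using xS by blast
  have "(g has_derivative (\<lambda>v. \<Sum>s\<in>UNIV. v $ s * list_series (dcoef s c) x)) (at x)"
    using g(2) at_within_open[OF xS \<open>open S\<close>] by simp
  then have "((\<lambda>y. g y + c []) has_derivative (\<lambda>v. \<Sum>s\<in>UNIV. v $ s * list_series (dcoef s c) x)) (at x)"
    using has_derivative_add[OF _ has_derivative_const] by fastforce
  then show ?thesis
  proof (rule has_derivative_transform_within_open[OF _ \<open>open S\<close> xS])
    fix y assume "y \<in> S"
    from g(1)[OF this] have "(\<lambda>n. hom_poly c n y) sums (g y + c [])" using sums_Suc by fastforce
    then show "g y + c [] = list_series c y" unfolding list_series_def by (rule sums_unique)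
  qed
qed


lemma list_series_lipschitz_on_box:
  fixes c :: "'s::finite list \<Rightarrow> real"
  assumes sym: "sym_coef c" and conv: "conv_coef c"
  shows "\<exists>L. L-lipschitz_on {x :: real^'s. \<forall>s. 0 \<le> x $ s \<and> x $ s \<le> 3/2} (list_series c)"
proof -
  define S where "S = {x :: real^'s. \<forall>s. 0 \<le> x $ s \<and> x $ s \<le> 3/2}"
  have S_eq: "S = cbox 0 (\<chi> s. 3/2)" by (auto simp: S_def mem_box_cart)
  have dom: "\<bar>x $ s\<bar> < 2" if "x \<in> S" for x s
  proof -
    have "0 \<le> x $ s" "x $ s \<le> 3/2" using that by (auto simp: S_def)
    then show ?thesis by simp
  qed
  have "continuous_on S (list_series (dcoef s c))" for s
    by (intro continuous_at_imp_continuous_on ballI)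
      (rule has_derivative_continuous[OF list_series_has_derivative[OF sym_coef_dcoef[OF sym] conv_coef_dcoef[OF conv] dom]])
  then have "compact (list_series (dcoef s c) ` S)" for s
    by (intro compact_continuous_image) (auto simp: S_eq)
  then have "bounded (list_series (dcoef s c) ` S)" for s
    by (rule compact_imp_bounded)
  then have "\<forall>s. \<exists>C. \<forall>y\<in>S. \<bar>list_series (dcoef s c) y\<bar> \<le> C"
    unfolding bounded_iff by simp
  from choice[OF this]
  obtain C where C: "\<And>s y. y \<in> S \<Longrightarrow> \<bar>list_series (dcoef s c) y\<bar> \<le> C s"
    by blast
  have "(\<Sum>s\<in>UNIV. \<bar>C s\<bar>)-lipschitz_on S (list_series c)"
  proof (rule bounded_derivative_imp_lipschitz)
    show "(list_series c has_derivative (\<lambda>v. \<Sum>s\<in>UNIV. v $ s * list_series (dcoef s c) x)) (at x within S)"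
      if "x \<in> S" for x
      by (rule has_derivative_at_withinI[OF list_series_has_derivative[OF sym conv dom[OF that]]])
    show "convex S" by (simp add: S_eq)
    show "0 \<le> (\<Sum>s\<in>UNIV. \<bar>C s\<bar>)" by (simp add: sum_nonneg)
    fix x assume x: "x \<in> S"
    show "onorm (\<lambda>v. \<Sum>s\<in>UNIV. v $ s * list_series (dcoef s c) x) \<le> (\<Sum>s\<in>UNIV. \<bar>C s\<bar>)"
    proof (rule onorm_bound)
      fix v :: "real^'s"
      have "norm (\<Sum>s\<in>UNIV. v $ s * list_series (dcoef s c) x) \<le> (\<Sum>s\<in>UNIV. norm v * \<bar>C s\<bar>)"
      proof (rule sum_norm_le)
        fix s
        show "norm (v $ s * list_series (dcoef s c) x) \<le> norm v * \<bar>C s\<bar>"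
          unfolding norm_mult using component_le_norm_cart[of v s] C[OF x, of s]
          by (intro mult_mono) auto
      qed
      then show "norm (\<Sum>s\<in>UNIV. v $ s * list_series (dcoef s c) x) \<le> (\<Sum>s\<in>UNIV. \<bar>C s\<bar>) * norm v"
        by (simp add: sum_distrib_left mult.commute)
    qed (simp add: sum_nonneg)
  qed
  then show ?thesis unfolding S_def by blast
qed

section \<open>The tree-descending ODE as a vector field\<close>

text \<open>
  With \<open>N = f' g - f g'\<close> the left-hand side is \<open>1/f \<cdot> (sqrt (f/g))'\<close> at \<open>f = A\<close>, \<open>g = B\<close>; this is the
  step from the tree-descending ODE with quotients to its division-free form.
\<close>

lemma three_halves_identity:
  fixes A B :: real
  assumes "0 < A" "0 < B"
  shows "N / B\<^sup>2 / (2 * sqrt (A / B)) / A = N / (2 * (A * B) powr (3/2))"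
proof -
  define r where "r = sqrt (A / B)"
  have r: "0 < r" using assms by (simp add: r_def)
  have A: "A = r\<^sup>2 * B" using assms by (simp add: r_def)
  have "A * B = (r * B)\<^sup>2" by (simp add: A power2_eq_square)
  then have "(A * B) powr (3/2) = (r * B) ^ 3"
    using r assms by (simp add: powr_half_sqrt[symmetric] powr_powr flip: powr_numeral)
  then show ?thesis
    unfolding r_def[symmetric] using r assms by (simp add: A field_simps power2_eq_square power3_eq_cube)
qed

text \<open>
  The domain of the vector field: positions in a cube slightly larger than the unit cube, so that
  solutions which leave the unit cube can still be compared for a short time, and velocities in the
  simplex given by \<open>\<langle>\<lambda>, \<Phi>'\<rangle> = 1\<close>.
\<close>

definition species_box :: "(real^'s::finite) set" where
  "species_box = {x. \<forall>s. 0 \<le> x $ s \<and> x $ s \<le> 3/2}"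

definition velocity_simplex :: "real^'s \<Rightarrow> (real^'s::finite) set" where
  "velocity_simplex lam = {a. (\<forall>s. 0 \<le> a $ s) \<and> lam \<bullet> a = 1}"

text \<open>
  What the reduction of the ODE to a vector field uses about \<open>\<xi>\<close>: the functions \<open>H s t\<close> are the partial
  derivatives \<open>\<partial>\<^sub>t \<xi>\<^sup>s\<close>, positive and symmetric after multiplication with \<open>\<lambda>\<^sub>s\<close>, and \<open>T s t u\<close> are the
  second partial derivatives \<open>\<partial>\<^sub>u \<partial>\<^sub>t \<xi>\<^sup>s\<close>.
\<close>

locale species_model =
  fixes lam :: "real^'s::finite" and \<gamma> :: "'s list \<Rightarrow> real"
    and H :: "'s \<Rightarrow> 's \<Rightarrow> real^'s \<Rightarrow> real" and T :: "'s \<Rightarrow> 's \<Rightarrow> 's \<Rightarrow> real^'s \<Rightarrow> real"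
  assumes lam_pos: "0 < lam $ s"
    and lam_sum: "(\<Sum>s\<in>UNIV. lam $ s) = 1"
    and xi_deriv: "(\<And>t. \<bar>x $ t\<bar> < 2) \<Longrightarrow>
      (xi_species lam \<gamma> s has_derivative (\<lambda>v. \<Sum>t\<in>UNIV. v $ t * H s t x)) (at x)"
    and H_deriv: "(\<And>t. \<bar>x $ t\<bar> < 2) \<Longrightarrow>
      (H s t has_derivative (\<lambda>v. \<Sum>u\<in>UNIV. v $ u * T s t u x)) (at x)"
    and H_lips: "Lipschitz_on species_box (H s t)"
    and T_lips: "Lipschitz_on species_box (T s t u)"
    and H_pos: "x \<in> species_box \<Longrightarrow> 0 < H s t x"
    and H_sym: "x \<in> species_box \<Longrightarrow> lam $ s * H s t x = lam $ t * H t s x"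
begin

text \<open>
  The directional derivative of \<open>\<xi>\<^sup>s\<close> at \<open>x\<close> along \<open>a\<close>; along a curve this is \<open>(\<xi>\<^sup>s \<circ> \<Phi>)'\<close>.
\<close>

definition dxi :: "real^'s \<Rightarrow> real^'s \<Rightarrow> 's \<Rightarrow> real" where
  "dxi x a s = (\<Sum>t\<in>UNIV. a $ t * H s t x)"

text \<open>
  The Hessian of \<open>\<xi>\<^sup>s\<close> at \<open>x\<close> evaluated at \<open>(a, a)\<close>.
\<close>

definition ddxi :: "real^'s \<Rightarrow> real^'s \<Rightarrow> 's \<Rightarrow> real" where
  "ddxi x a s = (\<Sum>t\<in>UNIV. a $ t * (\<Sum>u\<in>UNIV. a $ u * T s t u x))"

text \<open>
  The equation for the acceleration \<open>w\<close> at position \<open>x\<close> and velocity \<open>a\<close>: the division-free ODE, with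
  \<open>(\<xi>\<^sup>s \<circ> \<Phi>)''\<close> expanded by the chain rule, together with \<open>\<langle>\<lambda>, w\<rangle> = 0\<close>. It is linear in \<open>(w, \<psi>)\<close>.
\<close>

definition acc_eq :: "real^'s \<Rightarrow> real^'s \<Rightarrow> real^'s \<Rightarrow> real \<Rightarrow> bool" where
  "acc_eq x a w \<psi> \<longleftrightarrow> lam \<bullet> w = 0 \<and>
     (\<forall>s. w $ s * dxi x a s - a $ s * (dxi x w s + ddxi x a s) = 2 * \<psi> * (a $ s * dxi x a s) powr (3/2))"

definition phase :: "((real^'s) \<times> (real^'s)) set" where
  "phase = species_box \<times> velocity_simplex lam"

lemma compact_species_box: "compact (species_box :: (real^'s) set)"
proof -
  have "(species_box :: (real^'s) set) = cbox 0 (\<chi> s. 3/2)" by (auto simp: species_box_def mem_box_cart)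
  then show ?thesis using compact_cbox by metis
qed

lemma velocity_simplex_le: "a \<in> velocity_simplex lam \<Longrightarrow> a $ s \<le> 1 / lam $ s"
proof -
  assume a: "a \<in> velocity_simplex lam"
  have "lam $ s * a $ s \<le> (\<Sum>t\<in>UNIV. lam $ t * a $ t)"
    using a lam_pos by (intro member_le_sum) (auto simp: velocity_simplex_def less_imp_le)
  also have "\<dots> = 1" using a by (simp add: velocity_simplex_def inner_vec_def)
  finally show ?thesis using lam_pos[of s] by (simp add: field_simps)
qed

lemma compact_velocity_simplex: "compact (velocity_simplex lam)"
proof -
  have "velocity_simplex lam = (\<Inter>s. {a. 0 \<le> a $ s}) \<inter> {a. lam \<bullet> a = 1}" by (auto simp: velocity_simplex_def)
  moreover have "closed {a :: real^'s. 0 \<le> a $ s}" for s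
    by (intro closed_Collect_le continuous_intros)
  moreover have "closed {a :: real^'s. lam \<bullet> a = 1}"
    by (intro closed_Collect_eq continuous_intros)
  ultimately have "closed (velocity_simplex lam)" by (simp add: closed_INT closed_Int)
  moreover have "velocity_simplex lam \<subseteq> cbox 0 (\<chi> s. 1 / lam $ s)"
    using velocity_simplex_le by (auto simp: velocity_simplex_def mem_box_cart)
  then have "bounded (velocity_simplex lam)" using bounded_cbox bounded_subset by blast
  ultimately show ?thesis by (simp add: compact_eq_bounded_closed)
qed

lemma compact_phase: "compact phase"
  unfolding phase_def by (intro compact_Times compact_species_box compact_velocity_simplex)

lemma velocity_simplex_ex_pos: "a \<in> velocity_simplex lam \<Longrightarrow> \<exists>s. 0 < a $ s"
proof (rule ccontr)
  assume a: "a \<in> velocity_simplex lam" and "\<nexists>s. 0 < a $ s"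
  then have "a $ s = 0" for s by (auto simp: velocity_simplex_def not_less order.antisym)
  then have "a = 0" by (simp add: vec_eq_iff)
  then show False using a by (simp add: velocity_simplex_def)
qed

lemma dxi_pos:
  assumes "x \<in> species_box" "a \<in> velocity_simplex lam"
  shows "0 < dxi x a s"
proof -
  obtain t where t: "0 < a $ t" using velocity_simplex_ex_pos[OF assms(2)] by blast
  have "0 < a $ t * H s t x" using t H_pos[OF assms(1)] by simp
  also have "\<dots> \<le> dxi x a s" unfolding dxi_def
    using assms(2) H_pos[OF assms(1)] by (intro member_le_sum) (auto simp: velocity_simplex_def intro!: mult_nonneg_nonneg less_imp_le[OF H_pos[OF assms(1)]])
  finally show ?thesis .
qed

lemma linear_dxi: "linear (\<lambda>a. dxi x a s)"
  by (rule linearI) (simp_all add: dxi_def algebra_simps sum.distrib sum_distrib_left)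

lemma Lipschitz_on_H: "Lipschitz_on phase (\<lambda>z. H s t (fst z))"
  by (rule Lipschitz_on_compose[of _ fst species_box "H s t"])
    (auto simp: phase_def H_lips intro!: Lipschitz_on_nonexpansive dist_fst_le)

lemma Lipschitz_on_T: "Lipschitz_on phase (\<lambda>z. T s t u (fst z))"
  by (rule Lipschitz_on_compose[of _ fst species_box "T s t u"])
    (auto simp: phase_def T_lips intro!: Lipschitz_on_nonexpansive dist_fst_le)

lemma Lipschitz_on_snd_nth: "Lipschitz_on phase (\<lambda>z. snd z $ s)"
  by (rule Lipschitz_on_nonexpansive) (metis dist_snd_le dist_vec_nth_le order_trans)

lemmas Lipschitz_on_intros = Lipschitz_on_const Lipschitz_on_add Lipschitz_on_diff Lipschitz_on_mult[OF compact_phase] Lipschitz_on_sum Lipschitz_on_H Lipschitz_on_T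
  Lipschitz_on_snd_nth Lipschitz_on_Pair finite

lemma Lipschitz_on_dxi: "Lipschitz_on phase (\<lambda>z. dxi (fst z) (snd z) s)"
  unfolding dxi_def by (intro Lipschitz_on_intros)

lemma Lipschitz_on_dxi_const: "Lipschitz_on phase (\<lambda>z. dxi (fst z) w s)"
  unfolding dxi_def by (intro Lipschitz_on_intros)

lemma Lipschitz_on_ddxi: "Lipschitz_on phase (\<lambda>z. ddxi (fst z) (snd z) s)"
  unfolding ddxi_def by (intro Lipschitz_on_intros)

lemma velocity_dxi_nonneg: "z \<in> phase \<Longrightarrow> 0 \<le> snd z $ s * dxi (fst z) (snd z) s"
  by (rule mult_nonneg_nonneg) (auto simp: phase_def velocity_simplex_def intro!: less_imp_le[OF dxi_pos])

text \<open>
  The linear system for the acceleration is nonsingular, also when some components of the velocity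
  vanish. Summation with weights \<open>\<lambda>\<^sub>s\<close> cancels the left-hand sides by symmetry and gives \<open>\<psi> = 0\<close>; then a
  maximum principle for \<open>w\<^sub>s / a\<^sub>s\<close> shows that \<open>w\<close> is a multiple of \<open>a\<close>, hence 0.
\<close>

lemma acc_homogeneous_zero:
  assumes x: "x \<in> species_box" and a: "a \<in> velocity_simplex lam" and w: "lam \<bullet> w = 0"
    and eq: "\<And>s. w $ s * dxi x a s - a $ s * dxi x w s = 2 * \<psi> * (a $ s * dxi x a s) powr (3/2)"
  shows "w = 0 \<and> \<psi> = 0"
proof -
  have a0: "0 \<le> a $ s" for s using a by (simp add: velocity_simplex_def)
  have Bp: "0 < dxi x a s" for s by (rule dxi_pos[OF x a])
  obtain s0 where s0: "0 < a $ s0" using velocity_simplex_ex_pos[OF a] by blast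
  have "(\<Sum>s\<in>UNIV. lam $ s * (w $ s * dxi x a s)) = (\<Sum>s\<in>UNIV. \<Sum>t\<in>UNIV. w $ s * a $ t * (lam $ s * H s t x))"
    by (simp add: dxi_def sum_distrib_left mult_ac)
  also have "\<dots> = (\<Sum>t\<in>UNIV. \<Sum>s\<in>UNIV. w $ s * a $ t * (lam $ t * H t s x))"
    by (subst sum.swap) (simp only: H_sym[OF x])
  also have "\<dots> = (\<Sum>t\<in>UNIV. lam $ t * (a $ t * dxi x w t))"
    by (simp add: dxi_def sum_distrib_left mult_ac)
  finally have "(\<Sum>s\<in>UNIV. lam $ s * (w $ s * dxi x a s - a $ s * dxi x w s)) = 0"
    by (simp add: right_diff_distrib sum_subtractf)
  then have "2 * \<psi> * (\<Sum>s\<in>UNIV. lam $ s * (a $ s * dxi x a s) powr (3/2)) = 0"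
    unfolding eq by (simp add: sum_distrib_left mult_ac)
  moreover have "0 < (\<Sum>s\<in>UNIV. lam $ s * (a $ s * dxi x a s) powr (3/2))"
    using s0 Bp[of s0] lam_pos
    by (intro sum_pos2[of UNIV s0]) (auto intro!: mult_nonneg_nonneg less_imp_le[OF lam_pos])
  ultimately have \<psi>: "\<psi> = 0" by simp
  have eq0: "w $ s * dxi x a s = a $ s * dxi x w s" for s using eq[of s] \<psi> by simp
  define P where "P = {s. 0 < a $ s}"
  have wz: "w $ s = 0" if "s \<notin> P" for s
    using eq0[of s] that a0[of s] Bp[of s] by (simp add: P_def)
  define r where "r s = w $ s / a $ s" for s
  have wr: "w $ s = r s * a $ s" for s
    using wz[of s] a0[of s] by (cases "s \<in> P") (auto simp: r_def P_def)
  have "finite (r ` P)" "r ` P \<noteq> {}" using s0 by (auto simp: P_def)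
  then have "Max (r ` P) \<in> r ` P" by (rule Max_in)
  then obtain m where m: "m \<in> P" "r m = Max (r ` P)" by auto
  have m_max: "r t \<le> r m" if "t \<in> P" for t using that m(2) by simp
  \<comment> \<open>At the maximiser \<open>m\<close> of \<open>r\<close> the equation says that a sum of nonnegative terms vanishes.\<close>
  have "r m * dxi x a m = dxi x w m" using eq0[of m] m(1) by (simp add: wr P_def)
  then have "(\<Sum>t\<in>UNIV. (r m - r t) * a $ t * H m t x) = 0"
    by (simp add: dxi_def wr[symmetric] left_diff_distrib sum_subtractf sum_distrib_left mult.assoc)
  moreover have "0 \<le> (r m - r t) * a $ t * H m t x" for t
    using m_max[of t] a0[of t] H_pos[OF x, of m t] by (cases "t \<in> P") (auto simp: P_def)
  ultimately have "(r m - r t) * a $ t * H m t x = 0" for t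
    by (simp add: sum_nonneg_eq_0_iff)
  then have "r t * a $ t = r m * a $ t" for t
    using H_pos[OF x, of m t] by (metis cancel_comm_monoid_add_class.diff_cancel eq_iff_diff_eq_0 less_irrefl mult_eq_0_iff)
  then have wm: "w = r m *\<^sub>R a" by (simp add: vec_eq_iff wr)
  then have "r m = 0" using w a by (simp add: velocity_simplex_def)
  then show ?thesis using wm \<psi> by simp
qed

text \<open>
  The left- and right-hand side of this system as a linear map and a vector, in the unknowns \<open>(w, \<psi>)\<close>.
\<close>

definition acc_op :: "(real^'s) \<times> (real^'s) \<Rightarrow> (real^'s) \<times> real \<Rightarrow> (real^'s) \<times> real" where
  "acc_op z y = ((\<chi> s. fst y $ s * dxi (fst z) (snd z) s - snd z $ s * dxi (fst z) (fst y) s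
      - 2 * snd y * (snd z $ s * dxi (fst z) (snd z) s) powr (3/2)), lam \<bullet> fst y)"

definition acc_rhs :: "(real^'s) \<times> (real^'s) \<Rightarrow> (real^'s) \<times> real" where
  "acc_rhs z = ((\<chi> s. snd z $ s * ddxi (fst z) (snd z) s), 0)"

lemma acc_eq_iff: "acc_eq x a w \<psi> \<longleftrightarrow> acc_op (x, a) (w, \<psi>) = acc_rhs (x, a)"
  by (auto simp: acc_eq_def acc_op_def acc_rhs_def vec_eq_iff algebra_simps)

lemma linear_acc_op: "linear (acc_op z)"
proof (rule linearI)
  fix y y' :: "(real^'s) \<times> real" and r :: real
  show "acc_op z (y + y') = acc_op z y + acc_op z y'"
    by (auto simp: acc_op_def vec_eq_iff linear_add[OF linear_dxi] inner_add_right algebra_simps)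
  show "acc_op z (r *\<^sub>R y) = r *\<^sub>R acc_op z y"
    by (auto simp: acc_op_def vec_eq_iff linear_scale[OF linear_dxi] algebra_simps)
qed

lemma acc_op_inj:
  assumes "z \<in> phase" "acc_op z y = 0"
  shows "y = 0"
proof -
  have "fst y = 0 \<and> snd y = 0"
    by (rule acc_homogeneous_zero[of "fst z" "snd z"])
      (use assms in \<open>auto simp: phase_def acc_op_def vec_eq_iff zero_prod_def\<close>)
  then show ?thesis by (simp add: prod_eq_iff)
qed

text \<open>
  The solution of the system, unique for \<open>z\<close> in \<open>phase\<close>, and the resulting vector field, which turns the
  ODE into \<open>\<Phi>'' = field \<Phi> \<Phi>'\<close>.
\<close>

definition acc_sol :: "(real^'s) \<times> (real^'s) \<Rightarrow> (real^'s) \<times> real" where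
  "acc_sol z = (SOME y. acc_op z y = acc_rhs z)"

definition field :: "real^'s \<Rightarrow> real^'s \<Rightarrow> real^'s" where
  "field x a = fst (acc_sol (x, a))"

lemma acc_sol: "z \<in> phase \<Longrightarrow> acc_op z (acc_sol z) = acc_rhs z"
proof -
  assume z: "z \<in> phase"
  have "inj (acc_op z)"
    using linear_injective_0[OF linear_acc_op] acc_op_inj[OF z] by blast
  then have "surj (acc_op z)" by (rule linear_injective_imp_surjective[OF linear_acc_op]) (rule refl)
  then obtain y where "acc_op z y = acc_rhs z" by (metis surjD)
  then show ?thesis unfolding acc_sol_def by (rule someI)
qed

lemma Lipschitz_on_acc_sol: "Lipschitz_on phase acc_sol"
proof (rule Lipschitz_on_linear_system_solution[OF compact_phase linear_acc_op _ acc_op_inj _ acc_sol])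
  show "Lipschitz_on phase (\<lambda>z. acc_op z y)" for y
    unfolding acc_op_def
    by (intro Lipschitz_on_Pair Lipschitz_on_vec Lipschitz_on_const, unfold vec_lambda_beta,
      intro Lipschitz_on_intros Lipschitz_on_dxi Lipschitz_on_dxi_const Lipschitz_on_powr_three_halves compact_phase velocity_dxi_nonneg)
  show "Lipschitz_on phase acc_rhs"
    unfolding acc_rhs_def
    by (intro Lipschitz_on_Pair Lipschitz_on_vec Lipschitz_on_const, unfold vec_lambda_beta, intro Lipschitz_on_intros Lipschitz_on_ddxi)
qed

lemma acc_eq_field:
  assumes "x \<in> species_box" "a \<in> velocity_simplex lam"
  shows "acc_eq x a (field x a) (snd (acc_sol (x, a)))"
  unfolding acc_eq_iff field_def using acc_sol[of "(x, a)"] assms by (simp add: phase_def)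

lemma acc_eq_imp_field:
  assumes "x \<in> species_box" "a \<in> velocity_simplex lam" "acc_eq x a w \<psi>"
  shows "w = field x a"
proof -
  have z: "(x, a) \<in> phase" using assms by (simp add: phase_def)
  have "acc_op (x, a) ((w, \<psi>) - acc_sol (x, a)) = 0"
    using assms(3) acc_sol[OF z] by (simp add: acc_eq_iff linear_diff[OF linear_acc_op])
  from acc_op_inj[OF z this] show ?thesis by (simp add: field_def prod_eq_iff)
qed

lemma Lipschitz_on_field: "Lipschitz_on phase (\<lambda>z. field (fst z) (snd z))"
  unfolding field_def prod.collapse
  by (rule Lipschitz_on_compose[OF Lipschitz_on_acc_sol, of UNIV fst]) (auto intro!: Lipschitz_on_nonexpansive dist_fst_le)

lemma field_tangent: "x \<in> species_box \<Longrightarrow> a \<in> velocity_simplex lam \<Longrightarrow> lam \<bullet> field x a = 0"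
  using acc_eq_field by (simp add: acc_eq_def)

text \<open>
  The acceleration of a species is dominated by its velocity. This keeps velocities nonnegative and
  shows that a species at rest has always been at rest.
\<close>

lemma field_bound: "\<exists>M. \<forall>x\<in>species_box. \<forall>a\<in>velocity_simplex lam. \<forall>s. \<bar>field x a $ s\<bar> \<le> M * a $ s"
proof -
  \<comment> \<open>The equation for \<open>w\<^sub>s\<close> can be divided by the positive factor in front of it, and \<open>a\<^sub>s\<close> splits off the rest.\<close>
  define \<phi> where "\<phi> s z = (dxi (fst z) (fst (acc_sol z)) s + ddxi (fst z) (snd z) s) / dxi (fst z) (snd z) s
    + 2 * snd (acc_sol z) * sqrt (snd z $ s * dxi (fst z) (snd z) s)" for s z
  have cf: "continuous_on phase (\<lambda>z. acc_sol z)" using Lipschitz_on_continuous_on[OF Lipschitz_on_acc_sol] .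
  have "continuous_on phase (\<phi> s)" for s
    unfolding \<phi>_def[abs_def]
  proof (intro continuous_intros cf Lipschitz_on_continuous_on[OF Lipschitz_on_ddxi] Lipschitz_on_continuous_on[OF Lipschitz_on_dxi])
    show "continuous_on phase (\<lambda>z. dxi (fst z) (fst (acc_sol z)) s)"
      unfolding dxi_def by (intro continuous_intros cf Lipschitz_on_continuous_on[OF Lipschitz_on_H])
    show "\<forall>z\<in>phase. dxi (fst z) (snd z) s \<noteq> 0" 
    proof
      fix z assume "z \<in> phase"
      then have "0 < dxi (fst z) (snd z) s" by (intro dxi_pos) (auto simp: phase_def)
      then show "dxi (fst z) (snd z) s \<noteq> 0" by simp
    qed
  qed
  then have "bounded (\<phi> s ` phase)" for s
    by (intro compact_imp_bounded compact_continuous_image compact_phase)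
  then have "\<forall>s. \<exists>M. \<forall>z\<in>phase. \<bar>\<phi> s z\<bar> \<le> M" unfolding bounded_iff by simp
  from choice[OF this] obtain M where M: "\<And>s z. z \<in> phase \<Longrightarrow> \<bar>\<phi> s z\<bar> \<le> M s" by blast
  have "\<bar>field x a $ s\<bar> \<le> (\<Sum>s\<in>UNIV. \<bar>M s\<bar>) * a $ s"
    if xa: "x \<in> species_box" "a \<in> velocity_simplex lam" for x a s
  proof -
    have a0: "0 \<le> a $ s" using xa by (simp add: velocity_simplex_def)
    have Bp: "0 < dxi x a s" by (rule dxi_pos[OF xa])
    have p: "(a $ s * dxi x a s) powr (3/2) = a $ s * dxi x a s * sqrt (a $ s * dxi x a s)"
      using powr_add[of "a $ s * dxi x a s" 1 "1/2"] a0 Bp by (cases "a $ s = 0") (auto simp: powr_half_sqrt)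
    have "field x a $ s * dxi x a s - a $ s * (dxi x (field x a) s + ddxi x a s)
        = 2 * snd (acc_sol (x, a)) * (a $ s * dxi x a s) powr (3/2)"
      using acc_eq_field[OF xa] unfolding acc_eq_def by blast
    then have "field x a $ s * dxi x a s = a $ s * (dxi x (field x a) s + ddxi x a s)
        + 2 * snd (acc_sol (x, a)) * (a $ s * dxi x a s * sqrt (a $ s * dxi x a s))"
      unfolding p by (simp only: diff_eq_eq add.commute)
    then have "field x a $ s = a $ s * \<phi> s (x, a)"
      using Bp by (simp add: \<phi>_def field_def field_simps)
    also have "\<bar>\<dots>\<bar> \<le> a $ s * M s"
      using M[of "(x, a)" s] a0 xa by (simp add: abs_mult phase_def mult_left_mono)
    also have "\<dots> \<le> a $ s * (\<Sum>s\<in>UNIV. \<bar>M s\<bar>)"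
      using a0 member_le_sum[of s UNIV "\<lambda>s. \<bar>M s\<bar>"] by (intro mult_left_mono) auto
    finally show ?thesis by (simp add: mult.commute)
  qed
  then show ?thesis by blast
qed

lemma field_zero:
  assumes "x \<in> species_box" "a \<in> velocity_simplex lam" "a $ s = 0"
  shows "field x a $ s = 0"
proof -
  obtain M where "\<forall>x\<in>species_box. \<forall>a\<in>velocity_simplex lam. \<forall>s. \<bar>field x a $ s\<bar> \<le> M * a $ s"
    using field_bound by blast
  then have "\<bar>field x a $ s\<bar> \<le> M * a $ s" using assms by blast
  then show ?thesis using assms(3) by simp
qed

end

section \<open>The flow of the vector field\<close>

context species_model
begin

text \<open>
  Retractions of positions to the unit cube and of velocities to the simplex. They extend the vector
  field to a globally Lipschitz one. \<open>pos_shift\<close> moves a vector to the hyperplane \<open>\<langle>\<lambda>, a\<rangle> = 1\<close> before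
  taking positive parts, so that the denominator in \<open>simplex_retract\<close> is at least 1.
\<close>

definition unit_clamp :: "real^'s \<Rightarrow> real^'s" where
  "unit_clamp x = (\<chi> s. max 0 (min 1 (x $ s)))"

definition pos_shift :: "real^'s \<Rightarrow> real^'s" where
  "pos_shift a = (\<chi> s. max 0 (a $ s + (1 - lam \<bullet> a)))"

definition simplex_retract :: "real^'s \<Rightarrow> real^'s" where
  "simplex_retract a = (\<chi> s. pos_shift a $ s / (lam \<bullet> pos_shift a))"

lemma unit_clamp_in: "unit_clamp x \<in> species_box"
proof -
  have "max 0 (min 1 (x $ s)) \<le> 3/2" for s by (simp add: max_def min_def)
  then show ?thesis by (simp add: unit_clamp_def species_box_def)
qed

lemma unit_clamp_id: "(\<And>s. 0 \<le> x $ s) \<Longrightarrow> (\<And>s. x $ s \<le> 1) \<Longrightarrow> unit_clamp x = x"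
  by (simp add: unit_clamp_def vec_eq_iff max_absorb2 min_absorb2)

lemma Lipschitz_on_unit_clamp: "Lipschitz_on UNIV unit_clamp"
proof (rule Lipschitz_on_vec, rule Lipschitz_on_nonexpansive)
  fix x y :: "real^'s" and s
  have "dist (unit_clamp x $ s) (unit_clamp y $ s) \<le> dist (x $ s) (y $ s)"
    by (auto simp: unit_clamp_def dist_real_def max_def min_def)
  also have "\<dots> \<le> dist x y" by (rule dist_vec_nth_le)
  finally show "dist (unit_clamp x $ s) (unit_clamp y $ s) \<le> dist x y" .
qed

lemma pos_shift_nonneg: "0 \<le> pos_shift a $ s"
  by (simp add: pos_shift_def)

lemma mass_ge_1: "1 \<le> lam \<bullet> pos_shift a"
proof -
  have "1 = (\<Sum>s\<in>UNIV. lam $ s * (a $ s + (1 - lam \<bullet> a)))"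
    by (simp add: distrib_left sum.distrib sum_distrib_right[symmetric] lam_sum inner_vec_def)
  also have "\<dots> \<le> (\<Sum>s\<in>UNIV. lam $ s * pos_shift a $ s)"
    by (intro sum_mono mult_left_mono less_imp_le[OF lam_pos]) (simp add: pos_shift_def)
  finally show ?thesis by (simp add: inner_vec_def)
qed

lemma simplex_retract_in: "simplex_retract a \<in> velocity_simplex lam"
proof -
  have "lam \<bullet> simplex_retract a = (lam \<bullet> pos_shift a) / (lam \<bullet> pos_shift a)"
    by (simp add: simplex_retract_def inner_vec_def sum_divide_distrib[symmetric])
  then show ?thesis using mass_ge_1[of a] pos_shift_nonneg
    by (auto simp: velocity_simplex_def simplex_retract_def)
qed

lemma simplex_retract_id: "a \<in> velocity_simplex lam \<Longrightarrow> simplex_retract a = a"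
  by (simp add: velocity_simplex_def simplex_retract_def pos_shift_def vec_eq_iff max_absorb2 vec_nth_inverse)

lemma simplex_retract_zero: "lam \<bullet> a = 1 \<Longrightarrow> a $ s \<le> 0 \<Longrightarrow> simplex_retract a $ s = 0"
  by (simp add: simplex_retract_def pos_shift_def max_absorb1)

lemma Lipschitz_on_nth: "Lipschitz_on K (\<lambda>a. a $ s)"
  by (rule Lipschitz_on_nonexpansive) (rule dist_vec_nth_le)

lemma Lipschitz_on_inner_lam: "Lipschitz_on K f \<Longrightarrow> Lipschitz_on K (\<lambda>z. lam \<bullet> f z)" for f :: "'z::metric_space \<Rightarrow> real^'s"
  unfolding inner_vec_def inner_real_def
  by (intro Lipschitz_on_sum Lipschitz_on_cmult finite Lipschitz_on_compose[of K f UNIV "\<lambda>a. a $ _"] Lipschitz_on_nth) auto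

lemma Lipschitz_on_simplex_retract: "Lipschitz_on UNIV simplex_retract"
proof -
  have L1: "Lipschitz_on UNIV (\<lambda>a. pos_shift a $ s)" for s
  proof -
    have "Lipschitz_on UNIV (\<lambda>a. a $ s + (1 - lam \<bullet> a))"
      by (intro Lipschitz_on_add Lipschitz_on_diff Lipschitz_on_const Lipschitz_on_nth Lipschitz_on_inner_lam Lipschitz_on_nonexpansive) auto
    then have "Lipschitz_on UNIV (\<lambda>a. max 0 (a $ s + (1 - lam \<bullet> a)))"
      by (rule Lipschitz_on_compose[of _ _ UNIV "max 0"]) (auto simp: dist_real_def max_def intro!: Lipschitz_on_nonexpansive)
    then show ?thesis by (simp add: pos_shift_def)
  qed
  then have L2: "Lipschitz_on UNIV (\<lambda>a. lam \<bullet> pos_shift a)" by (intro Lipschitz_on_inner_lam Lipschitz_on_vec)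
  show ?thesis
  proof (rule Lipschitz_on_vec)
    fix s
    have "\<bar>pos_shift a $ s\<bar> \<le> 1 / lam $ s * (lam \<bullet> pos_shift a)" for a
    proof -
      have "lam $ s * pos_shift a $ s \<le> (\<Sum>t\<in>UNIV. lam $ t * pos_shift a $ t)"
        using lam_pos pos_shift_nonneg by (intro member_le_sum) (auto simp: less_imp_le)
      then show ?thesis using lam_pos[of s] pos_shift_nonneg[of a s] by (simp add: inner_vec_def field_simps)
    qed
    from Lipschitz_on_quotient[OF L1 L2 mass_ge_1 this]
    show "Lipschitz_on UNIV (\<lambda>z. simplex_retract z $ s)" by (simp add: simplex_retract_def)
  qed
qed

text \<open>
  The solution of the extended system keeps its velocity in the simplex: \<open>\<langle>\<lambda>, A\<rangle>\<close> is constant, and where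
  \<open>A\<^sub>s < 0\<close> the retracted velocity of species \<open>s\<close> is 0, hence so is its acceleration. Only the clamping
  of the position remains in the equation.
\<close>

lemma flow_exists:
  assumes v: "v \<in> velocity_simplex lam" and "a \<le> b"
  obtains \<Phi> A where "\<Phi> a = x" "A a = v"
    and "\<And>q. q \<in> {a..b} \<Longrightarrow> A q \<in> velocity_simplex lam"
    and "\<And>q. q \<in> {a..b} \<Longrightarrow> (\<Phi> has_vector_derivative A q) (at q within {a..b})"
    and "\<And>q. q \<in> {a..b} \<Longrightarrow> (A has_vector_derivative field (unit_clamp (\<Phi> q)) (A q)) (at q within {a..b})"
proof -
  define F where "F z = (snd z, field (unit_clamp (fst z)) (simplex_retract (snd z)))" for z
  have "Lipschitz_on UNIV (\<lambda>z :: (real^'s) \<times> (real^'s). (unit_clamp (fst z), simplex_retract (snd z)))"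
    by (intro Lipschitz_on_Pair Lipschitz_on_compose[of _ fst UNIV unit_clamp] Lipschitz_on_compose[of _ snd UNIV simplex_retract]
        Lipschitz_on_unit_clamp Lipschitz_on_simplex_retract Lipschitz_on_nonexpansive dist_fst_le dist_snd_le) auto
  moreover have "(\<lambda>z. (unit_clamp (fst z), simplex_retract (snd z))) ` UNIV \<subseteq> phase"
    by (auto simp: phase_def unit_clamp_in simplex_retract_in)
  ultimately have "Lipschitz_on UNIV (\<lambda>z. field (unit_clamp (fst z)) (simplex_retract (snd z)))"
    using Lipschitz_on_compose[OF _ Lipschitz_on_field] by fastforce
  then have "Lipschitz_on UNIV F" unfolding F_def
    by (rule Lipschitz_on_Pair[OF Lipschitz_on_nonexpansive[OF dist_snd_le]])
  then obtain L where "L-lipschitz_on UNIV F" by (auto simp: Lipschitz_on_def)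
  then obtain y where y0: "y a = (x, v)"
    and y: "\<And>t. t \<in> {a..b} \<Longrightarrow> (y has_vector_derivative F (y t)) (at t within {a..b})"
    using picard_lindelof_global[of L F a b "(x, v)"] \<open>a \<le> b\<close> by blast
  define \<Phi> where "\<Phi> t = fst (y t)" for t
  define A where "A t = snd (y t)" for t
  have d\<Phi>: "(\<Phi> has_vector_derivative A q) (at q within {a..b})" if "q \<in> {a..b}" for q
    using bounded_linear.has_vector_derivative[OF bounded_linear_fst y[OF that]]
    by (simp add: \<Phi>_def[abs_def] A_def F_def)
  have dA: "(A has_vector_derivative field (unit_clamp (\<Phi> q)) (simplex_retract (A q))) (at q within {a..b})"
    if "q \<in> {a..b}" for q
    using bounded_linear.has_vector_derivative[OF bounded_linear_snd y[OF that]]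
    by (simp add: \<Phi>_def A_def[abs_def] F_def)
  have init: "\<Phi> a = x" "A a = v" by (simp_all add: \<Phi>_def A_def y0)
  have mass: "lam \<bullet> A q = 1" if q: "q \<in> {a..b}" for q
  proof -
    have "((\<lambda>q. lam \<bullet> A q) has_vector_derivative 0) (at q within {a..b})" if "q \<in> {a..b}" for q
      using bounded_linear.has_vector_derivative[OF bounded_linear_inner_right dA[OF that], of lam]
      by (simp add: field_tangent[OF unit_clamp_in simplex_retract_in])
    then obtain c where c: "\<And>q. q \<in> {a..b} \<Longrightarrow> lam \<bullet> A q = c"
      using has_vector_derivative_zero_constant[of "{a..b}" "\<lambda>q. lam \<bullet> A q"] by blast
    then have "lam \<bullet> A q = lam \<bullet> A a" using q \<open>a \<le> b\<close> by (metis atLeastAtMost_iff order_refl)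
    then show ?thesis using v init by (simp add: velocity_simplex_def)
  qed
  have dAs: "((\<lambda>q. A q $ s) has_vector_derivative field (unit_clamp (\<Phi> q)) (simplex_retract (A q)) $ s) (at q within {a..b})"
    if "q \<in> {a..b}" for q s
    using bounded_linear.has_vector_derivative[OF bounded_linear_vec_nth dA[OF that]] .
  have nonneg: "0 \<le> A t $ s" if t: "t \<in> {a..b}" for t s
  proof (rule ccontr)
    assume neg: "\<not> 0 \<le> A t $ s"
    have contAs: "continuous_on {a..b} (\<lambda>q. A q $ s)"
      using dAs has_vector_derivative_continuous by (fastforce simp: continuous_on_eq_continuous_within)
    have cont: "continuous_on {a..t} (\<lambda>q. A q $ s)"
      by (rule continuous_on_subset[OF contAs]) (use t in auto)
    obtain r where r: "a \<le> r" "r < t" "A r $ s = 0" and below: "\<And>q. r < q \<Longrightarrow> q \<le> t \<Longrightarrow> A q $ s < 0"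
      by (rule last_zero[OF cont]) (use t neg init v in \<open>auto simp: velocity_simplex_def\<close>)
    have "A r $ s \<le> A t $ s"
    proof (rule DERIV_nonneg_imp_increasing_open[where f = "\<lambda>q. A q $ s"])
      show "continuous_on {r..t} (\<lambda>q. A q $ s)"
        by (rule continuous_on_subset[OF contAs]) (use r t in auto)
      fix q assume q: "r < q" "q < t"
      then have q': "q \<in> {a..b}" "q \<in> {a<..<b}" using r t by auto
      have "field (unit_clamp (\<Phi> q)) (simplex_retract (A q)) $ s = 0"
        using below[of q] q mass[OF q'(1)]
        by (intro field_zero[OF unit_clamp_in simplex_retract_in] simplex_retract_zero) auto
      then have "((\<lambda>q. A q $ s) has_real_derivative 0) (at q within {a..b})"
        using dAs[OF q'(1), of s] by (simp add: has_real_derivative_iff_has_vector_derivative)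
      then have "((\<lambda>q. A q $ s) has_real_derivative 0) (at q)"
        using at_within_Icc_at[of a q b] q'(2) by simp
      then show "\<exists>y. ((\<lambda>q. A q $ s) has_real_derivative y) (at q) \<and> 0 \<le> y" by blast
    qed (use r in simp)
    then show False using r neg by simp
  qed
  have inS: "A q \<in> velocity_simplex lam" if "q \<in> {a..b}" for q
    using nonneg mass that by (simp add: velocity_simplex_def)
  show thesis
    using that[OF init inS d\<Phi>] dA simplex_retract_id[OF inS] by simp
qed

text \<open>
  The competitor \<open>\<Theta>\<close> is not assumed to stay in the cube; it need only satisfy the equation while it
  is in the domain of the vector field, and being nonnegative it is there as long as it is within
  \<open>1/2\<close> of \<open>\<Phi>\<close>.
\<close>

lemma flow_unique:
  assumes d\<Phi>: "\<And>q. q \<in> {a..b} \<Longrightarrow> (\<Phi> has_vector_derivative A q) (at q within {a..b})"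
    and dA: "\<And>q. q \<in> {a..b} \<Longrightarrow> (A has_vector_derivative field (\<Phi> q) (A q)) (at q within {a..b})"
    and \<Phi>_box: "\<And>q s. q \<in> {a..b} \<Longrightarrow> 0 \<le> \<Phi> q $ s \<and> \<Phi> q $ s \<le> 1"
    and A_in: "\<And>q. q \<in> {a..b} \<Longrightarrow> A q \<in> velocity_simplex lam"
    and d\<Theta>: "\<And>q. q \<in> {a..b} \<Longrightarrow> (\<Theta> has_vector_derivative E q) (at q within {a..b})"
    and dE: "\<And>q. q \<in> {a..b} \<Longrightarrow> (E has_vector_derivative E2 q) (at q within {a..b})"
    and E2: "\<And>q. q \<in> {a..b} \<Longrightarrow> \<Theta> q \<in> species_box \<Longrightarrow> E2 q = field (\<Theta> q) (E q)"
    and \<Theta>_nonneg: "\<And>q s. q \<in> {a..b} \<Longrightarrow> 0 \<le> \<Theta> q $ s"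
    and E_in: "\<And>q. q \<in> {a..b} \<Longrightarrow> E q \<in> velocity_simplex lam"
    and init: "\<Phi> a = \<Theta> a" "A a = E a"
    and t: "t \<in> {a..b}"
  shows "\<Theta> t = \<Phi> t"
proof -
  define d where "d q = (\<Phi> q - \<Theta> q, A q - E q)" for q
  define d' where "d' q = (A q - E q, field (\<Phi> q) (A q) - E2 q)" for q
  have dd: "(d has_vector_derivative d' q) (at q within {a..b})" if "q \<in> {a..b}" for q
    unfolding d_def[abs_def] d'_def
    by (intro has_vector_derivative_Pair has_vector_derivative_diff d\<Phi> dA d\<Theta> dE that)
  define D where "D q = d q \<bullet> d q" for q
  have dD: "(D has_vector_derivative 2 * (d q \<bullet> d' q)) (at q within {a..b})" if "q \<in> {a..b}" for q
    using bounded_bilinear.has_vector_derivative[OF bounded_bilinear_inner dd[OF that] dd[OF that]]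
    by (simp add: D_def[abs_def] inner_commute)
  obtain L where L: "L-lipschitz_on phase (\<lambda>z. field (fst z) (snd z))"
    using Lipschitz_on_field by (auto simp: Lipschitz_on_def)
  have L0: "0 \<le> L" using L lipschitz_on_nonneg by blast
  have "D t = 0"
  proof (rule gronwall_zero[where D = D and a = a and b = b and t = t and e = "1/4" and L = "2 * (1 + L)"])
    show "continuous_on {a..b} D"
      using dD has_vector_derivative_continuous by (fastforce simp: continuous_on_eq_continuous_within)
    show "D a = 0" by (simp add: D_def d_def init)
    show "0 \<le> D q" for q by (simp add: D_def)
    fix q assume q: "q \<in> {a<..<b}" and small: "D q < 1/4"
    have q': "q \<in> {a..b}" using q by auto
    have "(norm (\<Phi> q - \<Theta> q))\<^sup>2 \<le> D q"
      by (simp add: D_def d_def inner_Pair power2_norm_eq_inner)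
    then have "(norm (\<Phi> q - \<Theta> q))\<^sup>2 < (1/2)\<^sup>2" using small by (simp add: power2_eq_square)
    then have n: "norm (\<Phi> q - \<Theta> q) < 1/2" by (rule power_less_imp_less_base) simp
    have "\<Theta> q \<in> species_box"
      unfolding species_box_def
    proof (intro CollectI allI conjI)
      fix s
      show "0 \<le> \<Theta> q $ s" by (rule \<Theta>_nonneg[OF q'])
      have "\<bar>(\<Phi> q - \<Theta> q) $ s\<bar> \<le> norm (\<Phi> q - \<Theta> q)" by (rule component_le_norm_cart)
      then show "\<Theta> q $ s \<le> 3/2" using n \<Phi>_box[OF q', of s] by (simp add: abs_le_iff)
    qed
    moreover have "\<Phi> q \<in> species_box"
    proof -
      have "\<Phi> q $ s \<le> 3/2" for s using \<Phi>_box[OF q', of s] by linarith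
      then show ?thesis using \<Phi>_box[OF q'] by (simp add: species_box_def)
    qed
    ultimately have ph: "(\<Phi> q, A q) \<in> phase" "(\<Theta> q, E q) \<in> phase" and e2: "E2 q = field (\<Theta> q) (E q)"
      using A_in[OF q'] E_in[OF q'] E2[OF q'] by (auto simp: phase_def)
    have nd: "norm (d q) = dist (\<Phi> q, A q) (\<Theta> q, E q)" by (simp add: d_def dist_norm)
    have "norm (d' q) \<le> norm (A q - E q) + norm (field (\<Phi> q) (A q) - E2 q)"
      unfolding d'_def by (rule norm_Pair_le)
    also have "\<dots> \<le> norm (d q) + L * norm (d q)"
    proof (rule add_mono)
      show "norm (A q - E q) \<le> norm (d q)" using norm_snd_le[of "A q - E q" "\<Phi> q - \<Theta> q"] by (simp add: d_def)
      show "norm (field (\<Phi> q) (A q) - E2 q) \<le> L * norm (d q)"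
        using lipschitz_onD[OF L ph] by (simp add: nd e2 dist_norm)
    qed
    finally have d'_le: "norm (d' q) \<le> (1 + L) * norm (d q)" by (simp add: algebra_simps)
    have "d q \<bullet> d' q \<le> norm (d q) * norm (d' q)" by (rule norm_cauchy_schwarz)
    also have "\<dots> \<le> norm (d q) * ((1 + L) * norm (d q))"
      by (intro mult_left_mono d'_le) simp
    also have "\<dots> = (1 + L) * D q" by (simp add: D_def power2_norm_eq_inner[symmetric] power2_eq_square)
    finally have "2 * (d q \<bullet> d' q) \<le> 2 * (1 + L) * D q"
      by (simp only: mult.assoc mult_le_cancel_left_pos zero_less_numeral)
    moreover have "(D has_real_derivative 2 * (d q \<bullet> d' q)) (at q)"
      using dD[OF q'] q at_within_Icc_at[of a q b] by (simp add: has_real_derivative_iff_has_vector_derivative)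
    ultimately show "\<exists>D'. (D has_real_derivative D') (at q) \<and> D' \<le> 2 * (1 + L) * D q" by blast
  qed (use t in simp_all)
  then have "d t = 0" by (simp add: D_def)
  then show ?thesis by (simp add: d_def zero_prod_def)
qed

lemma component_zero_backward:
  assumes dA: "\<And>q. q \<in> {a..b} \<Longrightarrow> (A has_vector_derivative field (\<Phi> q) (A q)) (at q within {a..b})"
    and \<Phi>_box: "\<And>q. q \<in> {a..b} \<Longrightarrow> \<Phi> q \<in> species_box"
    and A_in: "\<And>q. q \<in> {a..b} \<Longrightarrow> A q \<in> velocity_simplex lam"
    and t: "t \<in> {a..b}" and zero: "A t $ s = 0" and r: "r \<in> {a..t}"
  shows "A r $ s = 0"
proof -
  obtain M where M: "\<And>x a. x \<in> species_box \<Longrightarrow> a \<in> velocity_simplex lam \<Longrightarrow> \<bar>field x a $ s\<bar> \<le> M * a $ s"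
    using field_bound by blast
  have dAs: "((\<lambda>q. A q $ s) has_vector_derivative field (\<Phi> q) (A q) $ s) (at q within {a..b})"
    if "q \<in> {a..b}" for q
    using bounded_linear.has_vector_derivative[OF bounded_linear_vec_nth dA[OF that]] .
  have contAs: "continuous_on {a..b} (\<lambda>q. A q $ s)"
    using dAs has_vector_derivative_continuous by (fastforce simp: continuous_on_eq_continuous_within)
  have "A r $ s * exp (M * r) \<le> A t $ s * exp (M * t)"
  proof (rule DERIV_nonneg_imp_increasing_open[where f = "\<lambda>q. A q $ s * exp (M * q)"])
    show "r \<le> t" using r by simp
    show "continuous_on {r..t} (\<lambda>q. A q $ s * exp (M * q))"
      by (intro continuous_intros continuous_on_subset[OF contAs]) (use r t in auto)
    fix q assume q: "r < q" "q < t"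
    then have q': "q \<in> {a..b}" "q \<in> {a<..<b}" using r t by auto
    have "((\<lambda>q. A q $ s) has_real_derivative field (\<Phi> q) (A q) $ s) (at q)"
      using dAs[OF q'(1)] q'(2) at_within_Icc_at[of a q b]
      by (simp add: has_real_derivative_iff_has_vector_derivative)
    then have "((\<lambda>q. A q $ s * exp (M * q)) has_real_derivative
        (field (\<Phi> q) (A q) $ s + M * A q $ s) * exp (M * q)) (at q)"
      by (auto intro!: derivative_eq_intros simp: algebra_simps)
    moreover have "0 \<le> field (\<Phi> q) (A q) $ s + M * A q $ s"
      using M[OF \<Phi>_box[OF q'(1)] A_in[OF q'(1)]] by linarith
    ultimately show "\<exists>y. ((\<lambda>q. A q $ s * exp (M * q)) has_real_derivative y) (at q) \<and> 0 \<le> y"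
      by (meson exp_ge_zero mult_nonneg_nonneg)
  qed
  then have "A r $ s \<le> 0" using zero by (simp add: mult_le_0_iff)
  moreover have "0 \<le> A r $ s" using A_in[of r] r t by (auto simp: velocity_simplex_def)
  ultimately show ?thesis by simp
qed

text \<open>
  A species that reaches 1 strictly before the final time has never moved: it stays at 1, so
  its velocity vanishes at a later time and hence at all earlier ones.
\<close>

lemma boundary_not_before_end:
  assumes d\<Phi>: "\<And>q. q \<in> {a..b} \<Longrightarrow> (\<Phi> has_vector_derivative A q) (at q within {a..b})"
    and dA: "\<And>q. q \<in> {a..b} \<Longrightarrow> (A has_vector_derivative field (\<Phi> q) (A q)) (at q within {a..b})"
    and \<Phi>_box: "\<And>q s. q \<in> {a..b} \<Longrightarrow> 0 \<le> \<Phi> q $ s \<and> \<Phi> q $ s \<le> 1"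
    and mono: "mono_on {a..b} (\<lambda>q. \<Phi> q $ s)"
    and A_in: "\<And>q. q \<in> {a..b} \<Longrightarrow> A q \<in> velocity_simplex lam"
    and t: "a \<le> t" "t < b" and one: "\<Phi> t $ s = 1"
  shows "\<Phi> a $ s = 1 \<and> A a $ s = 0"
proof -
  define m where "m = (t + b) / 2"
  have m: "t < m" "m < b" "m \<in> {a..b}" using t by (auto simp: m_def)
  have box: "\<Phi> q \<in> species_box" if "q \<in> {a..b}" for q
  proof -
    have "\<Phi> q $ s \<le> 3/2" for s using \<Phi>_box[OF that, of s] by linarith
    then show ?thesis using \<Phi>_box[OF that] by (simp add: species_box_def)
  qed
  have d\<Phi>s: "((\<lambda>q. \<Phi> q $ s) has_vector_derivative A q $ s) (at q within {a..b})"
    if "q \<in> {a..b}" for q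
    using bounded_linear.has_vector_derivative[OF bounded_linear_vec_nth d\<Phi>[OF that]] .
  have const: "\<Phi> q $ s = 1" if "t \<le> q" "q \<le> b" for q
    using mono_onD[OF mono, of t q] \<Phi>_box[of q s] one that t by force
  have "((\<lambda>q. \<Phi> q $ s) has_vector_derivative A m $ s) (at m within {t..b})"
    by (rule has_vector_derivative_within_subset[OF d\<Phi>s[OF m(3)]]) (use t in auto)
  moreover have "((\<lambda>q. \<Phi> q $ s) has_vector_derivative 0) (at m within {t..b})"
    by (rule has_vector_derivative_transform_within[OF has_vector_derivative_const[of 1], of 1]) (use m const in auto)
  ultimately have Am: "A m $ s = 0"
    using vector_derivative_unique_within_closed_interval[of t b m] m t by auto
  have zero: "A r $ s = 0" if "r \<in> {a..m}" for r
    by (rule component_zero_backward[OF dA box A_in m(3) Am that])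
  have "((\<lambda>q. \<Phi> q $ s) has_vector_derivative 0) (at q within {a..m})" if "q \<in> {a..m}" for q
    using has_vector_derivative_within_subset[OF d\<Phi>s, of q "{a..m}"] zero[OF that] that m by auto
  then obtain c where "\<And>q. q \<in> {a..m} \<Longrightarrow> \<Phi> q $ s = c"
    using has_vector_derivative_zero_constant[of "{a..m}" "\<lambda>q. \<Phi> q $ s"] by blast
  then have "\<Phi> a $ s = \<Phi> m $ s" using m by simp
  then show ?thesis using const[of m] zero[of a] m t by auto
qed

end

section \<open>Equivalence of the ODE and the vector field\<close>

context species_model
begin

lemma has_vector_derivative_dxi:
  assumes \<Phi>: "(\<Phi> has_vector_derivative w) (at q within S)"
    and A: "(A has_vector_derivative z) (at q within S)"
    and dom: "\<And>s. \<bar>\<Phi> q $ s\<bar> < 2" and w: "w = A q"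
  shows "((\<lambda>u. dxi (\<Phi> u) (A u) s) has_vector_derivative dxi (\<Phi> q) z s + ddxi (\<Phi> q) (A q) s) (at q within S)"
proof -
  have H: "((\<lambda>u. H s t (\<Phi> u)) has_vector_derivative (\<Sum>u\<in>UNIV. A q $ u * T s t u (\<Phi> q))) (at q within S)" for t
    using vector_derivative_diff_chain_within[OF \<Phi> has_derivative_at_withinI[OF H_deriv[OF dom]], of s t]
    by (simp add: o_def w)
  have At: "((\<lambda>u. A u $ t) has_vector_derivative z $ t) (at q within S)" for t
    using bounded_linear.has_vector_derivative[OF bounded_linear_vec_nth A] .
  have "((\<lambda>u. \<Sum>t\<in>UNIV. A u $ t * H s t (\<Phi> u)) has_vector_derivative
      (\<Sum>t\<in>UNIV. A q $ t * (\<Sum>u\<in>UNIV. A q $ u * T s t u (\<Phi> q)) + z $ t * H s t (\<Phi> q))) (at q within S)"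
    by (intro has_vector_derivative_sum has_vector_derivative_mult H At)
  then show ?thesis by (simp add: dxi_def ddxi_def sum.distrib add.commute)
qed

lemma has_vector_derivative_xi_species:
  assumes \<Phi>: "(\<Phi> has_vector_derivative w) (at q within S)" and dom: "\<And>s. \<bar>\<Phi> q $ s\<bar> < 2"
  shows "((\<lambda>u. xi_species lam \<gamma> s (\<Phi> u)) has_vector_derivative dxi (\<Phi> q) w s) (at q within S)"
  using vector_derivative_diff_chain_within[OF \<Phi> has_derivative_at_withinI[OF xi_deriv[OF dom]], of s]
  by (simp add: o_def dxi_def)

lemma has_vector_derivative_sqrt_quotient:
  fixes f g :: "real \<Rightarrow> real"
  assumes "(f has_vector_derivative f') (at q within S)" "(g has_vector_derivative g') (at q within S)"
    and "0 < f q" "0 < g q"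
  shows "((\<lambda>u. sqrt (f u / g u)) has_vector_derivative
    (f' * g q - f q * g') / (g q)\<^sup>2 / (2 * sqrt (f q / g q))) (at q within S)"
  using assms unfolding has_real_derivative_iff_has_vector_derivative[symmetric]
  by (auto intro!: derivative_eq_intros simp: field_simps power2_eq_square)

lemma has_vector_derivative_vec:
  fixes f :: "real \<Rightarrow> 'n::finite \<Rightarrow> real"
  assumes "\<And>i. ((\<lambda>u. f u i) has_vector_derivative f' i) (at q within S)"
  shows "((\<lambda>u. \<chi> i. f u i) has_vector_derivative (\<chi> i. f' i)) (at q within S)"
proof -
  have "((\<lambda>u. \<chi> i. f u i) has_derivative (\<lambda>h. \<chi> i. h *\<^sub>R f' i)) (at q within S)"
    using assms unfolding has_vector_derivative_def
    by (subst has_derivative_componentwise_within) (auto simp: Basis_vec_def inner_axis)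
  moreover have "(\<lambda>h. \<chi> i. h *\<^sub>R f' i) = (\<lambda>h. h *\<^sub>R (\<chi> i. f' i))" by (auto simp: vec_eq_iff)
  ultimately show ?thesis by (simp add: has_vector_derivative_def)
qed

text \<open>
  The ODE determines the acceleration at every time at which the position is in the domain of the
  vector field. No assumption is made about positions at other times.
\<close>

lemma ode_imp_field:
  assumes ode: "tree_descending_ode lam \<gamma> a b \<Phi> \<Phi>1 \<Phi>2" and "a < b" and q: "q \<in> {a..b}"
    and box: "\<Phi> q \<in> species_box" and simplex: "\<Phi>1 q \<in> velocity_simplex lam" and tang: "lam \<bullet> \<Phi>2 q = 0"
  shows "\<Phi>2 q = field (\<Phi> q) (\<Phi>1 q)"
proof -
  from ode obtain G1 G2 where
    d0: "\<And>u. u \<in> {a..b} \<Longrightarrow> (\<Phi> has_vector_derivative \<Phi>1 u) (at u within {a..b})"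
    and d1: "\<And>u. u \<in> {a..b} \<Longrightarrow> (\<Phi>1 has_vector_derivative \<Phi>2 u) (at u within {a..b})"
    and g0: "\<And>u. u \<in> {a..b} \<Longrightarrow> ((\<lambda>q. \<chi> s. xi_species lam \<gamma> s (\<Phi> q)) has_vector_derivative G1 u) (at u within {a..b})"
    and g1: "\<And>u. u \<in> {a..b} \<Longrightarrow> (G1 has_vector_derivative G2 u) (at u within {a..b})"
    and eq: "if \<forall>s. \<Phi>1 q $ s \<noteq> 0
          then \<exists>R. ((\<lambda>u. \<chi> s. sqrt (\<Phi>1 u $ s / G1 u $ s)) has_vector_derivative R)
                     (at q within {a..b}) \<and>
                   (\<forall>s s'. 1 / \<Phi>1 q $ s * R $ s = 1 / \<Phi>1 q $ s' * R $ s')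
          else \<exists>\<Psi>. \<forall>s. \<Phi>2 q $ s * G1 q $ s - \<Phi>1 q $ s * G2 q $ s
                     = 2 * \<Psi> * (\<Phi>1 q $ s * G1 q $ s) powr (3 / 2)"
    using q unfolding tree_descending_ode_def deriv_on_def by blast
  have uniq: "D = D'" if "(f has_vector_derivative D) (at u within {a..b})"
    "(f has_vector_derivative D') (at u within {a..b})" "u \<in> {a..b}"
    for f :: "real \<Rightarrow> real" and D D' u
    using vector_derivative_unique_within_closed_interval[of a b u f D D'] that \<open>a < b\<close> by simp
  have G1: "G1 u $ s = dxi (\<Phi> u) (\<Phi>1 u) s" if u: "u \<in> {a..b}" and dom: "\<And>s. \<bar>\<Phi> u $ s\<bar> < 2" for u s
  proof (rule uniq[OF _ _ u])
    show "((\<lambda>q. xi_species lam \<gamma> s (\<Phi> q)) has_vector_derivative G1 u $ s) (at u within {a..b})"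
      using bounded_linear.has_vector_derivative[OF bounded_linear_vec_nth g0[OF u], of s] by simp
  qed (rule has_vector_derivative_xi_species[OF d0[OF u] dom])
  have domq: "\<bar>\<Phi> q $ s\<bar> < 2" for s
  proof -
    have "0 \<le> \<Phi> q $ s" "\<Phi> q $ s \<le> 3/2" using box by (auto simp: species_box_def)
    then show ?thesis by simp
  qed
  \<comment> \<open>The formula for \<open>G1\<close> is needed in a neighbourhood of \<open>q\<close>, since it gets differentiated there.\<close>
  have near: "\<exists>d>0. \<forall>u\<in>{a..b}. dist u q < d \<longrightarrow> (\<forall>s. \<bar>\<Phi> u $ s\<bar> < 2)"
  proof -
    have "continuous_on {a..b} \<Phi>"
      using d0 has_vector_derivative_continuous by (fastforce simp: continuous_on_eq_continuous_within)
    then obtain d where d: "d > 0" "\<And>u. u \<in> {a..b} \<Longrightarrow> dist u q < d \<Longrightarrow> dist (\<Phi> u) (\<Phi> q) < 1/2"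
      unfolding continuous_on_iff using q by (metis half_gt_zero_iff zero_less_one)
    have "\<bar>\<Phi> u $ s\<bar> < 2" if "u \<in> {a..b}" "dist u q < d" for u s
    proof -
      have "\<bar>\<Phi> u $ s - \<Phi> q $ s\<bar> < 1/2"
        using d(2)[OF that] dist_vec_nth_le[of "\<Phi> u" s "\<Phi> q"] by (simp add: dist_real_def)
      moreover have "0 \<le> \<Phi> q $ s" "\<Phi> q $ s \<le> 3/2" using box by (auto simp: species_box_def)
      ultimately show ?thesis by linarith
    qed
    then show ?thesis using d(1) by blast
  qed
  then obtain d where d: "d > 0" "\<And>u s. u \<in> {a..b} \<Longrightarrow> dist u q < d \<Longrightarrow> \<bar>\<Phi> u $ s\<bar> < 2" by blast
  have g1s: "((\<lambda>u. G1 u $ s) has_vector_derivative G2 q $ s) (at q within {a..b})" for s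
    using bounded_linear.has_vector_derivative[OF bounded_linear_vec_nth g1[OF q]] .
  have G2: "G2 q $ s = dxi (\<Phi> q) (\<Phi>2 q) s + ddxi (\<Phi> q) (\<Phi>1 q) s" for s
  proof (rule uniq[OF g1s _ q])
    show "((\<lambda>u. G1 u $ s) has_vector_derivative dxi (\<Phi> q) (\<Phi>2 q) s + ddxi (\<Phi> q) (\<Phi>1 q) s) (at q within {a..b})"
      by (rule has_vector_derivative_transform_within[OF has_vector_derivative_dxi[OF d0[OF q] d1[OF q] domq refl] d(1) q])
        (simp add: G1 d(2))
  qed
  have Bp: "0 < dxi (\<Phi> q) (\<Phi>1 q) s" for s by (rule dxi_pos[OF box simplex])
  have "\<exists>\<psi>. \<forall>s. \<Phi>2 q $ s * G1 q $ s - \<Phi>1 q $ s * G2 q $ s = 2 * \<psi> * (\<Phi>1 q $ s * G1 q $ s) powr (3/2)"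
  proof (cases "\<forall>s. \<Phi>1 q $ s \<noteq> 0")
    case True
    then have pos: "0 < \<Phi>1 q $ s" for s using simplex by (simp add: velocity_simplex_def less_le)
    have G1p: "0 < G1 q $ s" for s using Bp by (simp add: G1[OF q domq])
    from True eq obtain R where
      R: "((\<lambda>u. \<chi> s. sqrt (\<Phi>1 u $ s / G1 u $ s)) has_vector_derivative R) (at q within {a..b})"
      and Req: "\<And>s s'. 1 / \<Phi>1 q $ s * R $ s = 1 / \<Phi>1 q $ s' * R $ s'" by auto
    define \<psi> where "\<psi> = 1 / \<Phi>1 q $ undefined * R $ undefined"
    have "\<Phi>2 q $ s * G1 q $ s - \<Phi>1 q $ s * G2 q $ s = 2 * \<psi> * (\<Phi>1 q $ s * G1 q $ s) powr (3/2)" for s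
    proof -
      define N where "N = \<Phi>2 q $ s * G1 q $ s - \<Phi>1 q $ s * G2 q $ s"
      have d1s: "((\<lambda>u. \<Phi>1 u $ s) has_vector_derivative \<Phi>2 q $ s) (at q within {a..b})"
        using bounded_linear.has_vector_derivative[OF bounded_linear_vec_nth d1[OF q]] .
      have Rs: "((\<lambda>u. sqrt (\<Phi>1 u $ s / G1 u $ s)) has_vector_derivative R $ s) (at q within {a..b})"
        using bounded_linear.has_vector_derivative[OF bounded_linear_vec_nth R, of s] by simp
      have Req': "R $ s = N / (G1 q $ s)\<^sup>2 / (2 * sqrt (\<Phi>1 q $ s / G1 q $ s))"
        unfolding N_def
        by (rule uniq[OF Rs has_vector_derivative_sqrt_quotient[OF d1s g1s pos G1p] q])
      have "\<psi> = R $ s / \<Phi>1 q $ s" using Req[of undefined s] by (simp add: \<psi>_def)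
      also have "\<dots> = N / (2 * (\<Phi>1 q $ s * G1 q $ s) powr (3/2))"
        unfolding Req' by (rule three_halves_identity[OF pos G1p])
      finally have "\<psi> = N / (2 * (\<Phi>1 q $ s * G1 q $ s) powr (3/2))" .
      then show ?thesis using pos[of s] G1p[of s] by (simp add: N_def field_simps)
    qed
    then show ?thesis by blast
  next
    case False
    then show ?thesis using eq by (simp only: if_False)
  qed
  then obtain \<psi> where "\<And>s. \<Phi>2 q $ s * G1 q $ s - \<Phi>1 q $ s * G2 q $ s = 2 * \<psi> * (\<Phi>1 q $ s * G1 q $ s) powr (3/2)"
    by blast
  then have "acc_eq (\<Phi> q) (\<Phi>1 q) (\<Phi>2 q) \<psi>"
    unfolding acc_eq_def using tang by (simp add: G2 G1[OF q domq])
  then show ?thesis by (rule acc_eq_imp_field[OF box simplex])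
qed

lemma field_imp_ode:
  assumes d\<Phi>: "\<And>q. q \<in> {a..b} \<Longrightarrow> (\<Phi> has_vector_derivative A q) (at q within {a..b})"
    and dA: "\<And>q. q \<in> {a..b} \<Longrightarrow> (A has_vector_derivative field (\<Phi> q) (A q)) (at q within {a..b})"
    and box: "\<And>q. q \<in> {a..b} \<Longrightarrow> \<Phi> q \<in> species_box"
    and simplex: "\<And>q. q \<in> {a..b} \<Longrightarrow> A q \<in> velocity_simplex lam"
  shows "tree_descending_ode lam \<gamma> a b \<Phi> A (\<lambda>q. field (\<Phi> q) (A q))"
proof -
  define G1 where "G1 q = (\<chi> s. dxi (\<Phi> q) (A q) s)" for q
  define G2 where "G2 q = (\<chi> s. dxi (\<Phi> q) (field (\<Phi> q) (A q)) s + ddxi (\<Phi> q) (A q) s)" for q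
  have dom: "\<bar>\<Phi> q $ s\<bar> < 2" if "q \<in> {a..b}" for q s
  proof -
    have "0 \<le> \<Phi> q $ s" "\<Phi> q $ s \<le> 3/2" using box[OF that] by (auto simp: species_box_def)
    then show ?thesis by simp
  qed
  have g0: "deriv_on a b (\<lambda>q. \<chi> s. xi_species lam \<gamma> s (\<Phi> q)) G1"
    unfolding deriv_on_def G1_def
    by (intro ballI has_vector_derivative_vec has_vector_derivative_xi_species d\<Phi> dom)
  have g1: "deriv_on a b G1 G2"
    unfolding deriv_on_def G1_def[abs_def] G2_def
    by (intro ballI has_vector_derivative_vec has_vector_derivative_dxi[OF d\<Phi> dA] dom) auto
  have pt: "if \<forall>s. A q $ s \<noteq> 0
          then \<exists>R. ((\<lambda>u. \<chi> s. sqrt (A u $ s / G1 u $ s)) has_vector_derivative R)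
                     (at q within {a..b}) \<and>
                   (\<forall>s s'. 1 / A q $ s * R $ s = 1 / A q $ s' * R $ s')
          else \<exists>\<Psi>. \<forall>s. field (\<Phi> q) (A q) $ s * G1 q $ s - A q $ s * G2 q $ s
                     = 2 * \<Psi> * (A q $ s * G1 q $ s) powr (3 / 2)" if q: "q \<in> {a..b}" for q
  proof -
    define \<psi> where "\<psi> = snd (acc_sol (\<Phi> q, A q))"
    define N where "N s = field (\<Phi> q) (A q) $ s * G1 q $ s - A q $ s * G2 q $ s" for s
    have N: "N s = 2 * \<psi> * (A q $ s * G1 q $ s) powr (3 / 2)" for s
      using acc_eq_field[OF box[OF q] simplex[OF q]] by (simp add: acc_eq_def \<psi>_def G1_def G2_def N_def)
    show ?thesis
    proof (cases "\<forall>s. A q $ s \<noteq> 0")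
      case True
      then have pos: "0 < A q $ s" for s using simplex[OF q] by (simp add: velocity_simplex_def less_le)
      have G1p: "0 < G1 q $ s" for s using dxi_pos[OF box[OF q] simplex[OF q]] by (simp add: G1_def)
      have As: "((\<lambda>u. A u $ s) has_vector_derivative field (\<Phi> q) (A q) $ s) (at q within {a..b})" for s
        using bounded_linear.has_vector_derivative[OF bounded_linear_vec_nth dA[OF q]] .
      have Gs: "((\<lambda>u. G1 u $ s) has_vector_derivative G2 q $ s) (at q within {a..b})" for s
        using bounded_linear.has_vector_derivative[OF bounded_linear_vec_nth g1[unfolded deriv_on_def, rule_format, OF q]] .
      define R where "R = (\<chi> s. N s / (G1 q $ s)\<^sup>2 / (2 * sqrt (A q $ s / G1 q $ s)))"
      have "((\<lambda>u. \<chi> s. sqrt (A u $ s / G1 u $ s)) has_vector_derivative R) (at q within {a..b})"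
        unfolding R_def N_def
        by (intro has_vector_derivative_vec has_vector_derivative_sqrt_quotient As Gs pos G1p)
      moreover have "1 / A q $ s * R $ s = \<psi>" for s
      proof -
        have "1 / A q $ s * R $ s = N s / (G1 q $ s)\<^sup>2 / (2 * sqrt (A q $ s / G1 q $ s)) / A q $ s"
          by (simp only: R_def vec_lambda_beta times_divide_eq_left mult_1)
        also have "\<dots> = N s / (2 * (A q $ s * G1 q $ s) powr (3/2))"
          by (rule three_halves_identity[OF pos G1p])
        also have "\<dots> = \<psi>" using pos[of s] G1p[of s] by (simp add: N)
        finally show ?thesis .
      qed
      ultimately show ?thesis using True by auto
    next
      case False
      then show ?thesis using N unfolding N_def by auto
    qed
  qed
  have "deriv_on a b \<Phi> A" "deriv_on a b A (\<lambda>q. field (\<Phi> q) (A q))"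
    using d\<Phi> dA by (auto simp: deriv_on_def)
  then show ?thesis
    unfolding tree_descending_ode_def using g0 g1 pt
    by (intro conjI exI[of _ G1] exI[of _ G2] ballI)
qed

end

section \<open>Trajectories\<close>

lemma infnorm_eq_Max: "infnorm (y :: real^'n) = Max (range (\<lambda>s. \<bar>y $ s\<bar>))"
proof -
  have "{\<bar>y $ i\<bar> | i. i \<in> UNIV} = range (\<lambda>s. \<bar>y $ s\<bar>)" by auto
  then show ?thesis using infnorm_cart[of y] by (simp add: cSup_eq_Max)
qed

lemma infnorm_less_1_iff: "(\<And>s. 0 \<le> y $ s) \<Longrightarrow> infnorm (y :: real^'n) < 1 \<longleftrightarrow> (\<forall>s. y $ s < 1)"
  by (simp add: infnorm_eq_Max abs_of_nonneg)

lemma infnorm_eq_1_iff: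
  assumes "\<And>s. 0 \<le> y $ s" "\<And>s. y $ s \<le> 1"
  shows "infnorm (y :: real^'n) = 1 \<longleftrightarrow> (\<exists>s. y $ s = 1)"
proof -
  have "infnorm y \<le> 1" using assms by (simp add: infnorm_eq_Max abs_of_nonneg)
  moreover have "infnorm y < 1 \<longleftrightarrow> (\<forall>s. y $ s < 1)" by (rule infnorm_less_1_iff[OF assms(1)])
  ultimately show ?thesis using assms(2) by (metis less_le not_less)
qed

lemma mono_on_derivative_nonneg:
  fixes f :: "real \<Rightarrow> real"
  assumes "mono_on {a..b} f" "(f has_vector_derivative D) (at x within {a..b})" "a < b" "x \<in> {a..b}"
  shows "0 \<le> D"
proof (rule tendsto_lowerbound)
  show "((\<lambda>y. (f y - f x) / (y - x)) \<longlongrightarrow> D) (at x within {a..b})"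
    using assms(2) by (simp add: has_real_derivative_iff_has_vector_derivative[symmetric] has_field_derivative_iff)
  have "0 \<le> (f y - f x) / (y - x)" if "y \<in> {a..b}" for y
    using mono_onD[OF assms(1), of x y] mono_onD[OF assms(1), of y x] assms(4) that
    by (cases "x \<le> y") (auto intro: divide_nonneg_nonneg divide_nonpos_nonpos)
  then show "\<forall>\<^sub>F y in at x within {a..b}. 0 \<le> (f y - f x) / (y - x)"
    by (auto simp: eventually_at_filter)
  show "at x within {a..b} \<noteq> bot"
    using assms(3,4) by (simp add: trivial_limit_within islimpt_Icc)
qed

lemma mono_on_of_derivative_nonneg:
  fixes f :: "real \<Rightarrow> real"
  assumes der: "\<And>x. x \<in> {a..b} \<Longrightarrow> (f has_vector_derivative f' x) (at x within {a..b})"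
    and nonneg: "\<And>x. x \<in> {a..b} \<Longrightarrow> 0 \<le> f' x"
  shows "mono_on {a..b} f"
proof (rule mono_onI)
  fix r t assume rt: "r \<in> {a..b}" "t \<in> {a..b}" "r \<le> t"
  have cont: "continuous_on {a..b} f"
    using der has_vector_derivative_continuous by (fastforce simp: continuous_on_eq_continuous_within)
  show "f r \<le> f t"
  proof (rule DERIV_nonneg_imp_increasing_open[where f = f, OF rt(3)])
    show "continuous_on {r..t} f" by (rule continuous_on_subset[OF cont]) (use rt in auto)
    fix q assume q: "r < q" "q < t"
    then have q': "q \<in> {a..b}" "q \<in> {a<..<b}" using rt by auto
    then have "(f has_real_derivative f' q) (at q)"
      using der[OF q'(1)] at_within_Icc_at[of a q b] by (simp add: has_real_derivative_iff_has_vector_derivative)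
    then show "\<exists>y. (f has_real_derivative y) (at q) \<and> 0 \<le> y" using nonneg[OF q'(1)] by blast
  qed
qed

context species_model
begin

text \<open>
  Solutions of \<open>\<Phi>'' = field \<Phi> \<Phi>'\<close> in the unit cube, with velocity \<open>A\<close> in the simplex.
\<close>

definition flow :: "real \<Rightarrow> real \<Rightarrow> (real \<Rightarrow> real^'s) \<Rightarrow> (real \<Rightarrow> real^'s) \<Rightarrow> bool" where
  "flow a b \<Phi> A \<longleftrightarrow>
     (\<forall>q\<in>{a..b}. (\<Phi> has_vector_derivative A q) (at q within {a..b}) \<and>
        (A has_vector_derivative field (\<Phi> q) (A q)) (at q within {a..b}) \<and>
        (\<forall>s. 0 \<le> \<Phi> q $ s \<and> \<Phi> q $ s \<le> 1) \<and> A q \<in> velocity_simplex lam)"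

lemma flowD:
  assumes "flow a b \<Phi> A" "q \<in> {a..b}"
  shows "(\<Phi> has_vector_derivative A q) (at q within {a..b})"
    and "(A has_vector_derivative field (\<Phi> q) (A q)) (at q within {a..b})"
    and "0 \<le> \<Phi> q $ s" "\<Phi> q $ s \<le> 1" "A q \<in> velocity_simplex lam" "\<Phi> q \<in> species_box"
proof -
  show "(\<Phi> has_vector_derivative A q) (at q within {a..b})"
    and "(A has_vector_derivative field (\<Phi> q) (A q)) (at q within {a..b})"
    and 1: "0 \<le> \<Phi> q $ s" "\<Phi> q $ s \<le> 1" and "A q \<in> velocity_simplex lam" for s
    using assms unfolding flow_def by blast+
  have "\<Phi> q $ s \<le> 3/2" for s using 1(2)[of s] by linarith
  then show "\<Phi> q \<in> species_box" using 1 by (simp add: species_box_def)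
qed

lemma flow_component:
  assumes "flow a b \<Phi> A" "q \<in> {a..b}"
  shows "((\<lambda>q. \<Phi> q $ s) has_vector_derivative A q $ s) (at q within {a..b})"
  using bounded_linear.has_vector_derivative[OF bounded_linear_vec_nth flowD(1)[OF assms]] .

lemma flow_mono: "flow a b \<Phi> A \<Longrightarrow> mono_on {a..b} (\<lambda>q. \<Phi> q $ s)"
  by (rule mono_on_of_derivative_nonneg[where f' = "\<lambda>q. A q $ s"])
    (auto intro: flow_component dest: flowD(5) simp: velocity_simplex_def)

lemma flow_ode: "flow a b \<Phi> A \<Longrightarrow> tree_descending_ode lam \<gamma> a b \<Phi> A (\<lambda>q. field (\<Phi> q) (A q))"
  by (rule field_imp_ode) (rule flowD; assumption)+

lemma flow_ivp: "flow a b \<Phi> A \<Longrightarrow> ivp_solution lam \<gamma> (\<Phi> a) (A a) a b \<Phi>"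
  unfolding ivp_solution_def
  by (intro conjI allI exI[of _ A] exI[of _ "\<lambda>q. field (\<Phi> q) (A q)"] ballI refl flow_mono flow_ode
      field_tangent) (auto intro: flowD)

text \<open>
  A solution of the initial value problem agrees with the flow, without an a priori bound on it.
\<close>

lemma flow_unique_ivp:
  assumes fl: "flow a b \<Phi> A" and ivp: "ivp_solution lam \<gamma> (\<Phi> a) (A a) a c \<Theta>"
    and c: "c \<le> b" and q: "q \<in> {a..c}"
  shows "\<Theta> q = \<Phi> q"
proof (cases "a = c")
  case True
  then show ?thesis using ivp q by (auto simp: ivp_solution_def)
next
  case False
  then have ac: "a < c" using q by auto
  then have a: "a \<in> {a..b}" using c by auto
  from ivp obtain E E2 where mono: "\<And>s. mono_on {a..c} (\<lambda>q. \<Theta> q $ s)"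
    and ode: "tree_descending_ode lam \<gamma> a c \<Theta> E E2" and tang: "\<And>q. q \<in> {a..c} \<Longrightarrow> lam \<bullet> E2 q = 0"
    and init: "\<Theta> a = \<Phi> a" "E a = A a"
    unfolding ivp_solution_def by blast
  have d\<Theta>: "(\<Theta> has_vector_derivative E q) (at q within {a..c})" if "q \<in> {a..c}" for q
    using ode that by (simp add: tree_descending_ode_def deriv_on_def)
  have dE: "(E has_vector_derivative E2 q) (at q within {a..c})" if "q \<in> {a..c}" for q
    using ode that by (simp add: tree_descending_ode_def deriv_on_def)
  have E_nonneg: "0 \<le> E q $ s" if "q \<in> {a..c}" for q s
    by (rule mono_on_derivative_nonneg[OF mono _ ac that])
      (rule bounded_linear.has_vector_derivative[OF bounded_linear_vec_nth d\<Theta>[OF that]])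
  have "((\<lambda>q. lam \<bullet> E q) has_vector_derivative 0) (at q within {a..c})" if "q \<in> {a..c}" for q
    using bounded_linear.has_vector_derivative[OF bounded_linear_inner_right dE[OF that], of lam] tang[OF that] by simp
  then obtain k where k: "\<And>q. q \<in> {a..c} \<Longrightarrow> lam \<bullet> E q = k"
    using has_vector_derivative_zero_constant[of "{a..c}" "\<lambda>q. lam \<bullet> E q"] by blast
  have "k = 1" using k[of a] ac flowD(5)[OF fl a] init by (simp add: velocity_simplex_def)
  then have E_in: "E q \<in> velocity_simplex lam" if "q \<in> {a..c}" for q
    using k[OF that] E_nonneg[OF that] by (simp add: velocity_simplex_def)
  have \<Theta>_nonneg: "0 \<le> \<Theta> q $ s" if "q \<in> {a..c}" for q s
  proof -
    have "0 \<le> \<Phi> a $ s" by (rule flowD(3)[OF fl a])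
    also have "\<dots> \<le> \<Theta> q $ s" using mono_onD[OF mono, of a q s] that init by auto
    finally show ?thesis .
  qed
  have sub: "{a..c} \<subseteq> {a..b}" using c by auto
  show ?thesis
  proof (rule flow_unique[where \<Phi> = \<Phi> and \<Theta> = \<Theta> and A = A and E = E and ?E2.0 = E2 and a = a and b = c])
    fix q assume q: "q \<in> {a..c}"
    then have qb: "q \<in> {a..b}" using sub by auto
    show "(\<Phi> has_vector_derivative A q) (at q within {a..c})"
      "(A has_vector_derivative field (\<Phi> q) (A q)) (at q within {a..c})"
      using has_vector_derivative_within_subset[OF _ sub] flowD(1,2)[OF fl qb] by blast+
    show "A q \<in> velocity_simplex lam" "0 \<le> \<Phi> q $ s \<and> \<Phi> q $ s \<le> 1" for s using flowD[OF fl qb] by blast+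
    show "E2 q = field (\<Theta> q) (E q)" if "\<Theta> q \<in> species_box"
      by (rule ode_imp_field[OF ode ac q that E_in[OF q] tang[OF q]])
  qed (use d\<Theta> dE E_in \<Theta>_nonneg init q in auto)
qed

lemma flow_norm_less:
  assumes fl: "flow a b \<Phi> A" and start: "\<And>s. \<Phi> a $ s = 1 \<Longrightarrow> A a $ s \<noteq> 0" and q: "q \<in> {a..<b}"
  shows "infnorm (\<Phi> q) < 1"
proof -
  have q': "q \<in> {a..b}" using q by auto
  have "\<Phi> q $ s < 1" for s
  proof (rule ccontr)
    assume "\<not> \<Phi> q $ s < 1"
    then have "\<Phi> q $ s = 1" using flowD(4)[OF fl q', of s] by simp
    then have "\<Phi> a $ s = 1 \<and> A a $ s = 0"
      using q flow_mono[OF fl] flowD[OF fl]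
      by (intro boundary_not_before_end[of a b \<Phi> A s q]) auto
    then show False using start by blast
  qed
  then show ?thesis using infnorm_less_1_iff flowD(3)[OF fl q'] by blast
qed

lemma flow_solved_forward:
  assumes fl: "flow a b \<Phi> A" and start: "\<And>s. \<Phi> a $ s = 1 \<Longrightarrow> A a $ s \<noteq> 0"
    and "infnorm (\<Phi> b) = 1"
  shows "solved_forward_until_boundary lam \<gamma> (\<Phi> a) (A a) a b \<Phi>"
  unfolding solved_forward_until_boundary_def
proof (intro conjI ballI allI impI)
  fix c \<Theta> q
  assume "c \<in> {a..b}" and ivp: "ivp_solution lam \<gamma> (\<Phi> a) (A a) a c \<Theta>" and q: "q \<in> {a..c}"
  then have "c \<le> b" by simp
  then show "\<Theta> q = \<Phi> q" by (rule flow_unique_ivp[OF fl ivp _ q])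
next
  fix q assume q: "q \<in> {a..<b}"
  show "infnorm (\<Phi> q) < 1" by (rule flow_norm_less[OF fl _ q]) (rule start)
qed (fact flow_ivp[OF fl] assms(3))+

lemma flow_end_unique_aux:
  assumes fl: "flow a b \<Phi> A" and fl': "flow a c \<Theta> E" and init: "\<Theta> a = \<Phi> a" "E a = A a"
    and start: "\<And>s. \<Phi> a $ s = 1 \<Longrightarrow> A a $ s \<noteq> 0"
    and "infnorm (\<Phi> b) = 1" "infnorm (\<Theta> c) = 1" and bc: "a \<le> c" "c \<le> b"
  shows "c = b \<and> (\<forall>q\<in>{a..c}. \<Theta> q = \<Phi> q)"
proof -
  have eq: "\<Theta> q = \<Phi> q" if "q \<in> {a..c}" for q
    using flow_unique_ivp[OF fl _ bc(2) that] flow_ivp[OF fl'] init by simp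
  have "\<not> c < b"
  proof
    assume "c < b"
    then have "c \<in> {a..<b}" using bc by simp
    then have "infnorm (\<Phi> c) < 1" using flow_norm_less[OF fl] start by blast
    then show False using eq[of c] bc assms(7) by simp
  qed
  then have "c = b" using bc by simp
  then show ?thesis using eq by blast
qed

lemma flow_end_unique:
  assumes "flow a b \<Phi> A" "flow a c \<Theta> E" "\<Theta> a = \<Phi> a" "E a = A a"
    and "\<And>s. \<Phi> a $ s = 1 \<Longrightarrow> A a $ s \<noteq> 0"
    and "infnorm (\<Phi> b) = 1" "infnorm (\<Theta> c) = 1" "a \<le> b" "a \<le> c"
  shows "c = b \<and> (\<forall>q\<in>{a..c}. \<Theta> q = \<Phi> q)"
proof (cases "c \<le> b")
  case True
  then show ?thesis using flow_end_unique_aux[of a b \<Phi> A c \<Theta> E] assms by simp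
next
  case False
  then show ?thesis using flow_end_unique_aux[of a c \<Theta> E b \<Phi> A] assms by auto
qed

text \<open>
  The boundary is reached by time 1, because \<open>\<langle>\<lambda>, \<Phi> 1\<rangle> = 1\<close> prevents all components from being
  below 1. Up to the first such time the clamping of positions has no effect.
\<close>

lemma flow_until_boundary_exists:
  assumes x: "\<And>s. 0 \<le> x $ s" "\<And>s. x $ s \<le> 1" and v: "v \<in> velocity_simplex lam" and a: "lam \<bullet> x = a"
  obtains b \<Phi> A where "a \<le> b" "b \<le> 1" "flow a b \<Phi> A" "\<Phi> a = x" "A a = v" "infnorm (\<Phi> b) = 1"
    "\<And>q. q \<in> {a..b} \<Longrightarrow> lam \<bullet> \<Phi> q = q"
proof -
  have "lam \<bullet> x \<le> (\<Sum>s\<in>UNIV. lam $ s)"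
    unfolding inner_vec_def inner_real_def
    by (intro sum_mono) (use x lam_pos in \<open>simp add: mult_left_le less_imp_le\<close>)
  then have a1: "a \<le> 1" using a lam_sum by simp
  obtain \<Phi> A where init: "\<Phi> a = x" "A a = v"
    and A_in: "\<And>q. q \<in> {a..1} \<Longrightarrow> A q \<in> velocity_simplex lam"
    and d\<Phi>: "\<And>q. q \<in> {a..1} \<Longrightarrow> (\<Phi> has_vector_derivative A q) (at q within {a..1})"
    and dA: "\<And>q. q \<in> {a..1} \<Longrightarrow> (A has_vector_derivative field (unit_clamp (\<Phi> q)) (A q)) (at q within {a..1})"
    using flow_exists[OF v a1, of x] by blast
  have d\<Phi>s: "((\<lambda>q. \<Phi> q $ s) has_vector_derivative A q $ s) (at q within {a..1})" if "q \<in> {a..1}" for q s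
    using bounded_linear.has_vector_derivative[OF bounded_linear_vec_nth d\<Phi>[OF that]] .
  have mono: "mono_on {a..1} (\<lambda>q. \<Phi> q $ s)" for s
    by (rule mono_on_of_derivative_nonneg[where f' = "\<lambda>q. A q $ s"])
      (use A_in d\<Phi>s in \<open>auto simp: velocity_simplex_def\<close>)
  have cont: "continuous_on {a..1} (\<lambda>q. \<Phi> q $ s)" for s
    using d\<Phi>s has_vector_derivative_continuous by (fastforce simp: continuous_on_eq_continuous_within)
  have time: "lam \<bullet> \<Phi> q = q" if q: "q \<in> {a..1}" for q
  proof -
    have "((\<lambda>q. lam \<bullet> \<Phi> q - q) has_vector_derivative 0) (at q within {a..1})" if "q \<in> {a..1}" for q
      using has_vector_derivative_diff[OF bounded_linear.has_vector_derivative[OF bounded_linear_inner_right d\<Phi>[OF that], of lam]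
          has_vector_derivative_id] A_in[OF that] by (simp add: velocity_simplex_def)
    then obtain k where k: "\<And>q. q \<in> {a..1} \<Longrightarrow> lam \<bullet> \<Phi> q - q = k"
      using has_vector_derivative_zero_constant[of "{a..1}" "\<lambda>q. lam \<bullet> \<Phi> q - q"] by blast
    show ?thesis using k[OF q] k[of a] a1 init a by simp
  qed
  define S where "S = (\<Union>s. {q \<in> {a..1}. \<Phi> q $ s \<in> {1..}})"
  have "closed {q \<in> {a..1}. \<Phi> q $ s \<in> {1..}}" for s
    using continuous_closed_preimage[OF cont, of "{1..}"] by (simp add: vimage_def Int_def)
  then have "closed S" unfolding S_def by (intro closed_UN) auto
  moreover have "bounded S" by (rule bounded_subset[of "{a..1}"]) (auto simp: S_def)
  ultimately have "compact S" by (simp add: compact_eq_bounded_closed)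
  moreover have "S \<noteq> {}"
  proof -
    have "\<exists>s. 1 \<le> \<Phi> 1 $ s"
    proof (rule ccontr)
      assume "\<nexists>s. 1 \<le> \<Phi> 1 $ s"
      then have "lam $ s * \<Phi> 1 $ s < lam $ s" for s using lam_pos[of s] by (simp add: not_le)
      then have "(\<Sum>s\<in>UNIV. lam $ s * \<Phi> 1 $ s) < (\<Sum>s\<in>UNIV. lam $ s)" by (intro sum_strict_mono) auto
      then show False using time[of 1] a1 lam_sum by (simp add: inner_vec_def)
    qed
    then show ?thesis using a1 by (auto simp: S_def)
  qed
  ultimately obtain b where b: "b \<in> S" "\<And>q. q \<in> S \<Longrightarrow> b \<le> q" using compact_attains_inf[of S] by blast
  have b1: "a \<le> b" "b \<le> 1" using b(1) by (auto simp: S_def)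
  have le1: "\<Phi> b $ s \<le> 1" for s
  proof (rule ccontr)
    assume n: "\<not> \<Phi> b $ s \<le> 1"
    have "continuous_on {a..b} (\<lambda>q. \<Phi> q $ s)" by (rule continuous_on_subset[OF cont]) (use b1 in auto)
    then obtain c where c: "a \<le> c" "c \<le> b" "\<Phi> c $ s = 1"
      using IVT'[of "\<lambda>q. \<Phi> q $ s" a 1 b] n init x(2)[of s] b1 by auto
    have "c \<in> S" using c b1 by (auto simp: S_def intro!: exI[of _ s])
    then have "c = b" using b(2) c by force
    then show False using c n by simp
  qed
  have box: "0 \<le> \<Phi> q $ s" "\<Phi> q $ s \<le> 1" if "q \<in> {a..b}" for q s
    using mono_onD[OF mono, of a q s] mono_onD[OF mono, of q b s] that b1 init x(1)[of s] le1[of s] by auto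
  have sub: "{a..b} \<subseteq> {a..1}" using b1 by auto
  have "flow a b \<Phi> A"
    unfolding flow_def
  proof (intro ballI conjI allI)
    fix q assume q: "q \<in> {a..b}"
    then have q1: "q \<in> {a..1}" using sub by auto
    show "(\<Phi> has_vector_derivative A q) (at q within {a..b})"
      by (rule has_vector_derivative_within_subset[OF d\<Phi>[OF q1] sub])
    show "(A has_vector_derivative field (\<Phi> q) (A q)) (at q within {a..b})"
      using has_vector_derivative_within_subset[OF dA[OF q1] sub] unit_clamp_id[OF box[OF q]] by simp
    show "A q \<in> velocity_simplex lam" by (rule A_in[OF q1])
  qed (use box in auto)
  moreover have "infnorm (\<Phi> b) = 1"
  proof -
    obtain s where "1 \<le> \<Phi> b $ s" using b(1) by (auto simp: S_def)
    then have "\<Phi> b $ s = 1" using le1[of s] by simp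
    then show ?thesis using infnorm_eq_1_iff[of "\<Phi> b"] box[of b] b1 by auto
  qed
  ultimately show thesis using that[of b \<Phi> A] b1 init time sub by auto
qed

lemma flow_cong:
  assumes fl: "flow a b \<Phi> A" and eq: "\<And>q. q \<in> {a..b} \<Longrightarrow> \<Theta> q = \<Phi> q"
  shows "flow a b \<Theta> A"
  unfolding flow_def
proof (intro ballI conjI allI)
  fix q assume q: "q \<in> {a..b}"
  show "(\<Theta> has_vector_derivative A q) (at q within {a..b})"
    by (rule has_vector_derivative_transform_within[OF flowD(1)[OF fl q], of 1]) (use q eq in auto)
qed (use flowD[OF fl] eq in auto)

lemma flow_Adm:
  assumes fl: "flow a b \<Phi> A" and time: "\<And>q. q \<in> {a..b} \<Longrightarrow> lam \<bullet> \<Phi> q = q"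
    and ext: "\<And>q. q \<notin> {a..b} \<Longrightarrow> \<Phi> q = (\<chi> s. undefined)"
  shows "\<Phi> \<in> Adm lam a b"
  unfolding Adm_def
proof (intro CollectI conjI allI ballI time)
  fix s
  have "continuous_on {a..b} A"
    using flowD(2)[OF fl] has_vector_derivative_continuous by (fastforce simp: continuous_on_eq_continuous_within)
  then have "continuous_on {a..b} (\<lambda>q. A q $ s)" by (intro continuous_intros)
  moreover have "deriv_on a b (\<lambda>q. \<Phi> q $ s) (\<lambda>q. A q $ s)"
    using flow_component[OF fl] by (simp add: deriv_on_def)
  ultimately show "(\<lambda>q. \<Phi> q $ s) \<in> increasing_C1 a b"
    using flow_mono[OF fl] flowD[OF fl] ext
    by (auto simp: increasing_C1_def PiE_iff extensional_def)
qed

lemma trajectory_flow: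
  assumes Adm: "\<Phi> \<in> Adm lam a b" and ode: "tree_descending_ode lam \<gamma> a b \<Phi> \<Phi>1 \<Phi>2" and "a < b"
  shows "flow a b \<Phi> \<Phi>1"
proof -
  have mono: "mono_on {a..b} (\<lambda>q. \<Phi> q $ s)" for s using Adm by (simp add: Adm_def increasing_C1_def)
  have time: "lam \<bullet> \<Phi> q = q" if "q \<in> {a..b}" for q using Adm that by (simp add: Adm_def)
  have box: "0 \<le> \<Phi> q $ s" "\<Phi> q $ s \<le> 1" if "q \<in> {a..b}" for q s
    using Adm that by (auto simp: Adm_def increasing_C1_def PiE_iff)
  have cbox: "\<Phi> q \<in> species_box" if "q \<in> {a..b}" for q
  proof -
    have "\<Phi> q $ s \<le> 3/2" for s using box(2)[OF that, of s] by linarith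
    then show ?thesis using box(1)[OF that] by (simp add: species_box_def)
  qed
  have d1: "(\<Phi> has_vector_derivative \<Phi>1 q) (at q within {a..b})"
    and d2: "(\<Phi>1 has_vector_derivative \<Phi>2 q) (at q within {a..b})" if "q \<in> {a..b}" for q
    using ode that by (simp_all add: tree_descending_ode_def deriv_on_def)
  have uniq: "D = D'" if "(f has_vector_derivative D) (at u within {a..b})"
    "(f has_vector_derivative D') (at u within {a..b})" "u \<in> {a..b}"
    for f :: "real \<Rightarrow> real" and D D' u
    using vector_derivative_unique_within_closed_interval[of a b u f D D'] that \<open>a < b\<close> by simp
  have mass: "lam \<bullet> \<Phi>1 q = 1" if q: "q \<in> {a..b}" for q
  proof (rule uniq[OF _ _ q])
    show "((\<lambda>q. lam \<bullet> \<Phi> q) has_vector_derivative lam \<bullet> \<Phi>1 q) (at q within {a..b})"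
      by (rule bounded_linear.has_vector_derivative[OF bounded_linear_inner_right d1[OF q]])
    show "((\<lambda>q. lam \<bullet> \<Phi> q) has_vector_derivative 1) (at q within {a..b})"
      by (rule has_vector_derivative_transform_within[OF has_vector_derivative_id, of 1]) (use q time in auto)
  qed
  have tang: "lam \<bullet> \<Phi>2 q = 0" if q: "q \<in> {a..b}" for q
  proof (rule uniq[OF _ _ q])
    show "((\<lambda>q. lam \<bullet> \<Phi>1 q) has_vector_derivative lam \<bullet> \<Phi>2 q) (at q within {a..b})"
      by (rule bounded_linear.has_vector_derivative[OF bounded_linear_inner_right d2[OF q]])
    show "((\<lambda>q. lam \<bullet> \<Phi>1 q) has_vector_derivative 0) (at q within {a..b})"
      by (rule has_vector_derivative_transform_within[OF has_vector_derivative_const[of 1], of 1]) (use q mass in auto)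
  qed
  have nonneg: "0 \<le> \<Phi>1 q $ s" if q: "q \<in> {a..b}" for q s
    by (rule mono_on_derivative_nonneg[OF mono _ \<open>a < b\<close> q])
      (rule bounded_linear.has_vector_derivative[OF bounded_linear_vec_nth d1[OF q]])
  have simplex: "\<Phi>1 q \<in> velocity_simplex lam" if "q \<in> {a..b}" for q
    using nonneg mass that by (simp add: velocity_simplex_def)
  have "\<Phi>2 q = field (\<Phi> q) (\<Phi>1 q)" if "q \<in> {a..b}" for q
    by (rule ode_imp_field[OF ode \<open>a < b\<close> that cbox[OF that] simplex[OF that] tang[OF that]])
  then show ?thesis unfolding flow_def using d1 d2 box simplex by simp
qed

text \<open>
  Existence and uniqueness of tree-descending trajectories with a given initial velocity \<open>v\<close>. The
  predicate \<open>W\<close> is an additional condition which, with the kernel condition at \<open>x\<close>, singles out the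
  initial velocity. Species that start at 1 are assumed to have nonzero initial velocity; if there is
  one, the trajectory consists of the starting point alone.
\<close>

lemma trajectory_existence_uniqueness:
  assumes x: "\<And>s. 0 \<le> x $ s" "\<And>s. x $ s \<le> 1" and v: "v \<in> velocity_simplex lam" and a: "lam \<bullet> x = a"
    and solvable: "solvable lam \<gamma> h x"
    and Mv: "x \<noteq> 0 \<Longrightarrow> M_sym lam \<gamma> h x *v v = 0"
    and start: "\<And>s. x $ s = 1 \<Longrightarrow> v $ s \<noteq> 0"
    and W_flow: "\<And>b \<Phi> A. a \<le> b \<Longrightarrow> flow a b \<Phi> A \<Longrightarrow> \<Phi> a = x \<Longrightarrow> A a = v \<Longrightarrow> W b \<Phi>"
    and W_init: "\<And>b \<Phi> A. a < b \<Longrightarrow> flow a b \<Phi> A \<Longrightarrow> \<Phi> a = x \<Longrightarrow> W b \<Phi> \<Longrightarrow>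
        (x \<noteq> 0 \<longrightarrow> M_sym lam \<gamma> h x *v A a = 0) \<Longrightarrow> A a = v"
  shows "(\<exists>!T. case T of (b, p, \<Phi>) \<Rightarrow> tree_descending_trajectory lam \<gamma> h x b p \<Phi> \<and> W b \<Phi>) \<and>
    (\<forall>b p \<Phi>. tree_descending_trajectory lam \<gamma> h x b p \<Phi> \<and> W b \<Phi> \<longrightarrow>
       solved_forward_until_boundary lam \<gamma> x v a b \<Phi>)"
proof -
  have traj_flow: "\<exists>A. flow a b \<Phi> A \<and> A a = v"
    if t: "tree_descending_trajectory lam \<gamma> h x b p \<Phi>" "W b \<Phi>" for b p \<Phi>
  proof -
    from t(1) obtain \<Phi>1 \<Phi>2 where ab: "a \<le> b" and Adm: "\<Phi> \<in> Adm lam a b" and init: "\<Phi> a = x"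
      and ode: "tree_descending_ode lam \<gamma> a b \<Phi> \<Phi>1 \<Phi>2"
      and M1: "x \<noteq> 0 \<longrightarrow> M_sym lam \<gamma> h x *v \<Phi>1 a = 0"
      unfolding tree_descending_trajectory_def Let_def a by auto
    show ?thesis
    proof (cases "a = b")
      case True
      \<comment> \<open>On a one-point interval every vector is a derivative.\<close>
      have bot: "at b within {b} = bot" by (simp add: trivial_limit_within islimpt_finite)
      have "flow a b \<Phi> (\<lambda>_. v)"
        unfolding flow_def using True init x v
        by (auto simp: bot has_vector_derivative_def has_derivative_def bounded_linear_scaleR_left)
      then show ?thesis by blast
    next
      case False
      then have ab: "a < b" using ab by simp
      have fl: "flow a b \<Phi> \<Phi>1" by (rule trajectory_flow[OF Adm ode ab])
      then show ?thesis using W_init[OF ab fl init t(2) M1] by blast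
    qed
  qed
  have solved: "solved_forward_until_boundary lam \<gamma> x v a b \<Phi>"
    if t: "tree_descending_trajectory lam \<gamma> h x b p \<Phi>" "W b \<Phi>" for b p \<Phi>
  proof -
    obtain A where A: "flow a b \<Phi> A" "A a = v" using traj_flow[OF t] by blast
    have "\<Phi> a = x" "infnorm (\<Phi> b) = 1" using t(1) a by (auto simp: tree_descending_trajectory_def Let_def)
    then show ?thesis using flow_solved_forward[OF A(1)] A(2) start by auto
  qed
  have unique: "b = b' \<and> p = p' \<and> \<Phi> = \<Phi>'"
    if t: "tree_descending_trajectory lam \<gamma> h x b p \<Phi>" "W b \<Phi>"
      and t': "tree_descending_trajectory lam \<gamma> h x b' p' \<Phi>'" "W b' \<Phi>'" for b p \<Phi> b' p' \<Phi>'
  proof -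
    obtain A where A: "flow a b \<Phi> A" "A a = v" using traj_flow[OF t] by blast
    obtain A' where A': "flow a b' \<Phi>' A'" "A' a = v" using traj_flow[OF t'] by blast
    have tr: "a \<le> b" "p \<in> increasing_C1 a b" "\<Phi> \<in> Adm lam a b" "\<And>q. q \<in> {a..b} \<Longrightarrow> p q = 1" "\<Phi> a = x" "infnorm (\<Phi> b) = 1"
      using t(1) by (auto simp: tree_descending_trajectory_def Let_def a)
    have tr': "a \<le> b'" "p' \<in> increasing_C1 a b'" "\<Phi>' \<in> Adm lam a b'" "\<And>q. q \<in> {a..b'} \<Longrightarrow> p' q = 1" "\<Phi>' a = x" "infnorm (\<Phi>' b') = 1"
      using t'(1) by (auto simp: tree_descending_trajectory_def Let_def a)
    have eq: "b' = b" "\<And>q. q \<in> {a..b} \<Longrightarrow> \<Phi>' q = \<Phi> q"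
      using flow_end_unique[OF A(1) A'(1)] A(2) A'(2) tr tr' start by auto
    have "p q = p' q" for q
      using tr(2,4) tr'(2,4) eq(1) by (cases "q \<in> {a..b}") (auto simp: increasing_C1_def PiE_iff extensional_def)
    moreover have "\<Phi> q $ s = \<Phi>' q $ s" for q s
      using tr(3) tr'(3) eq by (cases "q \<in> {a..b}") (auto simp: Adm_def increasing_C1_def PiE_iff extensional_def)
    ultimately show ?thesis using eq(1) by (auto simp: fun_eq_iff vec_eq_iff)
  qed
  obtain b \<Phi>0 A where b: "a \<le> b" "b \<le> 1" and fl0: "flow a b \<Phi>0 A" and init0: "\<Phi>0 a = x" and init1: "A a = v"
    and end0: "infnorm (\<Phi>0 b) = 1" and time0: "\<And>q. q \<in> {a..b} \<Longrightarrow> lam \<bullet> \<Phi>0 q = q"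
    using flow_until_boundary_exists[OF x v a] by blast
  \<comment> \<open>Members of \<open>Adm\<close> are extensional.\<close>
  define \<Phi> where "\<Phi> q = (if q \<in> {a..b} then \<Phi>0 q else (\<chi> s. undefined))" for q
  define p where "p = restrict (\<lambda>_. 1 :: real) {a..b}"
  have fl: "flow a b \<Phi> A" by (rule flow_cong[OF fl0]) (simp add: \<Phi>_def)
  have init: "\<Phi> a = x" using b init0 by (simp add: \<Phi>_def)
  have Adm: "\<Phi> \<in> Adm lam a b" by (rule flow_Adm[OF fl]) (auto simp: \<Phi>_def time0)
  have p: "p \<in> increasing_C1 a b"
  proof -
    have "deriv_on a b p (\<lambda>_. 0)"
      unfolding deriv_on_def
      by (intro ballI has_vector_derivative_transform_within[OF has_vector_derivative_const[of 1], of 1])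
        (auto simp: p_def)
    moreover have "continuous_on {a..b} (\<lambda>_. 0 :: real)" by simp
    ultimately show ?thesis unfolding increasing_C1_def
      by (auto simp: p_def mono_on_def)
  qed
  have "\<exists>\<Phi>1 \<Phi>2. tree_descending_ode lam \<gamma> a b \<Phi> \<Phi>1 \<Phi>2 \<and> (x \<noteq> 0 \<longrightarrow> M_sym lam \<gamma> h x *v \<Phi>1 a = 0)"
    using flow_ode[OF fl] Mv init1 by blast
  moreover have "infnorm (\<Phi> b) = 1" using end0 b by (simp add: \<Phi>_def)
  moreover have "\<forall>q\<in>{a..b}. p q = 1" by (simp add: p_def)
  ultimately have "tree_descending_trajectory lam \<gamma> h x b p \<Phi>"
    unfolding tree_descending_trajectory_def Let_def a
    using solvable b p Adm init by simp
  moreover have "W b \<Phi>" by (rule W_flow[OF b(1) fl init init1])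
  ultimately have "\<exists>!T. case T of (b, p, \<Phi>) \<Rightarrow> tree_descending_trajectory lam \<gamma> h x b p \<Phi> \<and> W b \<Phi>"
    using unique by (intro ex1I[of _ "(b, p, \<Phi>)"]) auto
  then show ?thesis using solved by blast
qed

end

section \<open>Semidefinite matrices with negative off-diagonal entries\<close>

lemma pos_semidef_kernel:
  assumes psd: "pos_semidef M" and zero: "v \<bullet> (M *v v) = 0"
  shows "M *v v = 0"
proof (rule ccontr)
  assume nz: "M *v v \<noteq> 0"
  define w where "w = M *v v"
  define n where "n = w \<bullet> w"
  define m where "m = w \<bullet> (M *v w)"
  have n: "0 < n" using nz by (simp add: n_def w_def)
  have m: "0 \<le> m" using psd by (simp add: pos_semidef_def m_def)
  have "v v* M = w"
    using psd transpose_matrix_vector[of M v] by (simp add: pos_semidef_def w_def)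
  then have sym: "v \<bullet> (M *v w) = n"
    using dot_lmul_matrix[of v M w] by (simp add: n_def)
  \<comment> \<open>This \<open>t\<close> makes the form negative at \<open>v + t w\<close>.\<close>
  define t where "t = - n / (m + 1)"
  have "0 \<le> (v + t *\<^sub>R w) \<bullet> (M *v (v + t *\<^sub>R w))" using psd by (simp add: pos_semidef_def)
  also have "\<dots> = 2 * t * n + t\<^sup>2 * m"
    using zero by (simp add: matrix_vector_right_distrib matrix_vector_mult_scaleR inner_add_left inner_add_right
        sym m_def[symmetric] w_def[symmetric] n_def[symmetric] power2_eq_square algebra_simps)
  also have "\<dots> = t * (2 * n + t * m)" by (simp add: power2_eq_square algebra_simps)
  also have "t * m = - n - t" using m by (simp add: t_def field_simps)
  also have "t * (2 * n + (- n - t)) < 0"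
  proof (rule mult_neg_pos)
    show "t < 0" using m n by (simp add: t_def divide_neg_pos)
    then show "0 < 2 * n + (- n - t)" using n by simp
  qed
  finally show False by simp
qed

lemma quadratic_form_eq: "v \<bullet> (M *v v) = (\<Sum>s\<in>UNIV. \<Sum>t\<in>UNIV. M $ s $ t * (v $ s * v $ t))"
  for M :: "real^'n^'n"
  by (simp add: inner_vec_def matrix_vector_mult_def sum_distrib_left mult_ac)

lemma offdiag_negative_kernel_pos:
  fixes M :: "real^'n^'n"
  assumes off: "\<And>s t. s \<noteq> t \<Longrightarrow> M $ s $ t < 0" and v: "\<And>s. 0 \<le> v $ s" "v \<noteq> 0" and ker: "M *v v = 0"
  shows "0 < v $ s"
proof (rule ccontr)
  assume "\<not> 0 < v $ s"
  then have vs: "v $ s = 0" using v(1)[of s] by simp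
  obtain t where t: "v $ t \<noteq> 0" using v(2) by (auto simp: vec_eq_iff)
  then have ts: "t \<noteq> s" "0 < v $ t" using vs v(1)[of t] by auto
  have "0 = (M *v v) $ s" using ker by simp
  also have "\<dots> = (\<Sum>u\<in>UNIV. M $ s $ u * v $ u)" by (simp add: matrix_vector_mult_def)
  also have "\<dots> < (\<Sum>u\<in>(UNIV :: 'n set). 0)"
  proof (rule sum_strict_mono_ex1)
    show "\<forall>u\<in>UNIV. M $ s $ u * v $ u \<le> 0"
    proof
      fix u show "M $ s $ u * v $ u \<le> 0"
        using off[of s u] v(1)[of u] vs by (cases "u = s") (auto intro: mult_nonpos_nonneg)
    qed
    show "\<exists>u\<in>UNIV. M $ s $ u * v $ u < 0"
      using off[of s t] ts by (intro bexI[of _ t]) (auto intro: mult_neg_pos)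
  qed simp
  finally show False by simp
qed

text \<open>
  Passing to absolute values does not increase the quadratic form, and the kernel consists of its zeros.
\<close>

lemma abs_kernel:
  fixes M :: "real^'n^'n"
  assumes psd: "pos_semidef M" and off: "\<And>s t. s \<noteq> t \<Longrightarrow> M $ s $ t < 0" and ker: "M *v u = 0"
  shows "M *v (\<chi> s. \<bar>u $ s\<bar>) = 0"
proof (rule pos_semidef_kernel[OF psd])
  have "(\<chi> s. \<bar>u $ s\<bar>) \<bullet> (M *v (\<chi> s. \<bar>u $ s\<bar>)) \<le> u \<bullet> (M *v u)"
    unfolding quadratic_form_eq
  proof (intro sum_mono)
    fix s t
    have "M $ s $ t * \<bar>u $ s * u $ t\<bar> \<le> M $ s $ t * (u $ s * u $ t)"
    proof (cases "s = t")
      case False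
      then show ?thesis using off[of s t] by (intro mult_left_mono_neg) auto
    qed simp
    then show "M $ s $ t * ((\<chi> s. \<bar>u $ s\<bar>) $ s * (\<chi> s. \<bar>u $ s\<bar>) $ t) \<le> M $ s $ t * (u $ s * u $ t)"
      by (simp add: abs_mult)
  qed
  then show "(\<chi> s. \<bar>u $ s\<bar>) \<bullet> (M *v (\<chi> s. \<bar>u $ s\<bar>)) = 0"
    using psd ker by (simp add: pos_semidef_def order.antisym)
qed

text \<open>
  The Perron-Frobenius property of singular positive semidefinite matrices with negative off-diagonal entries.
\<close>

lemma ex1_normalized_kernel_vector:
  fixes M :: "real^'n^'n"
  assumes psd: "pos_semidef M" and sing: "\<not> invertible M" and off: "\<And>s t. s \<noteq> t \<Longrightarrow> M $ s $ t < 0"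
    and lam: "\<And>s. 0 < lam $ s"
  shows "\<exists>!v. (\<forall>s. 0 \<le> v $ s) \<and> M *v v = 0 \<and> lam \<bullet> v = 1"
proof -
  obtain u where u: "u \<noteq> 0" "M *v u = 0"
    using sing unfolding invertible_left_inverse matrix_left_invertible_ker by blast
  define w where "w = (\<chi> s. \<bar>u $ s\<bar>)"
  have w: "M *v w = 0" "w \<noteq> 0" "\<And>s. 0 \<le> w $ s"
    using abs_kernel[OF psd off u(2)] u(1) by (auto simp: w_def vec_eq_iff)
  have wp: "0 < w $ s" for s by (rule offdiag_negative_kernel_pos[OF off w(3,2,1)])
  have lw: "0 < lam \<bullet> w" unfolding inner_vec_def inner_real_def
    using lam wp by (intro sum_pos) auto
  define v where "v = (1 / (lam \<bullet> w)) *\<^sub>R w"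
  have v: "(\<forall>s. 0 \<le> v $ s) \<and> M *v v = 0 \<and> lam \<bullet> v = 1"
    using w lw by (simp add: v_def matrix_vector_mult_scaleR)
  show ?thesis
  proof (rule ex1I)
    show "(\<forall>s. 0 \<le> v $ s) \<and> M *v v = 0 \<and> lam \<bullet> v = 1" by (rule v)
    fix v' assume v': "(\<forall>s. 0 \<le> v' $ s) \<and> M *v v' = 0 \<and> lam \<bullet> v' = 1"
    define d where "d = v' - v"
    have d: "M *v d = 0" "lam \<bullet> d = 0"
      using v v' by (simp_all add: d_def matrix_vector_mult_diff_distrib inner_diff_right)
    \<comment> \<open>Twice the positive part of \<open>d\<close>; as a kernel vector it is 0 or positive throughout.\<close>
    define p where "p = d + (\<chi> s. \<bar>d $ s\<bar>)"
    have p: "M *v p = 0" "\<And>s. 0 \<le> p $ s"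
      using abs_kernel[OF psd off d(1)] d(1) by (auto simp: p_def matrix_vector_right_distrib)
    have "p = 0"
    proof (rule ccontr)
      assume "p \<noteq> 0"
      have pp: "0 < p $ s" for s by (rule offdiag_negative_kernel_pos[OF off p(2) \<open>p \<noteq> 0\<close> p(1)])
      have "0 < d $ s" for s using pp[of s] by (cases "d $ s < 0") (auto simp: p_def)
      then have "0 < lam \<bullet> d" unfolding inner_vec_def inner_real_def using lam by (intro sum_pos) auto
      then show False using d by simp
    qed
    have dn: "d $ s \<le> 0" for s
    proof -
      have "p $ s = 0" using \<open>p = 0\<close> by simp
      then show ?thesis using abs_ge_zero[of "d $ s"] by (simp add: p_def)
    qed
    have "(\<Sum>s\<in>UNIV. lam $ s * (- d $ s)) = 0" using d(2) by (simp add: inner_vec_def sum_negf)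
    moreover have "0 \<le> lam $ s * (- d $ s)" for s using lam[of s] dn[of s] by (intro mult_nonneg_nonneg) auto
    ultimately have lz: "lam $ s * (- d $ s) = 0" for s by (subst (asm) sum_nonneg_eq_0_iff) auto
    have "d $ s = 0" for s using lz[of s] lam[of s] by simp
    then show "v' = v" by (simp add: d_def vec_eq_iff)
  qed
qed

section \<open>The covariance function of the model\<close>

lemma partial_eqI:
  fixes f :: "real^'n \<Rightarrow> real"
  assumes "(f has_derivative D) (at x)"
  shows "partial s f x = D (axis s 1)"
proof -
  have "((\<lambda>t. x + t *\<^sub>R axis s 1) has_vector_derivative axis s 1) (at 0)"
    by (auto intro!: derivative_eq_intros)
  from vector_derivative_diff_chain_within[OF this, of f D]
  have "((\<lambda>t. f (x + t *\<^sub>R axis s 1)) has_vector_derivative D (axis s 1)) (at 0)"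
    using has_derivative_at_withinI[OF assms] by (simp add: o_def)
  then have "((\<lambda>t. f (x + t *\<^sub>R axis s 1)) has_real_derivative D (axis s 1)) (at 0)"
    by (simp add: has_real_derivative_iff_has_vector_derivative)
  then show ?thesis unfolding partial_def by (rule DERIV_imp_deriv)
qed

lemma sum_axis_mult: "(\<Sum>t\<in>UNIV. axis s 1 $ t * f t) = (f s :: real)"
  by (simp add: axis_def if_distrib[of "\<lambda>y. y * _"] cong: if_cong)

lemma open_polydisc: "open {x :: real^'n. \<forall>s. \<bar>x $ s\<bar> < 2}"
proof -
  have "{x :: real^'n. \<forall>s. \<bar>x $ s\<bar> < 2} = (\<Inter>s. {x. \<bar>x $ s\<bar> < 2})" by auto
  then show ?thesis by (auto intro!: open_INT open_Collect_less continuous_intros)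
qed

lemma tensor_infnorm_ge:
  fixes \<gamma> :: "'s::finite list \<Rightarrow> real"
  shows "length ss = k \<Longrightarrow> \<bar>\<gamma> ss\<bar> \<le> tensor_infnorm \<gamma> k"
  unfolding tensor_infnorm_def by (rule Max_ge) auto

lemma tensor_infnorm_nonneg:
  fixes \<gamma> :: "'s::finite list \<Rightarrow> real"
  shows "0 \<le> tensor_infnorm \<gamma> k"
  using tensor_infnorm_ge[of "replicate k undefined" k \<gamma>] abs_ge_zero[of "\<gamma> (replicate k undefined)"] by simp

lemma sum_lists_weights:
  fixes lam :: "real^'s::finite"
  assumes "(\<Sum>s\<in>UNIV. lam $ s) = 1"
  shows "(\<Sum>ss | length ss = k. prod_list (map (($) lam) ss)) = 1"
proof (induction k)
  case 0
  have "{ss :: 's list. length ss = 0} = {[]}" by auto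
  then show ?case by simp
next
  case (Suc k)
  then show ?case using assms
    by (simp add: sum_lists_Suc sum_distrib_left[symmetric])
qed

text \<open>
  Normalised weights and a symmetric, summable and non-degenerate family of tensors.
\<close>

locale tensor_model =
  fixes lam :: "real^'s::finite" and \<gamma> :: "'s list \<Rightarrow> real"
  assumes weights_pos: "0 < lam $ s"
    and weights_sum: "(\<Sum>s\<in>UNIV. lam $ s) = 1"
    and gamma_sym: "symmetric_tensors \<gamma>"
    and gamma_summable: "summable (\<lambda>k. 2 ^ (k + 2) * tensor_infnorm \<gamma> (k + 2))"
    and nondeg: "nondegenerate \<gamma>"
begin

text \<open>
  The word coefficients of \<open>\<xi>\<close>.
\<close>

definition coef :: "'s list \<Rightarrow> real" where
  "coef ss = (if length ss < 2 then 0 else (\<gamma> ss)\<^sup>2 * prod_list (map (($) lam) ss))"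

text \<open>
  On the domain of convergence \<open>D1 s\<close> is \<open>\<partial>\<^sub>s \<xi>\<close> and \<open>D2 s t\<close> is \<open>\<partial>\<^sub>t \<partial>\<^sub>s \<xi>\<close>.
\<close>

abbreviation "D1 s \<equiv> list_series (dcoef s coef)"
abbreviation "D2 s t \<equiv> list_series (dcoef t (dcoef s coef))"

lemma coef_nonneg: "0 \<le> coef ss"
proof -
  have "0 \<le> prod_list (map (($) lam) ss)" using weights_pos by (intro prod_list_nonneg) (auto simp: less_imp_le)
  then show ?thesis by (simp add: coef_def)
qed

lemma coef_pos: "length ss = 2 \<or> length ss = 3 \<Longrightarrow> 0 < coef ss"
proof -
  assume len: "length ss = 2 \<or> length ss = 3"
  have "0 < prod_list (map (($) lam) ss)" using weights_pos by (induction ss) auto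
  then show ?thesis using len nondeg by (auto simp: coef_def nondegenerate_def)
qed

lemma coef_sym: "sym_coef coef"
  unfolding sym_coef_def
proof (intro allI impI)
  fix ss ts :: "'s list" assume eq: "mset ss = mset ts"
  have len: "length ss = length ts" using eq by (metis size_mset)
  have "prod_list (map (($) lam) ss) = prod_list (map (($) lam) ts)"
    using eq by (metis mset_map prod_mset_prod_list)
  moreover have "2 \<le> length ss \<Longrightarrow> \<gamma> ss = \<gamma> ts"
    using gamma_sym eq by (auto simp: symmetric_tensors_def)
  ultimately show "coef ss = coef ts" using len by (simp add: coef_def)
qed

text \<open>
  Since \<open>\<Sum>\<lambda>\<^sub>s = 1\<close>, the coefficients of degree \<open>k\<close> have total size at most \<open>\<parallel>\<Gamma>\<^sup>(\<^sup>k\<^sup>)\<parallel>\<^sup>2\<close>, and one of the two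
  factors is bounded while the other one is summable with weights \<open>2 ^ k\<close>.
\<close>

lemma coef_conv: "conv_coef coef"
  unfolding conv_coef_def
proof (intro allI impI)
  fix R :: real assume R: "\<bar>R\<bar> < 2"
  define g where "g k = tensor_infnorm \<gamma> k" for k
  have g0: "0 \<le> g k" for k by (simp add: g_def tensor_infnorm_nonneg)
  have summ: "summable (\<lambda>k. 2 ^ (k + 2) * g (k + 2))" using gamma_summable by (simp add: g_def)
  from summable_imp_Bseq[OF this] obtain K where K: "\<And>k. norm (2 ^ (k + 2) * g (k + 2)) \<le> K"
    unfolding Bseq_def by blast
  have gK: "g (k + 2) \<le> K" for k
  proof -
    have "1 * g (k + 2) \<le> 2 ^ (k + 2) * g (k + 2)" by (intro mult_right_mono g0 one_le_power) simp
    then show ?thesis using K[of k] by simp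
  qed
  have "summable (\<lambda>k. (\<Sum>ss | length ss = k + 2. \<bar>coef ss\<bar>) * R ^ (k + 2))"
  proof (rule summable_comparison_test')
    show "summable (\<lambda>k. K * (2 ^ (k + 2) * g (k + 2)))" by (intro summable_mult summ)
    fix k :: nat
    have "(\<Sum>ss | length ss = k + 2. \<bar>coef ss\<bar>) \<le>
        (\<Sum>ss | length ss = k + 2. (g (k + 2))\<^sup>2 * prod_list (map (($) lam) ss))"
    proof (rule sum_mono)
      fix ss :: "'s list" assume ss: "ss \<in> {ss. length ss = k + 2}"
      have p: "0 \<le> prod_list (map (($) lam) ss)" using weights_pos by (intro prod_list_nonneg) (auto simp: less_imp_le)
      have "(\<gamma> ss)\<^sup>2 \<le> (g (k + 2))\<^sup>2"
        using tensor_infnorm_ge[of ss "k + 2" \<gamma>] ss by (intro abs_le_square_iff[THEN iffD1]) (simp add: g_def)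
      then show "\<bar>coef ss\<bar> \<le> (g (k + 2))\<^sup>2 * prod_list (map (($) lam) ss)"
        using p ss coef_nonneg[of ss] by (simp add: coef_def mult_right_mono)
    qed
    also have "\<dots> = (g (k + 2))\<^sup>2"
      by (simp only: sum_distrib_left[symmetric] sum_lists_weights[OF weights_sum] mult_1_right)
    finally have le: "(\<Sum>ss | length ss = k + 2. \<bar>coef ss\<bar>) \<le> (g (k + 2))\<^sup>2" .
    have "norm ((\<Sum>ss | length ss = k + 2. \<bar>coef ss\<bar>) * R ^ (k + 2))
        = (\<Sum>ss | length ss = k + 2. \<bar>coef ss\<bar>) * \<bar>R\<bar> ^ (k + 2)"
      by (simp add: abs_mult power_abs sum_nonneg)
    also have "\<dots> \<le> (g (k + 2))\<^sup>2 * 2 ^ (k + 2)"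
      using R by (intro mult_mono le power_mono) (auto simp: sum_nonneg)
    also have "\<dots> = g (k + 2) * (2 ^ (k + 2) * g (k + 2))" by (simp add: power2_eq_square)
    also have "\<dots> \<le> K * (2 ^ (k + 2) * g (k + 2))" using gK g0 by (intro mult_right_mono) auto
    finally show "norm ((\<Sum>ss | length ss = k + 2. \<bar>coef ss\<bar>) * R ^ (k + 2)) \<le> K * (2 ^ (k + 2) * g (k + 2))" .
  qed
  then show "summable (\<lambda>k. (\<Sum>ss | length ss = k. \<bar>coef ss\<bar>) * R ^ k)"
    using summable_iff_shift[of "\<lambda>k. (\<Sum>ss | length ss = k. \<bar>coef ss\<bar>) * R ^ k" 2] by simp
qed

lemma xi_eq: "(\<And>s. \<bar>x $ s\<bar> < 2) \<Longrightarrow> xi lam \<gamma> x = list_series coef x"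
proof -
  assume x: "\<And>s. \<bar>x $ s\<bar> < 2"
  have "(\<Sum>ss | length ss = k + 2. (\<gamma> ss)\<^sup>2 * prod_list (map (\<lambda>s. lam $ s * x $ s) ss)) = hom_poly coef (k + 2) x" for k
    unfolding hom_poly_def
  proof (rule sum.cong)
    fix ss :: "'s list" assume "ss \<in> {ss. length ss = k + 2}"
    moreover have "prod_list (map (\<lambda>s. lam $ s * x $ s) ss) = prod_list (map (($) lam) ss) * prod_list (map (($) x) ss)"
      by (induction ss) auto
    ultimately show "(\<gamma> ss)\<^sup>2 * prod_list (map (\<lambda>s. lam $ s * x $ s) ss) = coef ss * prod_list (map (($) x) ss)"
      by (simp add: coef_def)
  qed simp
  then have "xi lam \<gamma> x = (\<Sum>k. hom_poly coef (k + 2) x)" by (simp add: xi_def)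
  moreover have "hom_poly coef k x = 0" if "k < 2" for k
    using that by (simp add: hom_poly_def coef_def)
  ultimately show ?thesis
    using suminf_split_initial_segment[OF list_series_summable[OF coef_conv x], of 2]
    by (simp add: list_series_def)
qed

lemma partial_xi:
  assumes x: "\<And>s. \<bar>x $ s\<bar> < 2"
  shows "partial s (xi lam \<gamma>) x = D1 s x"
proof -
  have "(xi lam \<gamma> has_derivative (\<lambda>v. \<Sum>s\<in>UNIV. v $ s * D1 s x)) (at x)"
    by (rule has_derivative_transform_within_open[OF list_series_has_derivative[OF coef_sym coef_conv x] open_polydisc])
      (use x in \<open>auto simp: xi_eq\<close>)
  from partial_eqI[OF this, of s] show ?thesis by (simp add: sum_axis_mult)
qed

lemma partial_xi_has_derivative:
  assumes x: "\<And>s. \<bar>x $ s\<bar> < 2"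
  shows "(partial s (xi lam \<gamma>) has_derivative (\<lambda>v. \<Sum>t\<in>UNIV. v $ t * D2 s t x)) (at x)"
  by (rule has_derivative_transform_within_open[OF
        list_series_has_derivative[OF sym_coef_dcoef[OF coef_sym] conv_coef_dcoef[OF coef_conv] x] open_polydisc])
    (use x in \<open>auto simp: partial_xi\<close>)

lemma partial_partial_xi:
  assumes x: "\<And>s. \<bar>x $ s\<bar> < 2"
  shows "partial s (partial t (xi lam \<gamma>)) x = D2 t s x"
  using partial_eqI[OF partial_xi_has_derivative[OF x], of s t] by (simp add: sum_axis_mult)

lemma D2_pos:
  assumes "\<And>s. 0 \<le> x $ s" "\<And>s. x $ s < 2"
  shows "0 < D2 s t x"
proof (rule list_series_pos[OF conv_coef_dcoef[OF conv_coef_dcoef[OF coef_conv]] assms])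
  show "0 \<le> dcoef t (dcoef s coef) ss" for ss by (intro dcoef_nonneg coef_nonneg)
  show "0 < dcoef t (dcoef s coef) []" using coef_pos[of "[s, t]"] by (simp add: dcoef_def)
qed

lemma D2_commute: "D2 s t = D2 t s"
  by (simp add: dcoef_commute[OF coef_sym])

sublocale species_model lam \<gamma> "\<lambda>s t x. D2 s t x / lam $ s"
  "\<lambda>s t u x. list_series (dcoef u (dcoef t (dcoef s coef))) x / lam $ s"
proof
  fix s t u :: 's and x :: "real^'s"
  show "0 < lam $ s" "(\<Sum>s\<in>UNIV. lam $ s) = 1" by (rule weights_pos weights_sum)+
  have S: "sym_coef (dcoef s coef)" "sym_coef (dcoef t (dcoef s coef))" "sym_coef (dcoef u (dcoef t (dcoef s coef)))"
    by (intro sym_coef_dcoef coef_sym)+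
  have V: "conv_coef (dcoef s coef)" "conv_coef (dcoef t (dcoef s coef))" "conv_coef (dcoef u (dcoef t (dcoef s coef)))"
    by (intro conv_coef_dcoef coef_conv)+
  have L: "Lipschitz_on species_box (\<lambda>x. list_series c x / lam $ s)" if "sym_coef c" "conv_coef c" for c
    using Lipschitz_on_cmult[of species_box "list_series c" "1 / lam $ s"] list_series_lipschitz_on_box[OF that]
    by (simp add: Lipschitz_on_def species_box_def)
  show "Lipschitz_on species_box (\<lambda>x. D2 s t x / lam $ s)" by (rule L[OF S(2) V(2)])
  show "Lipschitz_on species_box (\<lambda>x. list_series (dcoef u (dcoef t (dcoef s coef))) x / lam $ s)" by (rule L[OF S(3) V(3)])
  show "(xi_species lam \<gamma> s has_derivative (\<lambda>v. \<Sum>t\<in>UNIV. v $ t * (D2 s t x / lam $ s))) (at x)"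
    if "\<And>t. \<bar>x $ t\<bar> < 2"
    using has_derivative_mult_left[OF partial_xi_has_derivative[OF that], of s "1 / lam $ s"]
    by (simp add: xi_species_def[abs_def] sum_divide_distrib)
  show "((\<lambda>x. D2 s t x / lam $ s) has_derivative
      (\<lambda>v. \<Sum>u\<in>UNIV. v $ u * (list_series (dcoef u (dcoef t (dcoef s coef))) x / lam $ s))) (at x)"
    if "\<And>t. \<bar>x $ t\<bar> < 2"
    using has_derivative_mult_left[OF list_series_has_derivative[OF S(2) V(2) that], of "1 / lam $ s"]
    by (simp add: sum_divide_distrib)
  assume x: "x \<in> species_box"
  have x': "0 \<le> x $ r" "x $ r < 2" for r
  proof -
    have "0 \<le> x $ r \<and> x $ r \<le> 3/2" using x by (simp add: species_box_def)
    then show "0 \<le> x $ r" "x $ r < 2" by auto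
  qed
  show "0 < D2 s t x / lam $ s" using D2_pos[OF x'] weights_pos by simp
  show "lam $ s * (D2 s t x / lam $ s) = lam $ t * (D2 t s x / lam $ t)"
    using weights_pos[of s] weights_pos[of t] D2_commute[of s t] by simp
qed

lemma unit_cubeD:
  assumes "x \<in> unit_cube"
  shows "0 < x $ s" "x $ s \<le> 1" "\<bar>x $ s\<bar> < 2" "0 \<le> x $ s" "x $ s < 2"
proof -
  have "0 < x $ s \<and> x $ s \<le> 1" using assms by (simp add: unit_cube_def)
  then show "0 < x $ s" "x $ s \<le> 1" "\<bar>x $ s\<bar> < 2" "0 \<le> x $ s" "x $ s < 2" by auto
qed

lemma M_sym_offdiag: "x \<in> unit_cube \<Longrightarrow> s \<noteq> t \<Longrightarrow> M_sym lam \<gamma> h x $ s $ t < 0"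
  using D2_pos[of x s t] unit_cubeD[of x] by (simp add: M_sym_def partial_partial_xi)

text \<open>
  By Euler's identity the two sides differ by a series with nonnegative terms: \<open>\<partial>\<^sub>s \<xi>\<close> has no constant
  term, its linear part contributes equally to both sides, and its quadratic part is positive because
  the entries of \<open>\<Gamma>\<^sup>(\<^sup>3\<^sup>)\<close> are.
\<close>

lemma euler_strict:
  assumes x: "x \<in> unit_cube"
  shows "D1 s x < (\<Sum>t\<in>UNIV. x $ t * D2 s t x)"
proof -
  let ?c = "dcoef s coef"
  have conv: "conv_coef ?c" by (rule conv_coef_dcoef[OF coef_conv])
  have nonneg: "0 \<le> hom_poly ?c k x" for k
    using unit_cubeD(4)[OF x] by (intro hom_poly_nonneg dcoef_nonneg coef_nonneg)
  have "(\<lambda>k. \<Sum>t\<in>UNIV. x $ t * hom_poly (dcoef t ?c) k x) sums (\<Sum>t\<in>UNIV. x $ t * D2 s t x)"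
    unfolding list_series_def
    by (intro sums_sum sums_mult summable_sums list_series_summable conv_coef_dcoef conv unit_cubeD(3)[OF x])
  then have 1: "(\<lambda>k. real (Suc k) * hom_poly ?c (Suc k) x) sums (\<Sum>t\<in>UNIV. x $ t * D2 s t x)"
    by (simp only: hom_poly_euler)
  have "(\<lambda>k. hom_poly ?c k x) sums D1 s x"
    unfolding list_series_def by (intro summable_sums list_series_summable conv unit_cubeD(3)[OF x])
  moreover have "hom_poly ?c 0 x = 0" by (simp add: dcoef_def coef_def)
  ultimately have 2: "(\<lambda>k. hom_poly ?c (Suc k) x) sums D1 s x" using sums_Suc_iff[of "\<lambda>k. hom_poly ?c k x"] by simp
  have 3: "(\<lambda>k. real k * hom_poly ?c (Suc k) x) sums ((\<Sum>t\<in>UNIV. x $ t * D2 s t x) - D1 s x)"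
    using sums_diff[OF 1 2] by (simp add: algebra_simps)
  have "0 < hom_poly ?c 2 x"
    using unit_cubeD(1)[OF x] by (intro hom_poly_pos) (auto simp: dcoef_def intro!: mult_pos_pos coef_pos)
  then have "0 < (\<Sum>k. real k * hom_poly ?c (Suc k) x)"
    using nonneg by (intro suminf_pos2[OF sums_summable[OF 3], of 1]) (auto simp: numeral_2_eq_2)
  then show ?thesis using sums_unique[OF 3] by simp
qed

text \<open>
  For \<open>h = 0\<close> the quadratic form is negative at \<open>x\<close> itself.
\<close>

lemma not_solvable_without_field:
  assumes x: "x \<in> unit_cube"
  shows "\<not> pos_semidef (M_sym lam \<gamma> 0 x)"
proof
  assume psd: "pos_semidef (M_sym lam \<gamma> 0 x)"
  have Mx: "(M_sym lam \<gamma> 0 x *v x) $ s = D1 s x - (\<Sum>t\<in>UNIV. x $ t * D2 s t x)" for s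
  proof -
    have "(M_sym lam \<gamma> 0 x *v x) $ s
        = (\<Sum>t\<in>UNIV. (if s = t then D1 s x / x $ s * x $ t else 0) - x $ t * D2 s t x)"
      using unit_cubeD[OF x] unfolding matrix_vector_mult_def
      by (auto simp: M_sym_def partial_xi partial_partial_xi D2_commute[of _ s] left_diff_distrib
          intro!: sum.cong)
    then show ?thesis using unit_cubeD(1)[OF x, of s] by (simp add: sum_subtractf)
  qed
  have "x \<bullet> (M_sym lam \<gamma> 0 x *v x) = (\<Sum>s\<in>UNIV. x $ s * (D1 s x - (\<Sum>t\<in>UNIV. x $ t * D2 s t x)))"
    by (simp add: inner_vec_def Mx)
  also have "\<dots> < (\<Sum>s\<in>(UNIV :: 's set). 0)"
    using euler_strict[OF x] unit_cubeD(1)[OF x] by (intro sum_strict_mono) (auto intro: mult_pos_neg)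
  finally show False using psd by (simp add: pos_semidef_def not_less[symmetric])
qed

end

section \<open>Tree-descending trajectories from a solvable point\<close>

theorem proposition1p7:
  fixes lam h x :: "real^'s::finite"
    and \<gamma> :: "'s list \<Rightarrow> real"
    and q1 :: real
  assumes lam_pos: "\<forall>s. 0 < lam $ s"
    and lam_sum: "(\<Sum>s\<in>UNIV. lam $ s) = 1"
    and h_nonneg: "\<forall>s. 0 \<le> h $ s"
    and gamma_nonneg: "\<forall>ss. 2 \<le> length ss \<longrightarrow> 0 \<le> \<gamma> ss"
    and gamma_sym: "symmetric_tensors \<gamma>"
    and gamma_summable: "summable (\<lambda>k. 2 ^ (k + 2) * tensor_infnorm \<gamma> (k + 2))"
    and nondeg: "nondegenerate \<gamma>"
    and x_mem: "x \<in> unit_cube \<union> {0}"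
    and x_solvable: "solvable lam \<gamma> h x"
    and q1: "lam \<bullet> x = q1"
  shows "(h \<noteq> 0 \<longrightarrow>
            x \<in> unit_cube \<and> 0 < q1 \<and>
            (\<exists>!v. (\<forall>s. 0 \<le> v $ s) \<and> M_sym lam \<gamma> h x *v v = 0 \<and> lam \<bullet> v = 1) \<and>
            (\<exists>!T. case T of (q2, p, \<Phi>) \<Rightarrow> tree_descending_trajectory lam \<gamma> h x q2 p \<Phi>) \<and>
            (\<forall>v q2 p \<Phi>.
               (\<forall>s. 0 \<le> v $ s) \<and> M_sym lam \<gamma> h x *v v = 0 \<and> lam \<bullet> v = 1 \<and>
               tree_descending_trajectory lam \<gamma> h x q2 p \<Phi>
               \<longrightarrow> solved_forward_until_boundary lam \<gamma> x v q1 q2 \<Phi>)) \<and>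
         (h = 0 \<longrightarrow>
            x = 0 \<and> q1 = 0 \<and>
            (\<forall>v. (\<forall>s. 0 \<le> v $ s) \<and> lam \<bullet> v = 1 \<longrightarrow>
               (\<exists>!T. case T of (q2, p, \<Phi>) \<Rightarrow>
                  tree_descending_trajectory lam \<gamma> h 0 q2 p \<Phi> \<and>
                  \<Phi> 0 = 0 \<and> (\<Phi> has_vector_derivative v) (at 0 within {0..q2})) \<and>
               (\<forall>q2 p \<Phi>.
                  tree_descending_trajectory lam \<gamma> h 0 q2 p \<Phi> \<and>
                  \<Phi> 0 = 0 \<and> (\<Phi> has_vector_derivative v) (at 0 within {0..q2})
                  \<longrightarrow> solved_forward_until_boundary lam \<gamma> 0 v 0 q2 \<Phi>)))"
proof -
  interpret tensor_model lam \<gamma>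
    by unfold_locales (use lam_pos lam_sum gamma_sym gamma_summable nondeg in auto)
  show ?thesis
  proof (intro conjI impI)
    assume h: "h \<noteq> 0"
    then have cube: "x \<in> unit_cube" and psd: "pos_semidef (M_sym lam \<gamma> h x)"
      and sing: "\<not> invertible (M_sym lam \<gamma> h x)"
      using x_solvable by (auto simp: solvable_def)
    show "x \<in> unit_cube" by (rule cube)
    show "0 < q1" unfolding q1[symmetric] inner_vec_def inner_real_def
      using lam_pos unit_cubeD(1)[OF cube] by (intro sum_pos) auto
    show ex1: "\<exists>!v. (\<forall>s. 0 \<le> v $ s) \<and> M_sym lam \<gamma> h x *v v = 0 \<and> lam \<bullet> v = 1"
      using lam_pos by (intro ex1_normalized_kernel_vector psd sing M_sym_offdiag cube) auto
    then obtain v where v: "\<And>s. 0 \<le> v $ s" "M_sym lam \<gamma> h x *v v = 0" "lam \<bullet> v = 1"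
      and v_unique: "\<And>w. (\<And>s. 0 \<le> w $ s) \<Longrightarrow> M_sym lam \<gamma> h x *v w = 0 \<Longrightarrow> lam \<bullet> w = 1 \<Longrightarrow> w = v"
      by metis
    have "v \<noteq> 0" using v(3) by auto
    have v_pos: "0 < v $ s" for s
      by (rule offdiag_negative_kernel_pos[OF M_sym_offdiag[OF cube] v(1) \<open>v \<noteq> 0\<close> v(2)])
    have x_nz: "x \<noteq> 0" using unit_cubeD(1)[OF cube, of undefined] by auto
    have main: "(\<exists>!T. case T of (b, p, \<Phi>) \<Rightarrow> tree_descending_trajectory lam \<gamma> h x b p \<Phi> \<and> True) \<and>
      (\<forall>b p \<Phi>. tree_descending_trajectory lam \<gamma> h x b p \<Phi> \<and> True \<longrightarrow>
         solved_forward_until_boundary lam \<gamma> x v q1 b \<Phi>)"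
    proof (rule trajectory_existence_uniqueness[OF unit_cubeD(4)[OF cube] unit_cubeD(2)[OF cube] _ q1 x_solvable v(2)])
      show "v \<in> velocity_simplex lam" using v by (simp add: velocity_simplex_def)
      show "v $ s \<noteq> 0" for s using v_pos[of s] by simp
      fix b \<Phi> A
      assume "q1 < b" and fl: "flow q1 b \<Phi> A" and "x \<noteq> 0 \<longrightarrow> M_sym lam \<gamma> h x *v A q1 = 0"
      then show "A q1 = v"
        using flowD(5)[OF fl, of q1] x_nz by (intro v_unique) (auto simp: velocity_simplex_def)
    qed simp_all
    then show "\<exists>!T. case T of (q2, p, \<Phi>) \<Rightarrow> tree_descending_trajectory lam \<gamma> h x q2 p \<Phi>" by simp
    show "\<forall>v q2 p \<Phi>. (\<forall>s. 0 \<le> v $ s) \<and> M_sym lam \<gamma> h x *v v = 0 \<and> lam \<bullet> v = 1 \<and>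
        tree_descending_trajectory lam \<gamma> h x q2 p \<Phi> \<longrightarrow> solved_forward_until_boundary lam \<gamma> x v q1 q2 \<Phi>"
      using main v_unique by blast
  next
    assume h: "h = 0"
    show x0: "x = 0"
      using x_solvable not_solvable_without_field[of x] h by (auto simp: solvable_def)
    show q0: "q1 = 0" using q1 x0 by simp
    show "\<forall>v. (\<forall>s. 0 \<le> v $ s) \<and> lam \<bullet> v = 1 \<longrightarrow>
               (\<exists>!T. case T of (q2, p, \<Phi>) \<Rightarrow>
                  tree_descending_trajectory lam \<gamma> h 0 q2 p \<Phi> \<and>
                  \<Phi> 0 = 0 \<and> (\<Phi> has_vector_derivative v) (at 0 within {0..q2})) \<and>
               (\<forall>q2 p \<Phi>.
                  tree_descending_trajectory lam \<gamma> h 0 q2 p \<Phi> \<and>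
                  \<Phi> 0 = 0 \<and> (\<Phi> has_vector_derivative v) (at 0 within {0..q2})
                  \<longrightarrow> solved_forward_until_boundary lam \<gamma> 0 v 0 q2 \<Phi>)"
    proof (intro allI impI, rule trajectory_existence_uniqueness)
      fix v assume v: "(\<forall>s. 0 \<le> v $ s) \<and> lam \<bullet> v = 1"
      show "v \<in> velocity_simplex lam" using v by (simp add: velocity_simplex_def)
      show "solvable lam \<gamma> h 0" using x_solvable x0 by simp
      show "\<Phi> 0 = 0 \<and> (\<Phi> has_vector_derivative v) (at 0 within {0..b})"
        if "0 \<le> b" "flow 0 b \<Phi> A" "\<Phi> 0 = 0" "A 0 = v" for b \<Phi> A
        using flowD(1)[OF that(2), of 0] that by auto
      show "A 0 = v"
        if "0 < b" "flow 0 b \<Phi> A" "\<Phi> 0 = 0 \<and> (\<Phi> has_vector_derivative v) (at 0 within {0..b})" for b \<Phi> A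
        using flowD(1)[OF that(2), of 0] that
          vector_derivative_unique_within_closed_interval[of 0 b 0 \<Phi> "A 0" v] by auto
    qed simp_all
  qed
qed

end
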